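(* Let $\Lambda$ be a row-finite $k$-graph with no sources and let $R$ be a commutative ring with identity. Suppose that $\Lambda$ is strongly aperiodic. (1) Suppose that $I$ is an ideal in $\operatorname{KP}_R(\Lambda)$. Then $$I= \operatorname{span}_R\{rs_{\lambda}s_{\mu^*}: r\in R,\ \lambda,\mu\in\Lambda,\ rp_{s(\mu)} \in I\}.$$ (2) Let $\mathcal{H}_\Lambda$ be the set of all saturated hereditary subsets of $\Lambda^0$, let $\mathcal{L}(R)$ be the set of ideals of $R$ and let $\mathcal{F}$ be the set of all functions $\pi:\mathcal{H}_\Lambda \to \mathcal{L}(R)$ such that $$\pi\Big(\bigvee_{H \in \mathcal{A}}H\Big) = \bigcap_{H \in \mathcal{A}}\pi(H)\quad\text{ for all } \mathcal{A} \subseteq \mathcal{H}_\Lambda.$$ Then the map $\Gamma$ from $\mathcal{F}$ to the set $\mathcal{L}(\operatorname{KP}_R(\Lambda))$ of ideals of $\operatorname{KP}_R(\Lambda)$ given by $$\Gamma(\pi) = \operatorname{span}_R\{rs_{\mu}s_{\nu^*} : \text{ there exists }H \in \mathcal{H}_{\Lambda} \text{ such that } r \in \pi(H) \text{ and } s_{\mu}s_{\nu^*} \in I_H\}$$ is a bijection. (3) Let $\pi_1,\pi_2\in\mathcal{F}$. Then $\Gamma(\pi_1) \subseteq \Gamma(\pi_2)$ if and only if $\pi_1(H) \subseteq \pi_2(H)$ for all $H \in \mathcal{H}_\Lambda$.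
   Context: $k$-graphs. Let $k\ge1$. A $k$-graph is a countable category $\Lambda$ with objects $\Lambda^0$ (identified with identity morphisms), codomain and domain maps $r,s:\Lambda\to\Lambda^0$, and a functor $d:\Lambda\to\mathbb{N}^k$ with the factorisation property: if $d(\lambda)=m+n$ then there are unique $\mu,\nu\in\Lambda$ with $d(\mu)=m$, $d(\nu)=n$, $\lambda=\mu\nu$. Composites $\mu\nu$ are defined when $s(\mu)=r(\nu)$. $v\Lambda^n=\{\lambda: r(\lambda)=v, d(\lambda)=n\}$. $\Lambda$ is row-finite if every $v\Lambda^n$ is finite and has no sources if every $v\Lambda^n$ is nonempty ($v\in\Lambda^0$, $n\in\mathbb{N}^k$). $H\subseteq\Lambda^0$ is hereditary if $r(\lambda)\in H$ implies $s(\lambda)\in H$, and saturated if $v\in H$ whenever $s(v\Lambda^n)\subseteq H$ for some $n\in\mathbb{N}^k$. For $\mathcal{A}\subseteq\mathcal{H}_\Lambda$, $\bigvee_{H\in\mathcal{A}}H$ is the smallest saturated hereditary set containing every $H\in\mathcal{A}$. The case $\mathcal{A}=\emptyset$ is included: the empty join is $\emptyset$ and the empty intersection is $R$, so $\pi(\emptyset)=R$. Aperiodicity. $\Omega_k$ is the $k$-graph with objects $\mathbb{N}^k$, morphisms $\{(p,q): p\le q\}$, $r(p,q)=p$, $s(p,q)=q$, $(p,q)(q,t)=(p,t)$, $d(p,q)=q-p$. An infinite path is a degree-preserving functor $x:\Omega_k\to\Lambda$; its range is $x(0,0)$; $\sigma^p(x)(m,n)=x(m+p,n+p)$. $\Lambda$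 is aperiodic if for every $v\in\Lambda^0$ there is an infinite path $x$ with range $v$ such that $\sigma^m(x)\ne\sigma^n(x)$ for all distinct $m,n\in\mathbb{N}^k$. For saturated hereditary $H\ne\Lambda^0$, $\Lambda\setminus \Lambda H=\{\lambda\in\Lambda:s(\lambda)\notin H\}$ is a $k$-graph with vertices $\Lambda^0\setminus H$; $\Lambda$ is strongly aperiodic if all of these are aperiodic. Kumjian–Pask algebra. $\operatorname{KP}_R(\Lambda)$ is the universal $R$-algebra generated by $p_v$ ($v\in\Lambda^0$) and $s_\lambda,s_{\lambda^*}$ ($\lambda\in\Lambda$, $d(\lambda)\neq 0$), with $s_v=s_{v^*}=p_v$ for vertices, such that: the $p_v$ are mutually orthogonal idempotents; whenever $s(\lambda)=r(\mu)$, $s_\lambda s_\mu=s_{\lambda\mu}$ and $s_{\mu^*}s_{\lambda^*}=s_{(\lambda\mu)^*}$ (in particular $p_{r(\lambda)}s_\lambda=s_\lambda=s_\lambda p_{s(\lambda)}$ and $p_{s(\lambda)}s_{\lambda^*}=s_{\lambda^*}=s_{\lambda^*}p_{r(\lambda)}$); $s_{\lambda^*}s_\mu=\delta_{\lambda,\mu}p_{s(\lambda)}$ whenever $d(\lambda)=d(\mu)$; and $p_v=\sum_{\lambda\in v\Lambda^n}s_\lambda s_{\lambda^*}$ for all $v\in\Lambda^0$, $n\in\mathbb{N}^k$. For $H\in\mathcal{H}_\Lambda$, $I_H$ is the ideal generated by $\{p_v:v\in H\}$. Ideals are two-sided. *)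

theory Defs
  imports "HOL-Analysis.Analysis" "HOL-Library.Poly_Mapping"
begin

section \<open>Higher-rank graphs\<close>

text \<open>
  Degrees live in \<open>nat ^ 'k\<close> with its pointwise addition and order, so \<open>k = CARD('k) \<ge> 1\<close>.
  Categories are given by their morphisms; an object is identified with its identity morphism,
  so \<open>obj\<close> is a subset of \<open>mor\<close>. The value of \<open>cmp\<close> on a non-composable pair is irrelevant.
\<close>

record ('m, 'k) kgraph =
  mor :: "'m set"
  obj :: "'m set"
  rng :: "'m \<Rightarrow> 'm"
  src :: "'m \<Rightarrow> 'm"
  cmp :: "'m \<Rightarrow> 'm \<Rightarrow> 'm"
  deg :: "'m \<Rightarrow> nat ^ 'k"

locale kgraph =
  fixes \<Lambda> :: "('m, 'k::finite) kgraph"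
  assumes obj_sub: "obj \<Lambda> \<subseteq> mor \<Lambda>"
    and countable_mor: "countable (mor \<Lambda>)"
    and rng_obj: "x \<in> mor \<Lambda> \<Longrightarrow> rng \<Lambda> x \<in> obj \<Lambda>"
    and src_obj: "x \<in> mor \<Lambda> \<Longrightarrow> src \<Lambda> x \<in> obj \<Lambda>"
    and rng_id: "v \<in> obj \<Lambda> \<Longrightarrow> rng \<Lambda> v = v"
    and src_id: "v \<in> obj \<Lambda> \<Longrightarrow> src \<Lambda> v = v"
    and cmp_mor: "\<lbrakk>x \<in> mor \<Lambda>; y \<in> mor \<Lambda>; src \<Lambda> x = rng \<Lambda> y\<rbrakk> \<Longrightarrow> cmp \<Lambda> x y \<in> mor \<Lambda>"
    and rng_cmp: "\<lbrakk>x \<in> mor \<Lambda>; y \<in> mor \<Lambda>; src \<Lambda> x = rng \<Lambda> y\<rbrakk> \<Longrightarrow> rng \<Lambda> (cmp \<Lambda> x y) = rng \<Lambda> x"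
    and src_cmp: "\<lbrakk>x \<in> mor \<Lambda>; y \<in> mor \<Lambda>; src \<Lambda> x = rng \<Lambda> y\<rbrakk> \<Longrightarrow> src \<Lambda> (cmp \<Lambda> x y) = src \<Lambda> y"
    and cmp_assoc: "\<lbrakk>x \<in> mor \<Lambda>; y \<in> mor \<Lambda>; z \<in> mor \<Lambda>; src \<Lambda> x = rng \<Lambda> y; src \<Lambda> y = rng \<Lambda> z\<rbrakk>
        \<Longrightarrow> cmp \<Lambda> (cmp \<Lambda> x y) z = cmp \<Lambda> x (cmp \<Lambda> y z)"
    and cmp_id_left: "x \<in> mor \<Lambda> \<Longrightarrow> cmp \<Lambda> (rng \<Lambda> x) x = x"
    and cmp_id_right: "x \<in> mor \<Lambda> \<Longrightarrow> cmp \<Lambda> x (src \<Lambda> x) = x"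
    and deg_id: "v \<in> obj \<Lambda> \<Longrightarrow> deg \<Lambda> v = 0"
    and deg_cmp: "\<lbrakk>x \<in> mor \<Lambda>; y \<in> mor \<Lambda>; src \<Lambda> x = rng \<Lambda> y\<rbrakk>
        \<Longrightarrow> deg \<Lambda> (cmp \<Lambda> x y) = deg \<Lambda> x + deg \<Lambda> y"
    and factorisation: "\<lbrakk>x \<in> mor \<Lambda>; deg \<Lambda> x = m + n\<rbrakk>
        \<Longrightarrow> \<exists>!p. case p of (y, z) \<Rightarrow> y \<in> mor \<Lambda> \<and> z \<in> mor \<Lambda> \<and> src \<Lambda> y = rng \<Lambda> z
              \<and> deg \<Lambda> y = m \<and> deg \<Lambda> z = n \<and> x = cmp \<Lambda> y z"

definition paths_from :: "('m, 'k::finite) kgraph \<Rightarrow> 'm \<Rightarrow> nat ^ 'k \<Rightarrow> 'm set" where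
  "paths_from \<Lambda> v n = {x \<in> mor \<Lambda>. rng \<Lambda> x = v \<and> deg \<Lambda> x = n}"

definition row_finite :: "('m, 'k::finite) kgraph \<Rightarrow> bool" where
  "row_finite \<Lambda> \<longleftrightarrow> (\<forall>v \<in> obj \<Lambda>. \<forall>n. finite (paths_from \<Lambda> v n))"

definition no_sources :: "('m, 'k::finite) kgraph \<Rightarrow> bool" where
  "no_sources \<Lambda> \<longleftrightarrow> (\<forall>v \<in> obj \<Lambda>. \<forall>n. paths_from \<Lambda> v n \<noteq> {})"

definition hereditary :: "('m, 'k::finite) kgraph \<Rightarrow> 'm set \<Rightarrow> bool" where
  "hereditary \<Lambda> H \<longleftrightarrow> (\<forall>x \<in> mor \<Lambda>. rng \<Lambda> x \<in> H \<longrightarrow> src \<Lambda> x \<in> H)"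

definition saturated :: "('m, 'k::finite) kgraph \<Rightarrow> 'm set \<Rightarrow> bool" where
  "saturated \<Lambda> H \<longleftrightarrow> (\<forall>v \<in> obj \<Lambda>. (\<exists>n. src \<Lambda> ` paths_from \<Lambda> v n \<subseteq> H) \<longrightarrow> v \<in> H)"

definition sat_her :: "('m, 'k::finite) kgraph \<Rightarrow> 'm set set" where
  "sat_her \<Lambda> = {H. H \<subseteq> obj \<Lambda> \<and> hereditary \<Lambda> H \<and> saturated \<Lambda> H}"

definition sh_join :: "('m, 'k::finite) kgraph \<Rightarrow> 'm set set \<Rightarrow> 'm set" where
  "sh_join \<Lambda> \<A> = \<Inter>{K \<in> sat_her \<Lambda>. \<forall>H \<in> \<A>. H \<subseteq> K}"


section \<open>Aperiodicity\<close>

definition Omega :: "((nat ^ 'k::finite) \<times> (nat ^ 'k), 'k) kgraph" where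
  "Omega = \<lparr>mor = {(p, q). p \<le> q}, obj = {(p, q). p = q},
     rng = (\<lambda>(p, q). (p, p)), src = (\<lambda>(p, q). (q, q)),
     cmp = (\<lambda>(p, q) (q', t). (p, t)), deg = (\<lambda>(p, q). q - p)\<rparr>"

lemma Omega_kgraph: "kgraph (Omega :: (_, 'k::finite) kgraph)"
proof
  fix x :: "(nat^'k) \<times> (nat^'k)" and m n :: "nat^'k"
  assume "x \<in> mor Omega" "deg Omega x = m + n"
  then obtain a b where x: "x = (a, b)" "a \<le> b" "b - a = m + n"
    by (auto simp: Omega_def)
  have i: "a $ i \<le> b $ i" "b $ i - a $ i = m $ i + n $ i" for i
    using x(2,3) by (auto simp: less_eq_vec_def vec_eq_iff)
  have le: "a + m \<le> b" unfolding less_eq_vec_def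
  proof
    fix j show "(a + m) $ j \<le> b $ j" using i[of j] by simp
  qed
  have eq: "b - (a + m) = n" unfolding vec_eq_iff
  proof
    fix j show "(b - (a + m)) $ j = n $ j" using i[of j] by simp
  qed
  have uniq: "c = a + m" if "a \<le> c" "c - a = m" for c
    unfolding vec_eq_iff
  proof
    fix j
    have "a $ j \<le> c $ j" "c $ j - a $ j = m $ j"
      using that by (auto simp: less_eq_vec_def)
    then show "c $ j = (a + m) $ j" by simp
  qed
  have "a \<le> a + m" by (simp add: less_eq_vec_def)
  then show "\<exists>!p. case p of (y, z) \<Rightarrow> y \<in> mor Omega \<and> z \<in> mor Omega \<and> src Omega y = rng Omega z
      \<and> deg Omega y = m \<and> deg Omega z = n \<and> x = cmp Omega y z"
  proof (intro ex1I[of _ "((a, a + m), (a + m, b))"])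
    fix p :: "((nat^'k) \<times> (nat^'k)) \<times> ((nat^'k) \<times> (nat^'k))"
    obtain a' c c' b' where p: "p = ((a', c), (c', b'))" by (metis surj_pair)
    assume "case p of (y, z) \<Rightarrow> y \<in> mor Omega \<and> z \<in> mor Omega \<and> src Omega y = rng Omega z
      \<and> deg Omega y = m \<and> deg Omega z = n \<and> x = cmp Omega y z"
    then have "a = a' \<and> b = b' \<and> c = c' \<and> a' \<le> c \<and> c - a' = m"
      by (simp add: p x(1) Omega_def) metis
    with uniq[of c] p show "p = ((a, a + m), (a + m, b))" by blast
  qed (use le eq x(1) in \<open>simp add: Omega_def\<close>)
next
  fix x y :: "(nat^'k) \<times> (nat^'k)"
  assume "x \<in> mor Omega" "y \<in> mor Omega" "src Omega x = rng Omega y"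
  then obtain a b c where x: "x = (a, b)" "y = (b, c)" "a \<le> b" "b \<le> c"
    by (auto simp: Omega_def)
  have "c - a = (b - a) + (c - b)" unfolding vec_eq_iff
  proof
    fix j
    have "a $ j \<le> b $ j" "b $ j \<le> c $ j" using x(3,4) by (auto simp: less_eq_vec_def)
    then show "(c - a) $ j = ((b - a) + (c - b)) $ j" by simp
  qed
  then show "deg Omega (cmp Omega x y) = deg Omega x + deg Omega y"
    by (simp add: Omega_def x)
  show "cmp Omega x y \<in> mor Omega" using x by (simp add: Omega_def)
qed (auto simp: Omega_def)

definition kgraph_functor ::
  "('a, 'k::finite) kgraph \<Rightarrow> ('b, 'k) kgraph \<Rightarrow> ('a \<Rightarrow> 'b) \<Rightarrow> bool" where
  "kgraph_functor \<Lambda> \<Lambda>' f \<longleftrightarrow>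
     f ` mor \<Lambda> \<subseteq> mor \<Lambda>' \<and> f ` obj \<Lambda> \<subseteq> obj \<Lambda>' \<and>
     (\<forall>x \<in> mor \<Lambda>. rng \<Lambda>' (f x) = f (rng \<Lambda> x) \<and> src \<Lambda>' (f x) = f (src \<Lambda> x)
        \<and> deg \<Lambda>' (f x) = deg \<Lambda> x) \<and>
     (\<forall>x \<in> mor \<Lambda>. \<forall>y \<in> mor \<Lambda>. src \<Lambda> x = rng \<Lambda> y \<longrightarrow>
        f (cmp \<Lambda> x y) = cmp \<Lambda>' (f x) (f y))"

text \<open>
  Infinite paths are taken extensional on the morphisms of \<open>Omega\<close> (and shifts restricted to
  them), so that equality of HOL functions is equality of functors.
\<close>

definition inf_paths ::
  "('m, 'k::finite) kgraph \<Rightarrow> ((nat ^ 'k) \<times> (nat ^ 'k) \<Rightarrow> 'm) set" where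
  "inf_paths \<Lambda> = {x \<in> extensional (mor Omega). kgraph_functor Omega \<Lambda> x}"

definition shift ::
  "nat ^ 'k::finite \<Rightarrow> ((nat ^ 'k) \<times> (nat ^ 'k) \<Rightarrow> 'm) \<Rightarrow> (nat ^ 'k) \<times> (nat ^ 'k) \<Rightarrow> 'm" where
  "shift p x = restrict (\<lambda>(m, n). x (m + p, n + p)) (mor Omega)"

definition aperiodic :: "('m, 'k::finite) kgraph \<Rightarrow> bool" where
  "aperiodic \<Lambda> \<longleftrightarrow> (\<forall>v \<in> obj \<Lambda>. \<exists>x \<in> inf_paths \<Lambda>. x (0, 0) = v \<and>
     (\<forall>m n. m \<noteq> n \<longrightarrow> shift m x \<noteq> shift n x))"

definition remove_her :: "('m, 'k::finite) kgraph \<Rightarrow> 'm set \<Rightarrow> ('m, 'k) kgraph" where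
  "remove_her \<Lambda> H = \<Lambda>\<lparr>mor := {x \<in> mor \<Lambda>. src \<Lambda> x \<notin> H}, obj := obj \<Lambda> - H\<rparr>"

definition strongly_aperiodic :: "('m, 'k::finite) kgraph \<Rightarrow> bool" where
  "strongly_aperiodic \<Lambda> \<longleftrightarrow>
     (\<forall>H \<in> sat_her \<Lambda>. H \<noteq> obj \<Lambda> \<longrightarrow> aperiodic (remove_her \<Lambda> H))"


section \<open>Ideals and spans\<close>

text \<open>
  The sort \<open>{comm_ring, comm_monoid_mult}\<close> is that of commutative rings with identity;
  unlike \<open>comm_ring_1\<close> it does not exclude the zero ring.
\<close>

definition ring_ideals :: "'r::{comm_ring, comm_monoid_mult} set set" where
  "ring_ideals = {J. 0 \<in> J \<and> (\<forall>a \<in> J. \<forall>b \<in> J. a + b \<in> J) \<and> (\<forall>r. \<forall>a \<in> J. r * a \<in> J)}"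

text \<open>Not necessarily unital algebras over \<open>'r\<close>, with carrier sets.\<close>

record ('r, 'a) nalg =
  acarrier :: "'a set"
  azero :: 'a
  aadd :: "'a \<Rightarrow> 'a \<Rightarrow> 'a"
  amult :: "'a \<Rightarrow> 'a \<Rightarrow> 'a"
  asmult :: "'r \<Rightarrow> 'a \<Rightarrow> 'a"

text \<open>
  Ideals are two-sided ring ideals; closure under scalars is not demanded (in an algebra
  with local units it is automatic).
\<close>

definition aideals :: "('r, 'a) nalg \<Rightarrow> 'a set set" where
  "aideals A = {I. I \<subseteq> acarrier A \<and> azero A \<in> I \<and>
     (\<forall>x \<in> I. \<forall>y \<in> I. aadd A x y \<in> I) \<and>
     (\<forall>x \<in> I. \<exists>y \<in> I. aadd A x y = azero A) \<and>
     (\<forall>a \<in> acarrier A. \<forall>x \<in> I. amult A a x \<in> I \<and> amult A x a \<in> I)}"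

definition ideal_gen :: "('r, 'a) nalg \<Rightarrow> 'a set \<Rightarrow> 'a set" where
  "ideal_gen A X = \<Inter>{I \<in> aideals A. X \<subseteq> I}"

inductive_set aspan :: "('r, 'a) nalg \<Rightarrow> 'a set \<Rightarrow> 'a set"
  for A :: "('r, 'a) nalg" and X :: "'a set" where
  base: "x \<in> X \<Longrightarrow> x \<in> aspan A X"
| zero: "azero A \<in> aspan A X"
| add: "\<lbrakk>x \<in> aspan A X; y \<in> aspan A X\<rbrakk> \<Longrightarrow> aadd A x y \<in> aspan A X"
| smult: "x \<in> aspan A X \<Longrightarrow> asmult A r x \<in> aspan A X"


section \<open>The Kumjian--Pask algebra\<close>

text \<open>
  \<open>'g word \<Rightarrow>\<^sub>0 'r\<close>, with the convolution product of \<open>Poly_Mapping\<close>, is the unital free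
  \<open>'r\<close>-algebra on \<open>'g\<close>.
\<close>

datatype 'g word = Word (letters: "'g list")

instantiation word :: (type) monoid_add
begin

definition zero_word :: "'a word" where
  "zero_word = Word []"

definition plus_word :: "'a word \<Rightarrow> 'a word \<Rightarrow> 'a word" where
  "plus_word u w = Word (letters u @ letters w)"

instance
  by standard (simp_all add: zero_word_def plus_word_def)

end

datatype 'm kp_gen = Vert 'm | Path 'm | Ghost 'm

definition kp_gens :: "('m, 'k::finite) kgraph \<Rightarrow> 'm kp_gen set" where
  "kp_gens \<Lambda> = Vert ` obj \<Lambda> \<union> Path ` {x \<in> mor \<Lambda>. deg \<Lambda> x \<noteq> 0}
     \<union> Ghost ` {x \<in> mor \<Lambda>. deg \<Lambda> x \<noteq> 0}"

type_synonym ('m, 'r) kp_free = "'m kp_gen word \<Rightarrow>\<^sub>0 'r"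

text \<open>
  The Kumjian--Pask algebra has no identity in general, so it is a quotient of the
  non-unital free algebra: the empty word is excluded.
\<close>

definition kp_free ::
  "('m, 'k::finite) kgraph \<Rightarrow> ('m, 'r::{comm_ring, comm_monoid_mult}) kp_free set" where
  "kp_free \<Lambda> = {f. \<forall>w \<in> Poly_Mapping.keys f. letters w \<noteq> [] \<and> set (letters w) \<subseteq> kp_gens \<Lambda>}"

definition free_gen :: "'m kp_gen \<Rightarrow> ('m, 'r::{comm_ring, comm_monoid_mult}) kp_free" where
  "free_gen g = Poly_Mapping.single (Word [g]) 1"

definition free_smult ::
  "'r::{comm_ring, comm_monoid_mult} \<Rightarrow> ('m, 'r) kp_free \<Rightarrow> ('m, 'r) kp_free" where
  "free_smult r f = Poly_Mapping.single 0 r * f"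

definition free_p :: "'m \<Rightarrow> ('m, 'r::{comm_ring, comm_monoid_mult}) kp_free" where
  "free_p v = free_gen (Vert v)"

definition free_s ::
  "('m, 'k::finite) kgraph \<Rightarrow> 'm \<Rightarrow> ('m, 'r::{comm_ring, comm_monoid_mult}) kp_free" where
  "free_s \<Lambda> x = (if deg \<Lambda> x = 0 then free_p x else free_gen (Path x))"

definition free_t ::
  "('m, 'k::finite) kgraph \<Rightarrow> 'm \<Rightarrow> ('m, 'r::{comm_ring, comm_monoid_mult}) kp_free" where
  "free_t \<Lambda> x = (if deg \<Lambda> x = 0 then free_p x else free_gen (Ghost x))"

text \<open>
  \<open>free_t\<close> lifts the ghost elements. Each relation \<open>l = r\<close> of the presentation is recorded
  as the element \<open>l - r\<close>.
\<close>

inductive_set kp_relators ::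
  "('m, 'k::finite) kgraph \<Rightarrow> ('m, 'r::{comm_ring, comm_monoid_mult}) kp_free set"
  for \<Lambda> :: "('m, 'k) kgraph" where
  idem: "v \<in> obj \<Lambda> \<Longrightarrow> free_p v * free_p v - free_p v \<in> kp_relators \<Lambda>"
| orth: "\<lbrakk>v \<in> obj \<Lambda>; w \<in> obj \<Lambda>; v \<noteq> w\<rbrakk> \<Longrightarrow> free_p v * free_p w \<in> kp_relators \<Lambda>"
| path_mult: "\<lbrakk>x \<in> mor \<Lambda>; y \<in> mor \<Lambda>; src \<Lambda> x = rng \<Lambda> y\<rbrakk>
    \<Longrightarrow> free_s \<Lambda> x * free_s \<Lambda> y - free_s \<Lambda> (cmp \<Lambda> x y) \<in> kp_relators \<Lambda>"
| ghost_mult: "\<lbrakk>x \<in> mor \<Lambda>; y \<in> mor \<Lambda>; src \<Lambda> x = rng \<Lambda> y\<rbrakk>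
    \<Longrightarrow> free_t \<Lambda> y * free_t \<Lambda> x - free_t \<Lambda> (cmp \<Lambda> x y) \<in> kp_relators \<Lambda>"
| ghost_path: "\<lbrakk>x \<in> mor \<Lambda>; y \<in> mor \<Lambda>; deg \<Lambda> x = deg \<Lambda> y\<rbrakk>
    \<Longrightarrow> free_t \<Lambda> x * free_s \<Lambda> y - (if x = y then free_p (src \<Lambda> x) else 0) \<in> kp_relators \<Lambda>"
| vertex_sum: "v \<in> obj \<Lambda>
    \<Longrightarrow> free_p v - (\<Sum>x \<in> paths_from \<Lambda> v n. free_s \<Lambda> x * free_t \<Lambda> x) \<in> kp_relators \<Lambda>"

inductive_set kp_null ::
  "('m, 'k::finite) kgraph \<Rightarrow> ('m, 'r::{comm_ring, comm_monoid_mult}) kp_free set"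
  for \<Lambda> :: "('m, 'k) kgraph" where
  rel: "f \<in> kp_relators \<Lambda> \<Longrightarrow> f \<in> kp_null \<Lambda>"
| zero: "0 \<in> kp_null \<Lambda>"
| add: "\<lbrakk>f \<in> kp_null \<Lambda>; g \<in> kp_null \<Lambda>\<rbrakk> \<Longrightarrow> f + g \<in> kp_null \<Lambda>"
| smult: "f \<in> kp_null \<Lambda> \<Longrightarrow> free_smult r f \<in> kp_null \<Lambda>"
| left: "\<lbrakk>a \<in> kp_free \<Lambda>; f \<in> kp_null \<Lambda>\<rbrakk> \<Longrightarrow> a * f \<in> kp_null \<Lambda>"
| right: "\<lbrakk>f \<in> kp_null \<Lambda>; a \<in> kp_free \<Lambda>\<rbrakk> \<Longrightarrow> f * a \<in> kp_null \<Lambda>"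

definition kp_cong ::
  "('m, 'k::finite) kgraph \<Rightarrow> ('m, 'r::{comm_ring, comm_monoid_mult}) kp_free rel" where
  "kp_cong \<Lambda> = {(f, g). f \<in> kp_free \<Lambda> \<and> g \<in> kp_free \<Lambda> \<and> f - g \<in> kp_null \<Lambda>}"

definition kp_class ::
  "('m, 'k::finite) kgraph \<Rightarrow> ('m, 'r::{comm_ring, comm_monoid_mult}) kp_free
    \<Rightarrow> ('m, 'r) kp_free set" where
  "kp_class \<Lambda> f = kp_cong \<Lambda> `` {f}"

definition KP ::
  "('m, 'k::finite) kgraph \<Rightarrow>
    ('r::{comm_ring, comm_monoid_mult}, ('m, 'r) kp_free set) nalg" where
  "KP \<Lambda> = \<lparr>acarrier = kp_free \<Lambda> // kp_cong \<Lambda>,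
     azero = kp_class \<Lambda> 0,
     aadd = (\<lambda>A B. \<Union>f \<in> A. \<Union>g \<in> B. kp_class \<Lambda> (f + g)),
     amult = (\<lambda>A B. \<Union>f \<in> A. \<Union>g \<in> B. kp_class \<Lambda> (f * g)),
     asmult = (\<lambda>r A. \<Union>f \<in> A. kp_class \<Lambda> (free_smult r f))\<rparr>"

text \<open>The operations of \<open>KP \<Lambda>\<close> are well defined.\<close>

lemma keys_times_letters:
  fixes f g :: "('m, 'r::{comm_ring, comm_monoid_mult}) kp_free"
  assumes "w \<in> Poly_Mapping.keys (f * g)"
  obtains u v where "u \<in> Poly_Mapping.keys f" "v \<in> Poly_Mapping.keys g"
    "letters w = letters u @ letters v"
  using assms keys_mult[of f g] by (auto simp: plus_word_def)

lemma kp_free_closed: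
  fixes f g :: "('m, 'r::{comm_ring, comm_monoid_mult}) kp_free"
  shows "0 \<in> kp_free \<Lambda>"
    and "f \<in> kp_free \<Lambda> \<Longrightarrow> g \<in> kp_free \<Lambda> \<Longrightarrow> f + g \<in> kp_free \<Lambda>"
    and "f \<in> kp_free \<Lambda> \<Longrightarrow> g \<in> kp_free \<Lambda> \<Longrightarrow> f * g \<in> kp_free \<Lambda>"
    and "f \<in> kp_free \<Lambda> \<Longrightarrow> free_smult r f \<in> kp_free \<Lambda>"
proof -
  show "0 \<in> kp_free \<Lambda>" by (simp add: kp_free_def)
  show "f \<in> kp_free \<Lambda> \<Longrightarrow> g \<in> kp_free \<Lambda> \<Longrightarrow> f + g \<in> kp_free \<Lambda>"
    unfolding kp_free_def using Poly_Mapping.keys_add[of f g] by blast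
  show "f \<in> kp_free \<Lambda> \<Longrightarrow> g \<in> kp_free \<Lambda> \<Longrightarrow> f * g \<in> kp_free \<Lambda>"
    unfolding kp_free_def by (fastforce elim!: keys_times_letters)
  show "free_smult r f \<in> kp_free \<Lambda>" if "f \<in> kp_free \<Lambda>"
  proof -
    have "Poly_Mapping.keys (free_smult r f) \<subseteq> Poly_Mapping.keys f"
    proof
      fix w assume "w \<in> Poly_Mapping.keys (free_smult r f)"
      then obtain u v where "u \<in> Poly_Mapping.keys (Poly_Mapping.single (0::'m kp_gen word) r)"
        and v: "v \<in> Poly_Mapping.keys f" "w = u + v"
        unfolding free_smult_def using keys_mult[of "Poly_Mapping.single 0 r" f] by blast
      then have "u = 0" by (simp split: if_splits)
      with v show "w \<in> Poly_Mapping.keys f" by simp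
    qed
    with that show ?thesis unfolding kp_free_def by blast
  qed
qed

lemma single_one_mult:
  fixes f :: "('m, 'r::{comm_ring, comm_monoid_mult}) kp_free"
  shows "Poly_Mapping.single 0 1 * f = f"
  by (simp flip: mult_map_scale_conv_mult add: poly_mapping_eq_iff fun_eq_iff Poly_Mapping.map.rep_eq when_def)

lemma kp_null_uminus:
  assumes "f \<in> kp_null \<Lambda>" shows "- f \<in> kp_null \<Lambda>"
proof -
  have "free_smult (- 1) f = - (Poly_Mapping.single 0 1 * f)"
    by (simp add: free_smult_def single_uminus)
  then show ?thesis
    using kp_null.smult[OF assms, of "- 1"] by (simp add: single_one_mult)
qed

lemma kp_null_diff:
  assumes "f \<in> kp_null \<Lambda>" "g \<in> kp_null \<Lambda>" shows "f - g \<in> kp_null \<Lambda>"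
  using kp_null.add[OF assms(1) kp_null_uminus[OF assms(2)]] by simp

lemma equiv_kp_cong: "equiv (kp_free \<Lambda>) (kp_cong \<Lambda>)"
proof (rule equivI)
  show "kp_cong \<Lambda> \<subseteq> kp_free \<Lambda> \<times> kp_free \<Lambda>" by (auto simp: kp_cong_def)
  show "refl_on (kp_free \<Lambda>) (kp_cong \<Lambda>)"
    by (auto simp: refl_on_def kp_cong_def kp_null.zero)
  show "sym (kp_cong \<Lambda>)"
    by (rule symI) (use kp_null_uminus in \<open>fastforce simp: kp_cong_def\<close>)
  show "trans (kp_cong \<Lambda>)"
    by (rule transI) (use kp_null.add in \<open>fastforce simp: kp_cong_def\<close>)
qed

lemma kp_class_eqI:
  "f \<in> kp_free \<Lambda> \<Longrightarrow> g \<in> kp_free \<Lambda> \<Longrightarrow> f - g \<in> kp_null \<Lambda> \<Longrightarrow> kp_class \<Lambda> f = kp_class \<Lambda> g"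
  unfolding kp_class_def by (rule equiv_class_eq[OF equiv_kp_cong]) (simp add: kp_cong_def)

lemma KP_ops:
  fixes f g :: "('m, 'r::{comm_ring, comm_monoid_mult}) kp_free"
  assumes f: "f \<in> kp_free \<Lambda>" and g: "g \<in> kp_free \<Lambda>"
  shows "aadd (KP \<Lambda>) (kp_class \<Lambda> f) (kp_class \<Lambda> g) = kp_class \<Lambda> (f + g)"
    and "amult (KP \<Lambda>) (kp_class \<Lambda> f) (kp_class \<Lambda> g) = kp_class \<Lambda> (f * g)"
    and "asmult (KP \<Lambda>) r (kp_class \<Lambda> f) = kp_class \<Lambda> (free_smult r f)"
proof -
  have self: "f \<in> kp_class \<Lambda> f" "g \<in> kp_class \<Lambda> g"
    using f g by (auto simp: kp_class_def kp_cong_def kp_null.zero)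
  have D: "f' \<in> kp_free \<Lambda>" "f' - h \<in> kp_null \<Lambda>"
    if "f' \<in> kp_class \<Lambda> h" for f' h :: "('m, 'r) kp_free"
    using that kp_null_uminus[of "h - f'" \<Lambda>] by (auto simp: kp_class_def kp_cong_def)
  have 1: "kp_class \<Lambda> (f' + g') = kp_class \<Lambda> (f + g)"
    if "f' \<in> kp_class \<Lambda> f" "g' \<in> kp_class \<Lambda> g" for f' g'
    using kp_null.add[OF D(2)[OF that(1)] D(2)[OF that(2)]] D(1)[OF that(1)] D(1)[OF that(2)] f g
    by (intro kp_class_eqI kp_free_closed) (simp_all add: algebra_simps)
  have 2: "kp_class \<Lambda> (f' * g') = kp_class \<Lambda> (f * g)"
    if "f' \<in> kp_class \<Lambda> f" "g' \<in> kp_class \<Lambda> g" for f' g'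
  proof (intro kp_class_eqI kp_free_closed)
    have "f' * (g' - g) + (f' - f) * g \<in> kp_null \<Lambda>"
      using that D f g by (intro kp_null.add kp_null.left kp_null.right) auto
    then show "f' * g' - f * g \<in> kp_null \<Lambda>" by (simp add: algebra_simps)
  qed (use that D f g in auto)
  have 3: "kp_class \<Lambda> (free_smult r f') = kp_class \<Lambda> (free_smult r f)"
    if "f' \<in> kp_class \<Lambda> f" for f'
    using kp_null.smult[OF D(2)[OF that], of r] D(1)[OF that] f
    by (intro kp_class_eqI kp_free_closed) (simp_all add: free_smult_def algebra_simps)
  show "aadd (KP \<Lambda>) (kp_class \<Lambda> f) (kp_class \<Lambda> g) = kp_class \<Lambda> (f + g)"
  proof -
    have "aadd (KP \<Lambda>) (kp_class \<Lambda> f) (kp_class \<Lambda> g) = (\<Union>f' \<in> kp_class \<Lambda> f. \<Union>g' \<in> kp_class \<Lambda> g. kp_class \<Lambda> (f' + g'))" by (simp add: KP_def)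
    also have "\<dots> = (\<Union>f' \<in> kp_class \<Lambda> f. \<Union>g' \<in> kp_class \<Lambda> g. kp_class \<Lambda> (f + g))" by (intro SUP_cong refl 1)
    also have "\<dots> = kp_class \<Lambda> (f + g)" using self by blast
    finally show ?thesis .
  qed
  show "amult (KP \<Lambda>) (kp_class \<Lambda> f) (kp_class \<Lambda> g) = kp_class \<Lambda> (f * g)"
  proof -
    have "amult (KP \<Lambda>) (kp_class \<Lambda> f) (kp_class \<Lambda> g) = (\<Union>f' \<in> kp_class \<Lambda> f. \<Union>g' \<in> kp_class \<Lambda> g. kp_class \<Lambda> (f' * g'))" by (simp add: KP_def)
    also have "\<dots> = (\<Union>f' \<in> kp_class \<Lambda> f. \<Union>g' \<in> kp_class \<Lambda> g. kp_class \<Lambda> (f * g))" by (intro SUP_cong refl 2)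
    also have "\<dots> = kp_class \<Lambda> (f * g)" using self by blast
    finally show ?thesis .
  qed
  show "asmult (KP \<Lambda>) r (kp_class \<Lambda> f) = kp_class \<Lambda> (free_smult r f)"
  proof -
    have "asmult (KP \<Lambda>) r (kp_class \<Lambda> f) = (\<Union>f' \<in> kp_class \<Lambda> f. kp_class \<Lambda> (free_smult r f'))" by (simp add: KP_def)
    also have "\<dots> = (\<Union>f' \<in> kp_class \<Lambda> f. kp_class \<Lambda> (free_smult r f))" by (intro SUP_cong refl 3)
    also have "\<dots> = kp_class \<Lambda> (free_smult r f)" using self by blast
    finally show ?thesis .
  qed
qed

definition kp_p ::
  "('m, 'k::finite) kgraph \<Rightarrow> 'm \<Rightarrow> ('m, 'r::{comm_ring, comm_monoid_mult}) kp_free set" where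
  "kp_p \<Lambda> v = kp_class \<Lambda> (free_p v)"

definition kp_s ::
  "('m, 'k::finite) kgraph \<Rightarrow> 'm \<Rightarrow> ('m, 'r::{comm_ring, comm_monoid_mult}) kp_free set" where
  "kp_s \<Lambda> x = kp_class \<Lambda> (free_s \<Lambda> x)"

definition kp_t ::
  "('m, 'k::finite) kgraph \<Rightarrow> 'm \<Rightarrow> ('m, 'r::{comm_ring, comm_monoid_mult}) kp_free set" where
  "kp_t \<Lambda> x = kp_class \<Lambda> (free_t \<Lambda> x)"

text \<open>\<open>kp_st \<Lambda> x y\<close> is the product of \<open>s\<^sub>x\<close> and the ghost element of \<open>y\<close>.\<close>

definition kp_st ::
  "('m, 'k::finite) kgraph \<Rightarrow> 'm \<Rightarrow> 'm \<Rightarrow> ('m, 'r::{comm_ring, comm_monoid_mult}) kp_free set"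
  where
  "kp_st \<Lambda> x y = amult (KP \<Lambda>) (kp_s \<Lambda> x) (kp_t \<Lambda> y)"

definition kp_ideal_of ::
  "('m, 'k::finite) kgraph \<Rightarrow> 'm set
    \<Rightarrow> ('m, 'r::{comm_ring, comm_monoid_mult}) kp_free set set" where
  "kp_ideal_of \<Lambda> H = ideal_gen (KP \<Lambda>) (kp_p \<Lambda> ` H)"

text \<open>
  Functions on \<open>sat_her \<Lambda>\<close> are extensional, so that they are determined by their values there.
  For \<open>\<A> = {}\<close> the intersection below is \<open>UNIV\<close>, i.e. the whole ring.
\<close>

definition join_maps ::
  "('m, 'k::finite) kgraph \<Rightarrow> ('m set \<Rightarrow> 'r::{comm_ring, comm_monoid_mult} set) set" where
  "join_maps \<Lambda> = {\<pi> \<in> sat_her \<Lambda> \<rightarrow>\<^sub>E ring_ideals.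
     \<forall>\<A>. \<A> \<subseteq> sat_her \<Lambda> \<longrightarrow> \<pi> (sh_join \<Lambda> \<A>) = (\<Inter>H \<in> \<A>. \<pi> H)}"

definition kp_Gamma ::
  "('m, 'k::finite) kgraph \<Rightarrow> ('m set \<Rightarrow> 'r::{comm_ring, comm_monoid_mult} set)
    \<Rightarrow> ('m, 'r) kp_free set set" where
  "kp_Gamma \<Lambda> \<pi> = aspan (KP \<Lambda>)
     {asmult (KP \<Lambda>) r (kp_st \<Lambda> x y) | r x y. x \<in> mor \<Lambda> \<and> y \<in> mor \<Lambda> \<and>
        (\<exists>H \<in> sat_her \<Lambda>. r \<in> \<pi> H \<and> kp_st \<Lambda> x y \<in> (kp_ideal_of \<Lambda> H :: ('m, 'r) kp_free set set))}"

end

theory Submission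
  imports Defs
begin

text \<open>
  For (1), let \<open>a \<in> I\<close>. For \<open>n\<close> large, \<open>a\<close> is the sum of the \<open>(a s\<^sub>\<mu>) s\<^sub>\<mu>\<^sub>*\<close> with \<open>d(\<mu>) = n\<close>, and
  every \<open>a s\<^sub>\<mu>\<close> is a combination of distinct paths \<open>c\<^sub>\<lambda> s\<^sub>\<lambda>\<close> with \<open>s(\<lambda>) = s(\<mu>)\<close>. So it suffices that
  \<open>\<Sum> c\<^sub>\<lambda> s\<^sub>\<lambda> \<in> I\<close>, with common source \<open>w\<close>, implies \<open>c\<^sub>\<lambda> p\<^sub>w \<in> I\<close>. If \<open>r = c\<^sub>\<lambda>\<close> violates this, then \<open>w\<close> lies
  outside the saturated hereditary set \<open>H = {v. r p\<^sub>v \<in> I}\<close>, and there is an aperiodic path \<open>x\<close> from \<open>w\<close>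
  that avoids \<open>H\<close>. Multiplying by the ghost of \<open>\<lambda> x(0,N)\<close> on the left and by \<open>x(0,N)\<close> on the right kills
  all other terms for \<open>N\<close> large, since a common extension of \<open>\<lambda> x(0,N)\<close> and \<open>\<lambda>' x(0,N)\<close> for all \<open>N\<close>
  would make two shifts of \<open>x\<close> agree. What remains is \<open>r p\<^sub>v \<in> I\<close> for a vertex \<open>v \<notin> H\<close> of \<open>x\<close>.

  For (2) and (3), the inverse of \<open>\<Gamma>\<close> sends \<open>I\<close> to \<open>H \<mapsto> {r. r p\<^sub>v \<in> I for all v \<in> H}\<close>; by (1) it only
  remains to recover \<open>\<pi>\<close> from \<open>\<Gamma>(\<pi>)\<close>. The algebra acts on functions of finite paths, modulo functions
  that vanish at all paths of large degree. The elements that map every function to one with values at \<open>\<kappa>\<close>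
  eventually in \<open>\<pi>(closure of s(\<kappa>))\<close> form an ideal, which contains \<open>r p\<^sub>v\<close> iff \<open>r \<in> \<pi>(closure of v)\<close>.
\<close>

section \<open>Degrees and factorisations\<close>

lemma nat_vec_add_diff:
  fixes m n :: "nat ^ 'k::finite"
  assumes "m \<le> n"
  shows "m + (n - m) = n"
  using assms by (simp add: less_eq_vec_def vec_eq_iff)

lemma nat_vec_le_add:
  fixes m n :: "nat ^ 'k::finite"
  shows "m \<le> m + n" "n \<le> m + n"
  by (simp_all add: less_eq_vec_def)

lemma nat_vec_add_le_cancel:
  fixes l m n :: "nat ^ 'k::finite"
  shows "l + m \<le> l + n \<longleftrightarrow> m \<le> n"
  by (simp add: less_eq_vec_def)

lemma nat_vec_le_sum:
  fixes f :: "'a \<Rightarrow> nat ^ 'k::finite"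
  assumes "finite A" "a \<in> A"
  shows "f a \<le> sum f A"
  using assms by (simp add: sum.remove[of A a] nat_vec_le_add)

lemma nat_vec_zero_le: "(0 :: nat ^ 'k::finite) \<le> n"
  by (simp add: less_eq_vec_def)

locale kp_graph = kgraph \<Lambda> for \<Lambda> :: "('m, 'k::finite) kgraph" +
  assumes row_fin: "row_finite \<Lambda>"
begin

abbreviation path_comp (infixl "\<diamondop>" 70) where "x \<diamondop> y \<equiv> cmp \<Lambda> x y"

lemma obj_mor: "v \<in> obj \<Lambda> \<Longrightarrow> v \<in> mor \<Lambda>"
  using obj_sub by blast

text \<open>Unique factorisation in the form of a cancellation rule: degrees cancel in
  \<open>nat ^ 'k\<close>, so equal degrees of the first factors force equal degrees of the second
  ones.\<close>

lemma factor_unique: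
  assumes "y \<in> mor \<Lambda>" "z \<in> mor \<Lambda>" "src \<Lambda> y = rng \<Lambda> z"
    and "y' \<in> mor \<Lambda>" "z' \<in> mor \<Lambda>" "src \<Lambda> y' = rng \<Lambda> z'"
    and "y \<diamondop> z = y' \<diamondop> z'" "deg \<Lambda> y = deg \<Lambda> y'"
  shows "y = y'" "z = z'"
proof -
  have "deg \<Lambda> y + deg \<Lambda> z = deg \<Lambda> y' + deg \<Lambda> z'"
    using deg_cmp[OF assms(1-3)] deg_cmp[OF assms(4-6)] assms(7) by simp
  then have z: "deg \<Lambda> z' = deg \<Lambda> z" using assms(8) by simp
  obtain q where q: "p = q" if "case p of (y1, z1) \<Rightarrow> y1 \<in> mor \<Lambda> \<and> z1 \<in> mor \<Lambda>
      \<and> src \<Lambda> y1 = rng \<Lambda> z1 \<and> deg \<Lambda> y1 = deg \<Lambda> y \<and> deg \<Lambda> z1 = deg \<Lambda> z \<and> y \<diamondop> z = y1 \<diamondop> z1" for p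
    using factorisation[OF cmp_mor[OF assms(1-3)] deg_cmp[OF assms(1-3)]] by (elim ex1E) blast
  have "(y, z) = q" "(y', z') = q" using assms z by (auto intro!: q)
  then show "y = y'" "z = z'" by auto
qed

lemma factorE:
  assumes "x \<in> mor \<Lambda>" "n \<le> deg \<Lambda> x"
  obtains y z where "y \<in> mor \<Lambda>" "z \<in> mor \<Lambda>" "src \<Lambda> y = rng \<Lambda> z" "deg \<Lambda> y = n"
    "deg \<Lambda> z = deg \<Lambda> x - n" "x = y \<diamondop> z"
  using factorisation[OF assms(1), of n "deg \<Lambda> x - n"] nat_vec_add_diff[OF assms(2)] that
  by auto

text \<open>Composing \<open>x\<close> with the identities at its source and at its range gives two
  factorisations of \<open>x\<close> into factors of degree zero; uniqueness identifies
  \<open>x\<close> with \<open>rng \<Lambda> x\<close>.\<close>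

lemma deg_zero_obj:
  assumes "x \<in> mor \<Lambda>" "deg \<Lambda> x = 0"
  shows "x \<in> obj \<Lambda>"
proof -
  have "x = rng \<Lambda> x"
    using assms
    by (intro factor_unique(1)[of x "src \<Lambda> x" "rng \<Lambda> x" x])
      (simp_all add: rng_obj src_obj obj_mor rng_id src_id cmp_id_left cmp_id_right deg_id)
  then show ?thesis using rng_obj[OF assms(1)] by simp
qed

lemma finite_paths: "v \<in> obj \<Lambda> \<Longrightarrow> finite (paths_from \<Lambda> v n)"
  using row_fin unfolding row_finite_def by blast

section \<open>Saturated hereditary sets and their joins\<close>

lemma sat_herD:
  assumes "H \<in> sat_her \<Lambda>"
  shows "H \<subseteq> obj \<Lambda>" "x \<in> mor \<Lambda> \<Longrightarrow> rng \<Lambda> x \<in> H \<Longrightarrow> src \<Lambda> x \<in> H"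
    "v \<in> obj \<Lambda> \<Longrightarrow> src \<Lambda> ` paths_from \<Lambda> v n \<subseteq> H \<Longrightarrow> v \<in> H"
  using assms unfolding sat_her_def hereditary_def saturated_def by blast+

lemma sat_herI:
  assumes "H \<subseteq> obj \<Lambda>" "\<And>x. x \<in> mor \<Lambda> \<Longrightarrow> rng \<Lambda> x \<in> H \<Longrightarrow> src \<Lambda> x \<in> H"
    "\<And>v n. v \<in> obj \<Lambda> \<Longrightarrow> src \<Lambda> ` paths_from \<Lambda> v n \<subseteq> H \<Longrightarrow> v \<in> H"
  shows "H \<in> sat_her \<Lambda>"
  using assms unfolding sat_her_def hereditary_def saturated_def by simp blast

lemma obj_sat_her: "obj \<Lambda> \<in> sat_her \<Lambda>"
  by (rule sat_herI) (simp_all add: src_obj)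

text \<open>Members of \<open>\<A>\<close> are only asked to be sets of vertices, so that the
  closure of a single vertex is covered as well.\<close>

lemma sh_join_sat_her:
  assumes "\<And>H. H \<in> \<A> \<Longrightarrow> H \<subseteq> obj \<Lambda>"
  shows "sh_join \<Lambda> \<A> \<in> sat_her \<Lambda>"
proof -
  let ?\<K> = "{K \<in> sat_her \<Lambda>. \<forall>H\<in>\<A>. H \<subseteq> K}"
  \<comment> \<open>The family of upper bounds is nonempty, which keeps its intersection inside
    \<open>obj \<Lambda>\<close>.\<close>
  have obj: "obj \<Lambda> \<in> ?\<K>" using obj_sat_her assms by simp
  show ?thesis
    unfolding sh_join_def
  proof (rule sat_herI)
    show "\<Inter>?\<K> \<subseteq> obj \<Lambda>" using obj by (rule Inter_lower)
  next
    fix x assume x: "x \<in> mor \<Lambda>" "rng \<Lambda> x \<in> \<Inter>?\<K>"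
    show "src \<Lambda> x \<in> \<Inter>?\<K>"
    proof (rule InterI)
      fix K assume K: "K \<in> ?\<K>"
      then show "src \<Lambda> x \<in> K" using x InterD[OF x(2) K] sat_herD(2) by simp
    qed
  next
    fix v n assume v: "v \<in> obj \<Lambda>" and n: "src \<Lambda> ` paths_from \<Lambda> v n \<subseteq> \<Inter>?\<K>"
    show "v \<in> \<Inter>?\<K>"
    proof (rule InterI)
      fix K assume K: "K \<in> ?\<K>"
      show "v \<in> K"
        by (rule sat_herD(3)[OF _ v subset_trans[OF n Inter_lower[OF K]]]) (use K in simp)
    qed
  qed
qed

lemma sh_join_upper: "H \<in> \<A> \<Longrightarrow> H \<subseteq> sh_join \<Lambda> \<A>"
  unfolding sh_join_def by blast

lemma sh_join_least: "K \<in> sat_her \<Lambda> \<Longrightarrow> (\<And>H. H \<in> \<A> \<Longrightarrow> H \<subseteq> K) \<Longrightarrow> sh_join \<Lambda> \<A> \<subseteq> K"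
  unfolding sh_join_def by blast

end

section \<open>The free algebra modulo the relations\<close>

lemma poly_mapping_sum_single:
  fixes f :: "'a \<Rightarrow>\<^sub>0 'b::comm_monoid_add"
  shows "f = (\<Sum>w\<in>Poly_Mapping.keys f. Poly_Mapping.single w (Poly_Mapping.lookup f w))"
  by (rule poly_mapping_eqI)
    (auto simp: lookup_sum lookup_single when_def sum.delta' in_keys_iff)

text \<open>Scalars sit at the empty word, which is neutral for concatenation, so they commute with
  every monomial although words do not commute with each other.\<close>

lemma single_zero_mult_commute:
  fixes f :: "'a::monoid_add \<Rightarrow>\<^sub>0 'r::{comm_ring, comm_monoid_mult}"
  shows "f * Poly_Mapping.single 0 r = Poly_Mapping.single 0 r * f"
proof -
  have "(\<Sum>w\<in>A. Poly_Mapping.single w (h w)) * Poly_Mapping.single 0 r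
      = Poly_Mapping.single 0 r * (\<Sum>w\<in>A. Poly_Mapping.single w (h w))" for A and h :: "'a \<Rightarrow> 'r"
    by (simp add: sum_distrib_left sum_distrib_right mult_single mult.commute)
  from this[of "Poly_Mapping.lookup f" "Poly_Mapping.keys f"] show ?thesis
    by (simp only: poly_mapping_sum_single[of f, symmetric])
qed

notation free_smult (infixr "\<cdot>" 75)

context
  fixes f g :: "('m, 'r::{comm_ring, comm_monoid_mult}) kp_free"
begin

lemma smult_add: "r \<cdot> (f + g) = r \<cdot> f + r \<cdot> g"
  by (simp add: free_smult_def distrib_left)

lemma smult_diff: "r \<cdot> (f - g) = r \<cdot> f - r \<cdot> g"
  by (simp add: free_smult_def right_diff_distrib)

lemma smult_add_left: "(r + q) \<cdot> f = r \<cdot> f + q \<cdot> f"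
  by (simp add: free_smult_def single_add distrib_right)

lemma smult_zero [simp]: "r \<cdot> (0 :: ('m, 'r) kp_free) = 0" "0 \<cdot> f = 0"
  by (simp_all add: free_smult_def)

lemma smult_one [simp]: "1 \<cdot> f = f"
  by (simp add: free_smult_def single_one_mult)

lemma smult_smult: "r \<cdot> q \<cdot> f = (r * q) \<cdot> f"
  by (simp add: free_smult_def mult_single flip: mult.assoc)

lemma smult_mult_left: "r \<cdot> f * g = r \<cdot> (f * g)"
  by (simp add: free_smult_def mult.assoc)

lemma smult_mult_right: "f * r \<cdot> g = r \<cdot> (f * g)"
  by (simp add: free_smult_def single_zero_mult_commute flip: mult.assoc)

end

lemma smult_sum: "r \<cdot> (\<Sum>i\<in>A. h i) = (\<Sum>i\<in>A. r \<cdot> h i)"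
  for h :: "'a \<Rightarrow> ('m, 'r::{comm_ring, comm_monoid_mult}) kp_free"
  by (simp add: free_smult_def sum_distrib_left)

lemma kp_free_sum:
  fixes h :: "'a \<Rightarrow> ('m, 'r::{comm_ring, comm_monoid_mult}) kp_free"
  assumes "\<And>i. i \<in> A \<Longrightarrow> h i \<in> kp_free \<Lambda>"
  shows "sum h A \<in> kp_free \<Lambda>"
  using assms by (induction A rule: infinite_finite_induct) (simp_all add: kp_free_closed)

lemma kp_free_gen: "g \<in> kp_gens \<Lambda> \<Longrightarrow> free_gen g \<in> kp_free \<Lambda>"
  by (auto simp: kp_free_def free_gen_def)

text \<open>Every element is a combination of nonempty words, and a nonempty word is a product of
  generators; hence no case for a unit arises.\<close>

lemma kp_free_induct [consumes 1, case_names zero add smult gen mult]: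
  fixes f :: "('m, 'r::{comm_ring, comm_monoid_mult}) kp_free"
  assumes "f \<in> kp_free \<Lambda>"
    and zero: "P 0"
    and add: "\<And>f g. \<lbrakk>f \<in> kp_free \<Lambda>; g \<in> kp_free \<Lambda>; P f; P g\<rbrakk> \<Longrightarrow> P (f + g)"
    and smult: "\<And>r f. \<lbrakk>f \<in> kp_free \<Lambda>; P f\<rbrakk> \<Longrightarrow> P (r \<cdot> f)"
    and gen: "\<And>g. g \<in> kp_gens \<Lambda> \<Longrightarrow> P (free_gen g)"
    and mult: "\<And>f g. \<lbrakk>f \<in> kp_free \<Lambda>; g \<in> kp_free \<Lambda>; P f; P g\<rbrakk> \<Longrightarrow> P (f * g)"
  shows "P f"
proof -
  \<comment> \<open>Membership in \<open>kp_free \<Lambda>\<close> travels along with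
    \<open>P\<close> here and below, because \<open>add\<close>, \<open>smult\<close> and
    \<open>mult\<close> ask for it.\<close>
  have word: "(Poly_Mapping.single (Word l) 1 :: ('m, 'r) kp_free) \<in> kp_free \<Lambda> \<and> P (Poly_Mapping.single (Word l) 1)"
    if "l \<noteq> []" "set l \<subseteq> kp_gens \<Lambda>" for l
    using that
  proof (induction l rule: list_nonempty_induct)
    case (single g)
    then show ?case using gen[of g] kp_free_gen[of g \<Lambda>] by (simp add: free_gen_def)
  next
    case (cons g l)
    have eq: "(Poly_Mapping.single (Word (g # l)) 1 :: ('m, 'r) kp_free)
        = free_gen g * Poly_Mapping.single (Word l) 1"
      by (simp add: free_gen_def mult_single plus_word_def)
    have g: "g \<in> kp_gens \<Lambda>" and l: "set l \<subseteq> kp_gens \<Lambda>" using cons.prems by auto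
    note IH = cons.IH[OF l]
    show ?case unfolding eq
      by (intro conjI kp_free_closed(3)[OF kp_free_gen[OF g] conjunct1[OF IH]]
          mult[OF kp_free_gen[OF g] conjunct1[OF IH] gen[OF g] conjunct2[OF IH]])
  qed
  have monom: "Poly_Mapping.single w (Poly_Mapping.lookup f w) \<in> kp_free \<Lambda>
      \<and> P (Poly_Mapping.single w (Poly_Mapping.lookup f w))"
    if "w \<in> Poly_Mapping.keys f" for w
  proof -
    have "letters w \<noteq> []" "set (letters w) \<subseteq> kp_gens \<Lambda>"
      using assms(1) that by (auto simp: kp_free_def)
    note w = word[OF this, unfolded word.collapse]
    have eq: "Poly_Mapping.single w (Poly_Mapping.lookup f w)
        = Poly_Mapping.lookup f w \<cdot> Poly_Mapping.single w 1"
      by (simp add: free_smult_def mult_single)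
    show ?thesis unfolding eq
      by (intro conjI kp_free_closed(4)[OF conjunct1[OF w]] smult[OF conjunct1[OF w] conjunct2[OF w]])
  qed
  have "sum h A \<in> kp_free \<Lambda> \<and> P (sum h A)"
    if "finite A" "\<And>i. i \<in> A \<Longrightarrow> h i \<in> kp_free \<Lambda> \<and> P (h i)"
    for A and h :: "'m kp_gen word \<Rightarrow> ('m, 'r) kp_free"
    using that
  proof (induction A)
    case empty
    show ?case by (simp add: zero kp_free_closed(1))
  next
    case (insert i A)
    have "h i \<in> kp_free \<Lambda> \<and> P (h i)" "sum h A \<in> kp_free \<Lambda> \<and> P (sum h A)"
      using insert.IH insert.prems by blast+
    then show ?case
      unfolding sum.insert[OF insert.hyps] by (elim conjE, intro conjI kp_free_closed(2) add)
  qed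
  from this[OF finite_keys, of f "\<lambda>w. Poly_Mapping.single w (Poly_Mapping.lookup f w)"] monom
  show ?thesis by (simp only: poly_mapping_sum_single[of f, symmetric])
qed

text \<open>The congruence on representatives: calculations then use the ring operations of the free
  algebra instead of those on classes.\<close>

definition kp_equiv :: "('m, 'k::finite) kgraph \<Rightarrow> ('m, 'r::{comm_ring, comm_monoid_mult}) kp_free
    \<Rightarrow> ('m, 'r) kp_free \<Rightarrow> bool" where
  "kp_equiv \<Lambda> f g \<longleftrightarrow> (f, g) \<in> kp_cong \<Lambda>"

lemma kp_equivD:
  assumes "kp_equiv \<Lambda> f g"
  shows "f \<in> kp_free \<Lambda>" "g \<in> kp_free \<Lambda>" "f - g \<in> kp_null \<Lambda>"
  using assms by (auto simp: kp_equiv_def kp_cong_def)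

lemma kp_equiv_refl: "f \<in> kp_free \<Lambda> \<Longrightarrow> kp_equiv \<Lambda> f f"
  by (simp add: kp_equiv_def kp_cong_def kp_null.zero)

lemma kp_equiv_sym: "kp_equiv \<Lambda> f g \<Longrightarrow> kp_equiv \<Lambda> g f"
  unfolding kp_equiv_def by (meson equivE equiv_kp_cong symD)

lemma kp_equiv_trans [trans]: "kp_equiv \<Lambda> f g \<Longrightarrow> kp_equiv \<Lambda> g h \<Longrightarrow> kp_equiv \<Lambda> f h"
  unfolding kp_equiv_def by (meson equivE equiv_kp_cong transD)

lemma kp_equiv_add:
  assumes "kp_equiv \<Lambda> f f'" "kp_equiv \<Lambda> g g'"
  shows "kp_equiv \<Lambda> (f + g) (f' + g')"
  using kp_null.add[OF kp_equivD(3)[OF assms(1)] kp_equivD(3)[OF assms(2)]] kp_equivD(1,2)[OF assms(1)]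
    kp_equivD(1,2)[OF assms(2)]
  by (simp add: kp_equiv_def kp_cong_def kp_free_closed algebra_simps)

lemma kp_equiv_mult:
  assumes "kp_equiv \<Lambda> f f'" "kp_equiv \<Lambda> g g'"
  shows "kp_equiv \<Lambda> (f * g) (f' * g')"
proof -
  have "f * (g - g') + (f - f') * g' \<in> kp_null \<Lambda>"
    using kp_equivD[OF assms(1)] kp_equivD[OF assms(2)]
    by (intro kp_null.add kp_null.left kp_null.right)
  then show ?thesis
    using kp_equivD(1,2)[OF assms(1)] kp_equivD(1,2)[OF assms(2)]
    by (simp add: kp_equiv_def kp_cong_def kp_free_closed algebra_simps)
qed

lemma kp_equiv_smult:
  assumes "kp_equiv \<Lambda> f g"
  shows "kp_equiv \<Lambda> (r \<cdot> f) (r \<cdot> g)"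
  using kp_equivD[OF assms] kp_null.smult[of "f - g" \<Lambda> r]
  by (simp add: kp_equiv_def kp_cong_def kp_free_closed smult_diff)

lemma kp_equiv_sum:
  assumes "\<And>i. i \<in> A \<Longrightarrow> kp_equiv \<Lambda> (f i) (g i)"
  shows "kp_equiv \<Lambda> (sum f A) (sum g A)"
  using assms
  by (induction A rule: infinite_finite_induct)
    (auto intro: kp_equiv_add kp_equiv_refl kp_free_closed)

lemma kp_class_cong: "kp_equiv \<Lambda> f g \<Longrightarrow> kp_class \<Lambda> f = kp_class \<Lambda> g"
  by (intro kp_class_eqI kp_equivD)

lemma kp_class_eqD:
  assumes "kp_class \<Lambda> f = kp_class \<Lambda> g" "g \<in> kp_free \<Lambda>"
  shows "kp_equiv \<Lambda> f g"
  using assms kp_equiv_refl[of g \<Lambda>] unfolding kp_class_def kp_equiv_def by blast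

context kp_graph
begin

abbreviation kp_rel :: "('m, 'r::{comm_ring, comm_monoid_mult}) kp_free \<Rightarrow> ('m, 'r) kp_free \<Rightarrow> bool"
    (infix "\<doteq>" 50) where
  "f \<doteq> g \<equiv> kp_equiv \<Lambda> f g"

abbreviation path_elt :: "'m \<Rightarrow> ('m, 'r::{comm_ring, comm_monoid_mult}) kp_free" ("S") where
  "S \<equiv> free_s \<Lambda>"

abbreviation ghost_elt :: "'m \<Rightarrow> ('m, 'r::{comm_ring, comm_monoid_mult}) kp_free" ("T") where
  "T \<equiv> free_t \<Lambda>"

lemma free_p_free [simp]: "v \<in> obj \<Lambda> \<Longrightarrow> free_p v \<in> kp_free \<Lambda>"
  by (auto simp: free_p_def kp_gens_def intro!: kp_free_gen)

lemma S_free [simp]: "x \<in> mor \<Lambda> \<Longrightarrow> S x \<in> kp_free \<Lambda>"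
  by (auto simp: free_s_def kp_gens_def deg_zero_obj intro!: kp_free_gen)

lemma T_free [simp]: "x \<in> mor \<Lambda> \<Longrightarrow> T x \<in> kp_free \<Lambda>"
  by (auto simp: free_t_def kp_gens_def deg_zero_obj intro!: kp_free_gen)

lemma S_obj: "v \<in> obj \<Lambda> \<Longrightarrow> S v = free_p v" and T_obj: "v \<in> obj \<Lambda> \<Longrightarrow> T v = free_p v"
  by (simp_all add: free_s_def free_t_def deg_id)

lemma kp_relators_free:
  fixes f :: "('m, 'r::{comm_ring, comm_monoid_mult}) kp_free"
  shows "f \<in> kp_relators \<Lambda> \<Longrightarrow> f \<in> kp_free \<Lambda>"
proof -
  have diff: "f - g \<in> kp_free \<Lambda>" if "f \<in> kp_free \<Lambda>" "g \<in> kp_free \<Lambda>"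
    for f g :: "('m, 'r) kp_free"
  proof -
    have "f - g = f + (- 1) \<cdot> g"
      by (simp add: free_smult_def single_uminus single_one_mult)
    then show ?thesis using kp_free_closed(2)[OF that(1) kp_free_closed(4)[OF that(2)]] by metis
  qed
  have "x \<in> mor \<Lambda>" if "x \<in> paths_from \<Lambda> v n" for x v n
    using that by (simp add: paths_from_def)
  note p = this
  show "f \<in> kp_relators \<Lambda> \<Longrightarrow> f \<in> kp_free \<Lambda>"
    by (induction rule: kp_relators.induct)
      (auto intro!: diff kp_free_closed(1,3) kp_free_sum simp: cmp_mor src_obj dest: p)
qed

lemma kp_null_free: "f \<in> kp_null \<Lambda> \<Longrightarrow> f \<in> kp_free \<Lambda>"
  by (induction rule: kp_null.induct) (simp_all add: kp_relators_free kp_free_closed)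

lemma relator_cong:
  assumes "f - g \<in> kp_relators \<Lambda>" "g \<in> kp_free \<Lambda>"
  shows "f \<doteq> g"
  using kp_free_closed(2)[OF kp_relators_free[OF assms(1)] assms(2)] assms
  by (simp add: kp_equiv_def kp_cong_def kp_null.rel)

lemma null_cong: "f \<in> kp_null \<Lambda> \<longleftrightarrow> f \<doteq> 0"
  using kp_null_free by (auto simp: kp_equiv_def kp_cong_def kp_free_closed)

section \<open>The defining relations as congruences\<close>

lemma p_idem: "v \<in> obj \<Lambda> \<Longrightarrow> free_p v * free_p v \<doteq> free_p v"
  by (intro relator_cong kp_relators.idem) simp_all

lemma p_orth: "v \<in> obj \<Lambda> \<Longrightarrow> w \<in> obj \<Lambda> \<Longrightarrow> v \<noteq> w \<Longrightarrow> free_p v * free_p w \<doteq> 0"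
  by (intro relator_cong) (simp_all add: kp_relators.orth kp_free_closed)

lemma S_mult:
  "\<lbrakk>x \<in> mor \<Lambda>; y \<in> mor \<Lambda>; src \<Lambda> x = rng \<Lambda> y\<rbrakk> \<Longrightarrow> S x * S y \<doteq> S (x \<diamondop> y)"
  by (intro relator_cong kp_relators.path_mult) (simp_all add: cmp_mor)

lemma T_mult:
  "\<lbrakk>x \<in> mor \<Lambda>; y \<in> mor \<Lambda>; src \<Lambda> x = rng \<Lambda> y\<rbrakk> \<Longrightarrow> T y * T x \<doteq> T (x \<diamondop> y)"
  by (intro relator_cong kp_relators.ghost_mult) (simp_all add: cmp_mor)

lemma T_S_same: "x \<in> mor \<Lambda> \<Longrightarrow> T x * S x \<doteq> free_p (src \<Lambda> x)"
  using kp_relators.ghost_path[of x \<Lambda> x] by (intro relator_cong) (simp_all add: src_obj)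

lemma T_S_diff:
  "\<lbrakk>x \<in> mor \<Lambda>; y \<in> mor \<Lambda>; deg \<Lambda> x = deg \<Lambda> y; x \<noteq> y\<rbrakk> \<Longrightarrow> T x * S y \<doteq> 0"
  using kp_relators.ghost_path[of x \<Lambda> y] by (intro relator_cong) (simp_all add: kp_free_closed)

lemma p_sum: "v \<in> obj \<Lambda> \<Longrightarrow> free_p v \<doteq> (\<Sum>x\<in>paths_from \<Lambda> v n. S x * T x)"
  by (intro relator_cong kp_relators.vertex_sum)
    (auto intro!: kp_free_sum kp_free_closed(3) simp: paths_from_def)

lemma p_S: "x \<in> mor \<Lambda> \<Longrightarrow> free_p (rng \<Lambda> x) * S x \<doteq> S x"
  using S_mult[of "rng \<Lambda> x" x] by (simp add: S_obj rng_obj obj_mor src_id cmp_id_left)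

lemma S_p: "x \<in> mor \<Lambda> \<Longrightarrow> S x * free_p (src \<Lambda> x) \<doteq> S x"
  using S_mult[of x "src \<Lambda> x"] by (simp add: S_obj src_obj obj_mor rng_id cmp_id_right)

lemma p_T: "x \<in> mor \<Lambda> \<Longrightarrow> free_p (src \<Lambda> x) * T x \<doteq> T x"
  using T_mult[of x "src \<Lambda> x"] by (simp add: T_obj src_obj obj_mor rng_id cmp_id_right)

lemma T_p: "x \<in> mor \<Lambda> \<Longrightarrow> T x * free_p (rng \<Lambda> x) \<doteq> T x"
  using T_mult[of "rng \<Lambda> x" x] by (simp add: T_obj rng_obj obj_mor src_id cmp_id_left)

lemma cong_mult_left: "f \<in> kp_free \<Lambda> \<Longrightarrow> g \<doteq> h \<Longrightarrow> f * g \<doteq> f * h"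
  by (intro kp_equiv_mult kp_equiv_refl)

lemma cong_mult_right: "f \<in> kp_free \<Lambda> \<Longrightarrow> g \<doteq> h \<Longrightarrow> g * f \<doteq> h * f"
  by (intro kp_equiv_mult kp_equiv_refl)

text \<open>Inserting the one-sided units \<open>e\<close> and \<open>f\<close> puts the product
  \<open>e * f\<close>, which vanishes, between \<open>a\<close> and \<open>b\<close>.\<close>

lemma orth_mult_zero:
  fixes a b e f :: "('m, 'r::{comm_ring, comm_monoid_mult}) kp_free"
  assumes "a * e \<doteq> a" "f * b \<doteq> b" "e * f \<doteq> 0" "e \<in> kp_free \<Lambda>" "f \<in> kp_free \<Lambda>"
  shows "a * b \<doteq> 0"
proof -
  have "a * b \<doteq> (a * e) * (f * b)"
    using assms(1,2) by (intro kp_equiv_mult kp_equiv_sym[OF assms(1)] kp_equiv_sym[OF assms(2)])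
  also have "\<dots> = a * (e * f) * b" by (simp add: mult.assoc)
  also have "\<dots> \<doteq> a * 0 * b"
    using assms by (intro kp_equiv_mult kp_equiv_refl) (auto dest: kp_equivD)
  finally show ?thesis by simp
qed

section \<open>Products of path and ghost elements\<close>

lemma S_mult_zero:
  "\<lbrakk>x \<in> mor \<Lambda>; y \<in> mor \<Lambda>; src \<Lambda> x \<noteq> rng \<Lambda> y\<rbrakk> \<Longrightarrow> S x * S y \<doteq> 0"
  by (rule orth_mult_zero[OF S_p p_S p_orth]) (simp_all add: src_obj rng_obj)

lemma T_S_zero:
  "\<lbrakk>x \<in> mor \<Lambda>; y \<in> mor \<Lambda>; rng \<Lambda> x \<noteq> rng \<Lambda> y\<rbrakk> \<Longrightarrow> T x * S y \<doteq> 0"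
  by (rule orth_mult_zero[OF T_p p_S p_orth]) (simp_all add: rng_obj)

text \<open>Factor \<open>y\<close> as \<open>y1 \<diamondop> z\<close> with \<open>y1\<close> of
  the degree of \<open>x\<close>. The product \<open>T x * S y1\<close> is a vertex if
  \<open>x = y1\<close> and zero otherwise, which leaves \<open>S z\<close> or nothing.\<close>

lemma T_S_longer:
  assumes "x \<in> mor \<Lambda>" "y \<in> mor \<Lambda>" "deg \<Lambda> x \<le> deg \<Lambda> y"
  obtains (zero) "(T x * S y :: ('m, 'r::{comm_ring, comm_monoid_mult}) kp_free) \<doteq> 0"
  | (ext) z where "z \<in> mor \<Lambda>" "src \<Lambda> x = rng \<Lambda> z" "y = x \<diamondop> z" "deg \<Lambda> z = deg \<Lambda> y - deg \<Lambda> x"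
    "(T x * S y :: ('m, 'r) kp_free) \<doteq> S z"
proof -
  obtain y1 z where y: "y1 \<in> mor \<Lambda>" "z \<in> mor \<Lambda>" "src \<Lambda> y1 = rng \<Lambda> z" "deg \<Lambda> y1 = deg \<Lambda> x"
    "deg \<Lambda> z = deg \<Lambda> y - deg \<Lambda> x" "y = y1 \<diamondop> z"
    using factorE[OF assms(2,3)] by metis
  have "(T x * S y :: ('m, 'r) kp_free) \<doteq> T x * (S y1 * S z)"
    unfolding y(6) using assms(1) y by (intro cong_mult_left kp_equiv_sym[OF S_mult]) simp_all
  also have "T x * (S y1 * S z) = T x * S y1 * S z" by (simp only: mult.assoc)
  finally have *: "(T x * S y :: ('m, 'r) kp_free) \<doteq> T x * S y1 * S z" .
  show thesis
  proof (cases "x = y1")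
    case True
    have "T x * S y1 * S z \<doteq> (free_p (src \<Lambda> x) * S z :: ('m, 'r) kp_free)"
      unfolding True by (intro cong_mult_right T_S_same S_free y)
    also have "\<dots> \<doteq> S z" using p_S[OF y(2)] True y(3) by simp
    finally show ?thesis using ext[OF y(2)] y True kp_equiv_trans[OF *] by blast
  next
    case False
    have "T x * S y1 * S z \<doteq> (0 * S z :: ('m, 'r) kp_free)"
      using False assms(1) y by (intro cong_mult_right T_S_diff) simp_all
    then show ?thesis using zero kp_equiv_trans[OF *] by simp
  qed
qed

text \<open>Mirror image of the zero case above: \<open>T y\<close> splits as
  \<open>T z * T y1\<close> with \<open>y1\<close> of the degree of \<open>x\<close>, and
  \<open>y1 = x\<close> would make \<open>y\<close> an extension of \<open>x\<close>.\<close>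

lemma T_S_shorter:
  assumes "x \<in> mor \<Lambda>" "y \<in> mor \<Lambda>" "deg \<Lambda> x \<le> deg \<Lambda> y"
    and "\<not> (\<exists>z\<in>mor \<Lambda>. src \<Lambda> x = rng \<Lambda> z \<and> y = x \<diamondop> z)"
  shows "T y * S x \<doteq> 0"
proof -
  obtain y1 z where y: "y1 \<in> mor \<Lambda>" "z \<in> mor \<Lambda>" "src \<Lambda> y1 = rng \<Lambda> z" "deg \<Lambda> y1 = deg \<Lambda> x"
    "y = y1 \<diamondop> z"
    using factorE[OF assms(2,3)] by metis
  have "T y * S x \<doteq> T z * T y1 * S x"
    unfolding y(5) using assms(1) y by (intro cong_mult_right kp_equiv_sym[OF T_mult]) simp_all
  also have "T z * T y1 * S x = T z * (T y1 * S x)" by (simp only: mult.assoc)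
  also have "\<dots> \<doteq> T z * 0"
    using assms y by (intro cong_mult_left T_S_diff) auto
  finally show ?thesis by simp
qed

text \<open>Insert the vertex \<open>rng \<Lambda> x\<close> between the factors and expand it over
  the paths \<open>k\<close> of degree \<open>deg \<Lambda> x + deg \<Lambda> y\<close>. Such a
  \<open>k\<close> is at least as long as both paths, so \<open>T x * S k\<close> vanishes unless
  \<open>k\<close> extends \<open>x\<close>, and \<open>T k * S y\<close> vanishes unless
  \<open>k\<close> extends \<open>y\<close>.\<close>

lemma T_S_no_common_extension:
  assumes x: "x \<in> mor \<Lambda>" and y: "y \<in> mor \<Lambda>"
    and no: "\<not> (\<exists>z\<in>mor \<Lambda>. \<exists>w\<in>mor \<Lambda>. src \<Lambda> x = rng \<Lambda> z \<and> src \<Lambda> y = rng \<Lambda> w \<and> x \<diamondop> z = y \<diamondop> w)"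
  shows "(T x * S y :: ('m, 'r::{comm_ring, comm_monoid_mult}) kp_free) \<doteq> 0"
proof (cases "rng \<Lambda> x = rng \<Lambda> y")
  case False
  then show ?thesis using x y by (intro T_S_zero)
next
  case True
  let ?A = "paths_from \<Lambda> (rng \<Lambda> x) (deg \<Lambda> x + deg \<Lambda> y)"
  have A: "k \<in> mor \<Lambda>" "deg \<Lambda> x \<le> deg \<Lambda> k" "deg \<Lambda> y \<le> deg \<Lambda> k" if "k \<in> ?A" for k
    using that by (auto simp: paths_from_def nat_vec_le_add)
  have zero: "(T x * (S k * T k) * S y :: ('m, 'r) kp_free) \<doteq> 0" if k: "k \<in> ?A" for k
  proof -
    have eq: "(T x * (S k * T k) * S y :: ('m, 'r) kp_free) = (T x * S k) * (T k * S y)" by (simp only: mult.assoc)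
    show ?thesis
    proof (cases "\<exists>w\<in>mor \<Lambda>. src \<Lambda> y = rng \<Lambda> w \<and> k = y \<diamondop> w")
      case True
      show ?thesis
        using A(1,2)[OF k]
      proof (rule T_S_longer[OF x])
        assume "(T x * S k :: ('m, 'r) kp_free) \<doteq> 0"
        then have "(T x * S k) * (T k * S y) \<doteq> (0 :: ('m, 'r) kp_free) * (T k * S y)"
          using A(1)[OF k] y by (intro cong_mult_right kp_free_closed) simp_all
        then show ?thesis unfolding eq by simp
      next
        fix z assume "z \<in> mor \<Lambda>" "src \<Lambda> x = rng \<Lambda> z" "k = x \<diamondop> z"
        with True no show ?thesis by metis
      qed
    next
      case False
      have "(T x * S k) * (T k * S y) \<doteq> (T x * S k) * (0 :: ('m, 'r) kp_free)"
        using A(1)[OF k] x by (intro cong_mult_left kp_free_closed T_S_shorter[OF y _ A(3)[OF k] False]) simp_all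
      then show ?thesis unfolding eq by simp
    qed
  qed
  have "(T x * S y :: ('m, 'r) kp_free) \<doteq> T x * free_p (rng \<Lambda> x) * S y"
    using x y by (intro cong_mult_right kp_equiv_sym[OF T_p]) simp_all
  also have "\<dots> \<doteq> T x * (\<Sum>k\<in>?A. S k * T k) * S y"
    using x y by (intro cong_mult_right cong_mult_left p_sum) (simp_all add: rng_obj)
  also have "\<dots> = (\<Sum>k\<in>?A. T x * (S k * T k) * S y)"
    by (simp only: sum_distrib_left sum_distrib_right)
  also have "\<dots> \<doteq> (\<Sum>k\<in>?A. 0)" using zero by (rule kp_equiv_sum)
  finally show ?thesis by simp
qed

end

section \<open>Ideals\<close>

text \<open>The preimage in the free algebra of an ideal of \<open>KP \<Lambda>\<close>.\<close>

definition lifted_ideal ::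
  "('m, 'k::finite) kgraph \<Rightarrow> ('m, 'r::{comm_ring, comm_monoid_mult}) kp_free set \<Rightarrow> bool" where
  "lifted_ideal \<Lambda> J \<longleftrightarrow> J \<subseteq> kp_free \<Lambda> \<and> kp_null \<Lambda> \<subseteq> J \<and> (\<forall>f\<in>J. \<forall>g\<in>J. f + g \<in> J)
     \<and> (\<forall>a\<in>kp_free \<Lambda>. \<forall>f\<in>J. a * f \<in> J \<and> f * a \<in> J)"

lemma lifted_idealD:
  assumes "lifted_ideal \<Lambda> J"
  shows "f \<in> J \<Longrightarrow> f \<in> kp_free \<Lambda>" "f \<in> kp_null \<Lambda> \<Longrightarrow> f \<in> J"
    "f \<in> J \<Longrightarrow> g \<in> J \<Longrightarrow> f + g \<in> J"
    "a \<in> kp_free \<Lambda> \<Longrightarrow> f \<in> J \<Longrightarrow> a * f \<in> J"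
    "a \<in> kp_free \<Lambda> \<Longrightarrow> f \<in> J \<Longrightarrow> f * a \<in> J"
  using assms unfolding lifted_ideal_def by blast+

lemma lifted_ideal_equiv:
  assumes "lifted_ideal \<Lambda> J" "f \<in> J" "kp_equiv \<Lambda> f g"
  shows "g \<in> J"
  using lifted_idealD(3)[OF assms(1,2) lifted_idealD(2)[OF assms(1) kp_equivD(3)[OF kp_equiv_sym[OF assms(3)]]]]
  by simp

lemma lifted_ideal_sum:
  assumes "lifted_ideal \<Lambda> J" "\<And>i. i \<in> A \<Longrightarrow> h i \<in> J"
  shows "sum h A \<in> J"
  using assms(2)
  by (induction A rule: infinite_finite_induct)
    (simp_all add: lifted_idealD(3)[OF assms(1)] lifted_idealD(2)[OF assms(1)] kp_null.zero)

context kp_graph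
begin

text \<open>Vertices count as paths of degree zero, which leaves two kinds of generators.\<close>

lemma kp_free_path_induct [consumes 1, case_names zero add smult path ghost mult]:
  fixes f :: "('m, 'r::{comm_ring, comm_monoid_mult}) kp_free"
  assumes "f \<in> kp_free \<Lambda>"
    and "P 0"
    and "\<And>f g. \<lbrakk>f \<in> kp_free \<Lambda>; g \<in> kp_free \<Lambda>; P f; P g\<rbrakk> \<Longrightarrow> P (f + g)"
    and "\<And>r f. \<lbrakk>f \<in> kp_free \<Lambda>; P f\<rbrakk> \<Longrightarrow> P (r \<cdot> f)"
    and S: "\<And>x. x \<in> mor \<Lambda> \<Longrightarrow> P (S x)"
    and T: "\<And>x. x \<in> mor \<Lambda> \<Longrightarrow> P (T x)"
    and "\<And>f g. \<lbrakk>f \<in> kp_free \<Lambda>; g \<in> kp_free \<Lambda>; P f; P g\<rbrakk> \<Longrightarrow> P (f * g)"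
  shows "P f"
  using assms(1)
proof (induction rule: kp_free_induct)
  case (gen g)
  then consider v where "v \<in> obj \<Lambda>" "g = Vert v"
    | x where "x \<in> mor \<Lambda>" "deg \<Lambda> x \<noteq> 0" "g = Path x"
    | x where "x \<in> mor \<Lambda>" "deg \<Lambda> x \<noteq> 0" "g = Ghost x"
    unfolding kp_gens_def by blast
  then show ?case
  proof cases
    case 1
    then show ?thesis using S[OF obj_mor[OF 1(1)]] by (simp add: S_obj free_p_def)
  next
    case 2
    then show ?thesis using S[OF 2(1)] by (simp add: free_s_def)
  next
    case 3
    then show ?thesis using T[OF 3(1)] by (simp add: free_t_def)
  qed
qed (fact assms)+

section \<open>Local units and closure of ideals under scalars\<close>

lemma p_sum_unit:
  assumes "finite V" "V \<subseteq> obj \<Lambda>" "u \<in> V"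
  shows "free_p u * (\<Sum>v\<in>V. free_p v) \<doteq> free_p u"
proof -
  have "free_p u * (\<Sum>v\<in>V. free_p v) = (\<Sum>v\<in>V. free_p u * free_p v)"
    by (rule sum_distrib_left)
  also have "\<dots> \<doteq> (\<Sum>v\<in>V. if u = v then free_p u else 0)"
  proof (rule kp_equiv_sum)
    fix v assume "v \<in> V"
    then show "free_p u * free_p v \<doteq> (if u = v then free_p u else 0)"
      using assms(2,3) by (cases "u = v") (auto intro: p_idem p_orth)
  qed
  finally show ?thesis using assms(1,3) by simp
qed

lemma right_unit_vertex:
  assumes "g * free_p u \<doteq> g" "u \<in> V" "finite V" "V \<subseteq> obj \<Lambda>"
  shows "g * (\<Sum>v\<in>V. free_p v) \<doteq> g"
proof -
  have V: "(\<Sum>v\<in>V. free_p v) \<in> kp_free \<Lambda>" using assms(4) by (intro kp_free_sum) auto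
  have "g * (\<Sum>v\<in>V. free_p v) \<doteq> g * free_p u * (\<Sum>v\<in>V. free_p v)"
    by (rule cong_mult_right[OF V kp_equiv_sym[OF assms(1)]])
  also have "\<dots> = g * (free_p u * (\<Sum>v\<in>V. free_p v))" by (rule mult.assoc)
  also have "\<dots> \<doteq> g * free_p u"
    by (rule cong_mult_left[OF kp_equivD(2)[OF assms(1)] p_sum_unit[OF assms(3,4,2)]])
  also note assms(1)
  finally show ?thesis .
qed

text \<open>Asking for all finite \<open>V\<close> above \<open>U\<close>, instead of one set, lets
  a sum be treated by the union of the sets of its summands. For a product the set of the right
  factor suffices.\<close>

lemma right_unit:
  fixes f :: "('m, 'r::{comm_ring, comm_monoid_mult}) kp_free"
  assumes "f \<in> kp_free \<Lambda>"
  shows "\<exists>U. finite U \<and> U \<subseteq> obj \<Lambda>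
    \<and> (\<forall>V. finite V \<longrightarrow> U \<subseteq> V \<longrightarrow> V \<subseteq> obj \<Lambda> \<longrightarrow> f * (\<Sum>v\<in>V. free_p v) \<doteq> f)"
  using assms
proof (induction rule: kp_free_path_induct)
  case zero
  then show ?case by (intro exI[of _ "{}"]) (simp add: kp_equiv_refl kp_free_closed)
next
  case (add f g)
  obtain U where U: "finite U" "U \<subseteq> obj \<Lambda>"
      "\<And>V. \<lbrakk>finite V; U \<subseteq> V; V \<subseteq> obj \<Lambda>\<rbrakk> \<Longrightarrow> f * (\<Sum>v\<in>V. free_p v) \<doteq> f"
    using add.IH(1) by blast
  obtain W where W: "finite W" "W \<subseteq> obj \<Lambda>"
      "\<And>V. \<lbrakk>finite V; W \<subseteq> V; V \<subseteq> obj \<Lambda>\<rbrakk> \<Longrightarrow> g * (\<Sum>v\<in>V. free_p v) \<doteq> g"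
    using add.IH(2) by blast
  show ?case
    using U(1,2) W(1,2)
    by (intro exI[of _ "U \<union> W"]) (auto simp: distrib_right intro!: kp_equiv_add U(3) W(3))
next
  case (smult r f)
  then obtain U where U: "finite U" "U \<subseteq> obj \<Lambda>"
      "\<And>V. \<lbrakk>finite V; U \<subseteq> V; V \<subseteq> obj \<Lambda>\<rbrakk> \<Longrightarrow> f * (\<Sum>v\<in>V. free_p v) \<doteq> f"
    by blast
  then show ?case by (intro exI[of _ U]) (auto simp: smult_mult_left intro!: kp_equiv_smult U(3))
next
  case (path x)
  then show ?case
    by (intro exI[of _ "{src \<Lambda> x}"]) (auto simp: src_obj intro!: right_unit_vertex[OF S_p])
next
  case (ghost x)
  then show ?case
    by (intro exI[of _ "{rng \<Lambda> x}"]) (auto simp: rng_obj intro!: right_unit_vertex[OF T_p])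
next
  case (mult f g)
  obtain U where U: "finite U" "U \<subseteq> obj \<Lambda>"
      "\<And>V. \<lbrakk>finite V; U \<subseteq> V; V \<subseteq> obj \<Lambda>\<rbrakk> \<Longrightarrow> g * (\<Sum>v\<in>V. free_p v) \<doteq> g"
    using mult.IH(2) by blast
  then show ?case
    by (intro exI[of _ U]) (auto simp: mult.assoc intro!: cong_mult_left mult.hyps U(3))
qed

text \<open>Scalar closure is not part of the notion of ideal. A local unit \<open>e\<close> of
  \<open>f\<close> supplies it, since \<open>r \<cdot> f\<close> is congruent to
  \<open>f * (r \<cdot> e)\<close>.\<close>

lemma lifted_ideal_smult:
  assumes J: "lifted_ideal \<Lambda> J" and f: "f \<in> J"
  shows "r \<cdot> f \<in> J"
proof -
  obtain U where U: "finite U" "U \<subseteq> obj \<Lambda>" "f * (\<Sum>v\<in>U. free_p v) \<doteq> f"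
    using right_unit[OF lifted_idealD(1)[OF J f]] by blast
  have "f * (r \<cdot> (\<Sum>v\<in>U. free_p v)) \<in> J"
    using U(2) by (intro lifted_idealD(5)[OF J _ f] kp_free_closed(4) kp_free_sum) auto
  then show ?thesis
    by (rule lifted_ideal_equiv[OF J]) (simp add: smult_mult_right kp_equiv_smult U(3))
qed

text \<open>Hereditary, because multiplication by \<open>T x\<close> on the left and
  \<open>S x\<close> on the right moves \<open>r\<close> from the range of \<open>x\<close> to its
  source. Saturated, because \<open>p_v\<close> is the sum of the
  \<open>S x * free_p (src \<Lambda> x) * T x\<close> over the paths \<open>x\<close> of degree
  \<open>n\<close> from \<open>v\<close>.\<close>

lemma coefficient_sat_her:
  assumes J: "lifted_ideal \<Lambda> J"
  shows "{v \<in> obj \<Lambda>. r \<cdot> free_p v \<in> J} \<in> sat_her \<Lambda>"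
proof (rule sat_herI)
  fix x assume x: "x \<in> mor \<Lambda>" and r: "rng \<Lambda> x \<in> {v \<in> obj \<Lambda>. r \<cdot> free_p v \<in> J}"
  have "T x * (r \<cdot> free_p (rng \<Lambda> x)) * S x \<in> J"
    using r x by (intro lifted_idealD(4,5)[OF J]) auto
  moreover have "T x * (r \<cdot> free_p (rng \<Lambda> x)) * S x \<doteq> r \<cdot> free_p (src \<Lambda> x)"
  proof -
    have "T x * (r \<cdot> free_p (rng \<Lambda> x)) * S x = r \<cdot> (T x * (free_p (rng \<Lambda> x) * S x))"
      by (simp add: smult_mult_right smult_mult_left mult.assoc)
    also have "\<dots> \<doteq> r \<cdot> (T x * S x)" using x by (intro kp_equiv_smult cong_mult_left p_S T_free)
    also have "\<dots> \<doteq> r \<cdot> free_p (src \<Lambda> x)" using x by (intro kp_equiv_smult T_S_same)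
    finally show ?thesis .
  qed
  ultimately show "src \<Lambda> x \<in> {v \<in> obj \<Lambda>. r \<cdot> free_p v \<in> J}"
    using lifted_ideal_equiv[OF J] src_obj[OF x] by blast
next
  fix v n assume v: "v \<in> obj \<Lambda>"
    and r: "src \<Lambda> ` paths_from \<Lambda> v n \<subseteq> {v \<in> obj \<Lambda>. r \<cdot> free_p v \<in> J}"
  have "r \<cdot> free_p v \<doteq> r \<cdot> (\<Sum>x\<in>paths_from \<Lambda> v n. S x * T x)"
    by (intro kp_equiv_smult p_sum v)
  also have "\<dots> = (\<Sum>x\<in>paths_from \<Lambda> v n. r \<cdot> (S x * T x))" by (rule smult_sum)
  also have "\<dots> \<doteq> (\<Sum>x\<in>paths_from \<Lambda> v n. S x * (r \<cdot> free_p (src \<Lambda> x)) * T x)"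
  proof (rule kp_equiv_sum)
    fix x assume "x \<in> paths_from \<Lambda> v n"
    then have x: "x \<in> mor \<Lambda>" by (simp add: paths_from_def)
    have "r \<cdot> (S x * T x) \<doteq> r \<cdot> (S x * free_p (src \<Lambda> x) * T x)"
      by (rule kp_equiv_smult[OF cong_mult_right[OF T_free[OF x] kp_equiv_sym[OF S_p[OF x]]]])
    then show "r \<cdot> (S x * T x) \<doteq> S x * (r \<cdot> free_p (src \<Lambda> x)) * T x"
      by (simp add: smult_mult_right smult_mult_left)
  qed
  finally have eq: "r \<cdot> free_p v \<doteq> (\<Sum>x\<in>paths_from \<Lambda> v n. S x * (r \<cdot> free_p (src \<Lambda> x)) * T x)" .
  have "(\<Sum>x\<in>paths_from \<Lambda> v n. S x * (r \<cdot> free_p (src \<Lambda> x)) * T x) \<in> J"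
  proof (rule lifted_ideal_sum[OF J])
    fix x assume x: "x \<in> paths_from \<Lambda> v n"
    then have "x \<in> mor \<Lambda>" "r \<cdot> free_p (src \<Lambda> x) \<in> J" using r by (auto simp: paths_from_def)
    then show "S x * (r \<cdot> free_p (src \<Lambda> x)) * T x \<in> J"
      by (intro lifted_idealD(4,5)[OF J] S_free T_free)
  qed
  then show "v \<in> {v \<in> obj \<Lambda>. r \<cdot> free_p v \<in> J}"
    using lifted_ideal_equiv[OF J _ kp_equiv_sym[OF eq]] v by blast
qed auto

section \<open>Reduction to combinations of paths\<close>

text \<open>Indexing by a set \<open>L\<close> keeps the paths distinct, as needed to isolate one
  coefficient. The lower bound \<open>m\<close> on degrees serves the product case of the induction
  in \<open>mult_long_path_in_path_span\<close>.\<close>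

definition path_span :: "'m \<Rightarrow> nat ^ 'k \<Rightarrow> ('m, 'r::{comm_ring, comm_monoid_mult}) kp_free set" where
  "path_span w m = {f. \<exists>L c. finite L \<and> (\<forall>x\<in>L. x \<in> mor \<Lambda> \<and> src \<Lambda> x = w \<and> m \<le> deg \<Lambda> x)
     \<and> f \<doteq> (\<Sum>x\<in>L. c x \<cdot> S x)}"

lemma path_span_S: "x \<in> mor \<Lambda> \<Longrightarrow> m \<le> deg \<Lambda> x \<Longrightarrow> S x \<in> path_span (src \<Lambda> x) m"
  unfolding path_span_def
  by (intro CollectI exI[of _ "{x}"] exI[of _ "\<lambda>_. 1"]) (simp add: kp_equiv_refl)

lemma path_span_equiv: "f \<doteq> g \<Longrightarrow> g \<in> path_span w m \<Longrightarrow> f \<in> path_span w m"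
  unfolding path_span_def by (blast intro: kp_equiv_trans)

lemma path_span_zero: "0 \<in> path_span w m"
  unfolding path_span_def
  by (intro CollectI exI[of _ "{}"] exI[of _ "\<lambda>_. 1"]) (simp add: kp_equiv_refl kp_free_closed)

lemma path_span_smult:
  assumes "f \<in> path_span w m"
  shows "r \<cdot> f \<in> path_span w m"
proof -
  obtain L c where L: "finite L" "\<forall>x\<in>L. x \<in> mor \<Lambda> \<and> src \<Lambda> x = w \<and> m \<le> deg \<Lambda> x"
    "f \<doteq> (\<Sum>x\<in>L. c x \<cdot> S x)" using assms unfolding path_span_def by blast
  then show ?thesis
    unfolding path_span_def using kp_equiv_smult[OF L(3), of r]
    by (intro CollectI exI[of _ L] exI[of _ "\<lambda>x. r * c x"]) (simp add: smult_sum smult_smult)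
qed

lemma path_span_add:
  assumes "f \<in> path_span w m" "g \<in> path_span w m"
  shows "f + g \<in> path_span w m"
proof -
  obtain L c where L: "finite L" "\<forall>x\<in>L. x \<in> mor \<Lambda> \<and> src \<Lambda> x = w \<and> m \<le> deg \<Lambda> x"
    "f \<doteq> (\<Sum>x\<in>L. c x \<cdot> S x)" using assms(1) unfolding path_span_def by blast
  obtain M d where M: "finite M" "\<forall>x\<in>M. x \<in> mor \<Lambda> \<and> src \<Lambda> x = w \<and> m \<le> deg \<Lambda> x"
    "g \<doteq> (\<Sum>x\<in>M. d x \<cdot> S x)" using assms(2) unfolding path_span_def by blast
  \<comment> \<open>Both coefficient functions are extended by zero to the union and added.\<close>
  let ?e = "\<lambda>x. (if x \<in> L then c x else 0) + (if x \<in> M then d x else 0)"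
  have "(\<Sum>x\<in>L \<union> M. (if x \<in> L then c x else 0) \<cdot> S x) = (\<Sum>x\<in>L. c x \<cdot> S x)"
    "(\<Sum>x\<in>L \<union> M. (if x \<in> M then d x else 0) \<cdot> S x) = (\<Sum>x\<in>M. d x \<cdot> S x)"
    using L(1) M(1) by (intro sum.mono_neutral_cong_right; auto)+
  then have "(\<Sum>x\<in>L \<union> M. ?e x \<cdot> S x) = (\<Sum>x\<in>L. c x \<cdot> S x) + (\<Sum>x\<in>M. d x \<cdot> S x)"
    by (simp only: smult_add_left sum.distrib)
  then have "f + g \<doteq> (\<Sum>x\<in>L \<union> M. ?e x \<cdot> S x)" using kp_equiv_add[OF L(3) M(3)] by simp
  then show ?thesis
    unfolding path_span_def using L M
    by (intro CollectI exI[of _ "L \<union> M"] exI[of _ ?e]) auto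
qed

lemma path_span_sum:
  assumes "\<And>i. i \<in> A \<Longrightarrow> h i \<in> path_span w m"
  shows "sum h A \<in> path_span w m"
  using assms
  by (induction A rule: infinite_finite_induct) (simp_all add: path_span_zero path_span_add)

text \<open>Induction with \<open>m\<close> free: in \<open>f * g * S y\<close> the paths produced
  by \<open>g\<close> have to be long enough for \<open>f\<close>, so the threshold of
  \<open>f\<close> becomes the bound \<open>m\<close> for \<open>g\<close>. A ghost
  \<open>T x\<close> shortens paths by the degree of \<open>x\<close>, whence its threshold
  \<open>deg \<Lambda> x + m\<close>.\<close>

lemma mult_long_path_in_path_span:
  fixes f :: "('m, 'r::{comm_ring, comm_monoid_mult}) kp_free"
  assumes "f \<in> kp_free \<Lambda>"
  shows "\<exists>n. \<forall>y\<in>mor \<Lambda>. n \<le> deg \<Lambda> y \<longrightarrow> f * S y \<in> path_span (src \<Lambda> y) m"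
  using assms
proof (induction arbitrary: m rule: kp_free_path_induct)
  case zero
  show ?case by (simp add: path_span_zero)
next
  case (add f g)
  obtain n1 where n1: "\<And>y. y \<in> mor \<Lambda> \<Longrightarrow> n1 \<le> deg \<Lambda> y \<Longrightarrow> f * S y \<in> path_span (src \<Lambda> y) m"
    using add.IH(1) by blast
  obtain n2 where n2: "\<And>y. y \<in> mor \<Lambda> \<Longrightarrow> n2 \<le> deg \<Lambda> y \<Longrightarrow> g * S y \<in> path_span (src \<Lambda> y) m"
    using add.IH(2) by blast
  show ?case
    unfolding distrib_right
    by (intro exI[of _ "n1 + n2"] ballI impI path_span_add n1 n2)
      (assumption | erule order_trans[rotated], rule nat_vec_le_add)+
next
  case (smult r f)
  obtain n where n: "\<And>y. y \<in> mor \<Lambda> \<Longrightarrow> n \<le> deg \<Lambda> y \<Longrightarrow> f * S y \<in> path_span (src \<Lambda> y) m"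
    using smult.IH by blast
  show ?case
    unfolding smult_mult_left by (intro exI[of _ n] ballI impI path_span_smult n)
next
  case (path x)
  show ?case
  proof (intro exI[of _ m] ballI impI)
    fix y assume y: "y \<in> mor \<Lambda>" "m \<le> deg \<Lambda> y"
    show "S x * S y \<in> path_span (src \<Lambda> y) m"
    proof (cases "src \<Lambda> x = rng \<Lambda> y")
      case True
      have "m \<le> deg \<Lambda> (x \<diamondop> y)"
        using y deg_cmp[OF path y(1) True] nat_vec_le_add(2) order_trans by metis
      then show ?thesis
        using path_span_S[OF cmp_mor[OF path y(1) True]]
        by (intro path_span_equiv[OF S_mult[OF path y(1) True]]) (simp add: src_cmp[OF path y(1) True])
    next
      case False
      show ?thesis
        by (rule path_span_equiv[OF S_mult_zero[OF path y(1) False] path_span_zero])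
    qed
  qed
next
  case (ghost x)
  show ?case
  proof (intro exI[of _ "deg \<Lambda> x + m"] ballI impI)
    fix y assume y: "y \<in> mor \<Lambda>" "deg \<Lambda> x + m \<le> deg \<Lambda> y"
    then have le: "deg \<Lambda> x \<le> deg \<Lambda> y" using nat_vec_le_add(1) order_trans by blast
    show "(T x * S y :: ('m, 'r) kp_free) \<in> path_span (src \<Lambda> y) m"
    proof (rule T_S_longer[OF ghost y(1) le])
      assume "(T x * S y :: ('m, 'r) kp_free) \<doteq> 0"
      then show ?thesis by (rule path_span_equiv[OF _ path_span_zero])
    next
      fix z assume z: "z \<in> mor \<Lambda>" "src \<Lambda> x = rng \<Lambda> z" "y = x \<diamondop> z"
        "(T x * S y :: ('m, 'r) kp_free) \<doteq> S z"
      have "m \<le> deg \<Lambda> z" "src \<Lambda> y = src \<Lambda> z"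
        using y(2) deg_cmp[OF ghost z(1,2)] src_cmp[OF ghost z(1,2)]
        by (simp_all add: z(3) nat_vec_add_le_cancel)
      then show ?thesis using path_span_equiv[OF z(4) path_span_S[OF z(1)]] by simp
    qed
  qed
next
  case (mult f g)
  obtain n1 where n1: "\<And>y. y \<in> mor \<Lambda> \<Longrightarrow> n1 \<le> deg \<Lambda> y \<Longrightarrow> f * S y \<in> path_span (src \<Lambda> y) m"
    using mult.IH(1) by blast
  obtain n2 where n2: "\<And>y. y \<in> mor \<Lambda> \<Longrightarrow> n2 \<le> deg \<Lambda> y \<Longrightarrow> g * S y \<in> path_span (src \<Lambda> y) n1"
    using mult.IH(2) by blast
  show ?case
  proof (intro exI[of _ n2] ballI impI)
    fix y assume y: "y \<in> mor \<Lambda>" "n2 \<le> deg \<Lambda> y"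
    obtain L c where L: "finite L" "\<forall>x\<in>L. x \<in> mor \<Lambda> \<and> src \<Lambda> x = src \<Lambda> y \<and> n1 \<le> deg \<Lambda> x"
      "g * S y \<doteq> (\<Sum>x\<in>L. c x \<cdot> S x)" using n2[OF y] unfolding path_span_def by blast
    have "f * g * S y = f * (g * S y)" by (rule mult.assoc)
    also have "\<dots> \<doteq> f * (\<Sum>x\<in>L. c x \<cdot> S x)" by (intro cong_mult_left mult.hyps L(3))
    also have "\<dots> = (\<Sum>x\<in>L. c x \<cdot> (f * S x))" by (simp add: sum_distrib_left smult_mult_right)
    finally show "f * g * S y \<in> path_span (src \<Lambda> y) m"
    proof (rule path_span_equiv[OF _ path_span_sum])
      fix x assume "x \<in> L"
      then show "c x \<cdot> (f * S x) \<in> path_span (src \<Lambda> y) m"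
        using path_span_smult[OF n1[of x]] L(2) by simp
    qed
  qed
qed

section \<open>Aperiodic paths\<close>

text \<open>The objects of \<open>Omega\<close> are the pairs \<open>(p, p)\<close>, so the vertices
  of the path are the values \<open>x (p, p)\<close>; range, source, degree and composition in
  \<open>remove_her\<close> are those of \<open>\<Lambda>\<close>.\<close>

lemma inf_pathD:
  assumes x: "x \<in> inf_paths (remove_her \<Lambda> H)" and pq: "p \<le> q"
  shows "x (p, q) \<in> mor \<Lambda>" "src \<Lambda> (x (p, q)) \<notin> H" "rng \<Lambda> (x (p, q)) = x (p, p)"
    "src \<Lambda> (x (p, q)) = x (q, q)" "deg \<Lambda> (x (p, q)) = q - p"
    "q \<le> r \<Longrightarrow> x (p, q) \<diamondop> x (q, r) = x (p, r)"
proof -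
  have F: "kgraph_functor Omega (remove_her \<Lambda> H) x" using x by (simp add: inf_paths_def)
  have pq': "(p, q) \<in> mor Omega" using pq by (simp add: Omega_def)
  have "x (p, q) \<in> mor (remove_her \<Lambda> H)"
    using F pq' unfolding kgraph_functor_def by blast
  then show "x (p, q) \<in> mor \<Lambda>" "src \<Lambda> (x (p, q)) \<notin> H" by (simp_all add: remove_her_def)
  have "rng (remove_her \<Lambda> H) (x (p, q)) = x (rng Omega (p, q))
      \<and> src (remove_her \<Lambda> H) (x (p, q)) = x (src Omega (p, q))
      \<and> deg (remove_her \<Lambda> H) (x (p, q)) = deg Omega (p, q)"
    using F pq' unfolding kgraph_functor_def by blast
  then show "rng \<Lambda> (x (p, q)) = x (p, p)" "src \<Lambda> (x (p, q)) = x (q, q)"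
    "deg \<Lambda> (x (p, q)) = q - p" by (simp_all add: remove_her_def Omega_def)
  show "x (p, q) \<diamondop> x (q, r) = x (p, r)" if "q \<le> r"
  proof -
    have "(q, r) \<in> mor Omega" "src Omega (p, q) = rng Omega (q, r)"
      using that by (simp_all add: Omega_def)
    then have "x (cmp Omega (p, q) (q, r)) = cmp (remove_her \<Lambda> H) (x (p, q)) (x (q, r))"
      using F pq' unfolding kgraph_functor_def by blast
    then show ?thesis by (simp add: remove_her_def Omega_def)
  qed
qed

text \<open>Cuts the composite of \<open>y\<close>, \<open>x (0, M)\<close> and \<open>z\<close> so
  that the segment \<open>x (a, b)\<close> stands alone behind a factor of known degree. The
  remaining conclusions are the side conditions of \<open>factor_unique\<close>.\<close>

lemma cmp_inf_path_decomp:
  assumes x: "x \<in> inf_paths (remove_her \<Lambda> H)" and y: "y \<in> mor \<Lambda>" "src \<Lambda> y = x (0, 0)"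
    and ab: "a \<le> b" "b \<le> M" and z: "z \<in> mor \<Lambda>" "rng \<Lambda> z = x (M, M)"
  shows "(y \<diamondop> x (0, M)) \<diamondop> z = (y \<diamondop> x (0, a)) \<diamondop> (x (a, b) \<diamondop> (x (b, M) \<diamondop> z))"
    and "y \<diamondop> x (0, a) \<in> mor \<Lambda>" "deg \<Lambda> (y \<diamondop> x (0, a)) = deg \<Lambda> y + a"
    "src \<Lambda> (y \<diamondop> x (0, a)) = x (a, a)"
    "x (b, M) \<diamondop> z \<in> mor \<Lambda>" "rng \<Lambda> (x (b, M) \<diamondop> z) = x (b, b)"
    "x (a, b) \<diamondop> (x (b, M) \<diamondop> z) \<in> mor \<Lambda>" "rng \<Lambda> (x (a, b) \<diamondop> (x (b, M) \<diamondop> z)) = x (a, a)"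
proof -
  note D = inf_pathD[OF x]
  have aM: "a \<le> M" using ab by simp
  note 0 = nat_vec_zero_le
  have sz: "src \<Lambda> (x (p, M)) = rng \<Lambda> z" if "p \<le> M" for p using D(4)[OF that] z(2) by simp
  have ya: "src \<Lambda> y = rng \<Lambda> (x (0, p))" for p using D(3)[OF 0, of p] y(2) by simp
  show *: "y \<diamondop> x (0, a) \<in> mor \<Lambda>" "deg \<Lambda> (y \<diamondop> x (0, a)) = deg \<Lambda> y + a"
    "src \<Lambda> (y \<diamondop> x (0, a)) = x (a, a)"
    using cmp_mor[OF y(1) D(1)[OF 0] ya] deg_cmp[OF y(1) D(1)[OF 0] ya]
      src_cmp[OF y(1) D(1)[OF 0] ya] D(4,5)[OF 0, of a] by simp_all
  show bz: "x (b, M) \<diamondop> z \<in> mor \<Lambda>" "rng \<Lambda> (x (b, M) \<diamondop> z) = x (b, b)"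
    using cmp_mor[OF D(1)[OF ab(2)] z(1) sz[OF ab(2)]] rng_cmp[OF D(1)[OF ab(2)] z(1) sz[OF ab(2)]]
      D(3)[OF ab(2)] by simp_all
  have ab': "src \<Lambda> (x (a, b)) = rng \<Lambda> (x (b, M) \<diamondop> z)" using D(4)[OF ab(1)] bz by simp
  show abz: "x (a, b) \<diamondop> (x (b, M) \<diamondop> z) \<in> mor \<Lambda>" "rng \<Lambda> (x (a, b) \<diamondop> (x (b, M) \<diamondop> z)) = x (a, a)"
    using cmp_mor[OF D(1)[OF ab(1)] bz(1) ab'] rng_cmp[OF D(1)[OF ab(1)] bz(1) ab']
      D(3)[OF ab(1)] by simp_all
  have abM: "src \<Lambda> (x (a, b)) = rng \<Lambda> (x (b, M))" using D(4)[OF ab(1)] D(3)[OF ab(2)] by simp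
  have aM': "src \<Lambda> (x (0, a)) = rng \<Lambda> (x (a, M))" using D(4)[OF 0, of a] D(3)[OF aM] by simp
  have "x (a, b) \<diamondop> (x (b, M) \<diamondop> z) = (x (a, b) \<diamondop> x (b, M)) \<diamondop> z"
    by (rule cmp_assoc[OF D(1)[OF ab(1)] D(1)[OF ab(2)] z(1) abM sz[OF ab(2)], symmetric])
  also have "\<dots> = x (a, M) \<diamondop> z" by (simp only: D(6)[OF ab])
  finally have "(y \<diamondop> x (0, a)) \<diamondop> (x (a, b) \<diamondop> (x (b, M) \<diamondop> z)) = (y \<diamondop> x (0, a)) \<diamondop> (x (a, M) \<diamondop> z)"
    by simp
  also have "\<dots> = ((y \<diamondop> x (0, a)) \<diamondop> x (a, M)) \<diamondop> z"
    by (rule cmp_assoc[OF *(1) D(1)[OF aM] z(1) _ sz[OF aM], symmetric]) (simp add: *(3) D(3)[OF aM])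
  also have "(y \<diamondop> x (0, a)) \<diamondop> x (a, M) = y \<diamondop> (x (0, a) \<diamondop> x (a, M))"
    by (rule cmp_assoc[OF y(1) D(1)[OF 0] D(1)[OF aM] ya aM'])
  also have "x (0, a) \<diamondop> x (a, M) = x (0, M)" by (rule D(6)[OF 0 aM])
  finally show "(y \<diamondop> x (0, M)) \<diamondop> z = (y \<diamondop> x (0, a)) \<diamondop> (x (a, b) \<diamondop> (x (b, M) \<diamondop> z))" by simp
qed

text \<open>
  A common extension of \<open>y x(0,M)\<close> and \<open>z x(0,M)\<close> forces the segments of length \<open>q\<close> of the
  shifts of \<open>x\<close> by \<open>deg z\<close> and \<open>deg y\<close> to agree once \<open>M\<close> is large compared with \<open>q\<close>.
\<close>

lemma aperiodic_no_common_extension: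
  assumes x: "x \<in> inf_paths (remove_her \<Lambda> H)" and aper: "\<And>m n. m \<noteq> n \<Longrightarrow> shift m x \<noteq> shift n x"
    and y: "y \<in> mor \<Lambda>" "src \<Lambda> y = x (0, 0)" and z: "z \<in> mor \<Lambda>" "src \<Lambda> z = x (0, 0)"
    and deg: "deg \<Lambda> y \<noteq> deg \<Lambda> z"
  shows "\<exists>N. \<forall>M\<ge>N. \<not> (\<exists>u\<in>mor \<Lambda>. \<exists>w\<in>mor \<Lambda>. x (M, M) = rng \<Lambda> u \<and> x (M, M) = rng \<Lambda> w
    \<and> (y \<diamondop> x (0, M)) \<diamondop> u = (z \<diamondop> x (0, M)) \<diamondop> w)"
proof (rule ccontr)
  assume "\<not> ?thesis"
  then have ext: "\<exists>M\<ge>N. \<exists>u\<in>mor \<Lambda>. \<exists>w\<in>mor \<Lambda>. x (M, M) = rng \<Lambda> u \<and> x (M, M) = rng \<Lambda> w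
    \<and> (y \<diamondop> x (0, M)) \<diamondop> u = (z \<diamondop> x (0, M)) \<diamondop> w" for N by blast
  let ?m = "deg \<Lambda> y" and ?n = "deg \<Lambda> z"
  note D = inf_pathD[OF x]
  have seg: "x (?n, ?n + q) = x (?m, ?m + q)" for q
  proof -
    \<comment> \<open>This \<open>M\<close> lies beyond the ends of both segments,
      \<open>?n + q\<close> and \<open>?m + q\<close>.\<close>
    obtain M u w where M: "?n + ?m + q \<le> M" and u: "u \<in> mor \<Lambda>" "rng \<Lambda> u = x (M, M)"
      and w: "w \<in> mor \<Lambda>" "rng \<Lambda> w = x (M, M)"
      and eq: "(y \<diamondop> x (0, M)) \<diamondop> u = (z \<diamondop> x (0, M)) \<diamondop> w"
      using ext[of "?n + ?m + q"] by metis
    have le: "?n \<le> ?n + q" "?n + q \<le> M" "?m \<le> ?m + q" "?m + q \<le> M"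
      using M by (simp_all add: nat_vec_le_add) (auto simp: less_eq_vec_def intro: order_trans[rotated])
    note A = cmp_inf_path_decomp[OF x y le(1,2) u] and B = cmp_inf_path_decomp[OF x z le(3,4) w]
    \<comment> \<open>The initial pieces \<open>y \<diamondop> x (0, ?n)\<close> and
      \<open>z \<diamondop> x (0, ?m)\<close> both have degree \<open>?m + ?n\<close>, so the
      remainders agree; then so do the initial pieces of degree \<open>q\<close> of these
      remainders.\<close>
    have eq2: "x (?n, ?n + q) \<diamondop> (x (?n + q, M) \<diamondop> u) = x (?m, ?m + q) \<diamondop> (x (?m + q, M) \<diamondop> w)"
      by (rule factor_unique(2)[OF A(2,7) _ B(2,7)])
        (use A B eq in \<open>simp_all add: add.commute\<close>)
    show ?thesis
      by (rule factor_unique(1)[OF D(1)[OF le(1)] A(5) _ D(1)[OF le(3)] B(5) _ eq2])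
        (simp_all add: D(4,5) le A(6) B(6))
  qed
  have "shift ?n x = shift ?m x"
    unfolding shift_def
  proof (rule restrict_ext)
    fix pq :: "(nat ^ 'k) \<times> (nat ^ 'k)" assume "pq \<in> mor Omega"
    then obtain p q where pq: "pq = (p, q)" "p \<le> q" by (auto simp: Omega_def)
    have le: "a \<le> a + p" "a + p \<le> a + q" for a :: "nat ^ 'k"
      using pq(2) by (simp_all add: nat_vec_le_add nat_vec_add_le_cancel)
    \<comment> \<open>Equality of the segments of length \<open>q\<close> at \<open>?n\<close> and
      \<open>?m\<close> passes to the part after \<open>p\<close> by cancelling their initial pieces
      of degree \<open>p\<close>.\<close>
    have "x (?n + p, ?n + q) = x (?m + p, ?m + q)"
    proof (rule factor_unique(2)[OF D(1)[OF le(1)] D(1)[OF le(2)] _ D(1)[OF le(1)] D(1)[OF le(2)]])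
      show "x (?n, ?n + p) \<diamondop> x (?n + p, ?n + q) = x (?m, ?m + p) \<diamondop> x (?m + p, ?m + q)"
        by (rule trans[OF D(6)[OF le] trans[OF seg D(6)[OF le, symmetric]]])
    qed (simp_all add: D(3-5) le)
    then show "(case pq of (m, n) \<Rightarrow> x (m + ?n, n + ?n)) = (case pq of (m, n) \<Rightarrow> x (m + ?m, n + ?m))"
      by (simp add: pq(1) add.commute)
  qed
  with aper[of ?n ?m] deg show False by simp
qed

lemma coefficients_in_ideal:
  fixes J :: "('m, 'r::{comm_ring, comm_monoid_mult}) kp_free set"
  assumes SA: "strongly_aperiodic \<Lambda>" and J: "lifted_ideal \<Lambda> J"
    and L: "finite L" "\<And>y. y \<in> L \<Longrightarrow> y \<in> mor \<Lambda> \<and> src \<Lambda> y = w"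
    and sum: "(\<Sum>y\<in>L. c y \<cdot> S y) \<in> J" and l: "l \<in> L"
  shows "c l \<cdot> free_p w \<in> J"
proof (rule ccontr)
  assume not: "c l \<cdot> free_p w \<notin> J"
  let ?H = "{v \<in> obj \<Lambda>. c l \<cdot> free_p v \<in> J}"
  have lm: "l \<in> mor \<Lambda>" "src \<Lambda> l = w" using L(2)[OF l] by auto
  then have w: "w \<in> obj \<Lambda> - ?H" using not src_obj[OF lm(1)] by simp
  \<comment> \<open>The vertex \<open>w\<close> lies outside \<open>?H\<close>, so \<open>?H\<close>
    is proper and its complement is among the graphs assumed aperiodic.\<close>
  have "aperiodic (remove_her \<Lambda> ?H)"
    by (rule SA[unfolded strongly_aperiodic_def, rule_format, OF coefficient_sat_her[OF J]])
      (use w in auto)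
  moreover have "w \<in> obj (remove_her \<Lambda> ?H)" using w by (simp add: remove_her_def)
  ultimately obtain x where x: "x \<in> inf_paths (remove_her \<Lambda> ?H)" "x (0, 0) = w"
    and aper: "\<And>m n. m \<noteq> n \<Longrightarrow> shift m x \<noteq> shift n x"
    unfolding aperiodic_def by meson
  note D = inf_pathD[OF x(1)]
  note 0 = nat_vec_zero_le
  have "\<exists>N. \<forall>M\<ge>N. y \<in> L \<longrightarrow> deg \<Lambda> l \<noteq> deg \<Lambda> y \<longrightarrow>
     \<not> (\<exists>u\<in>mor \<Lambda>. \<exists>v\<in>mor \<Lambda>. x (M, M) = rng \<Lambda> u \<and> x (M, M) = rng \<Lambda> v
    \<and> (l \<diamondop> x (0, M)) \<diamondop> u = (y \<diamondop> x (0, M)) \<diamondop> v)" for y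
  proof (cases "y \<in> L \<and> deg \<Lambda> l \<noteq> deg \<Lambda> y")
    case True
    then show ?thesis
      using aperiodic_no_common_extension[OF x(1) aper lm(1) _ _ _, of y] L(2)[of y] lm(2) x(2) by simp
  qed auto
  then obtain N where N: "\<And>y M. \<lbrakk>N y \<le> M; y \<in> L; deg \<Lambda> l \<noteq> deg \<Lambda> y\<rbrakk> \<Longrightarrow>
     \<not> (\<exists>u\<in>mor \<Lambda>. \<exists>v\<in>mor \<Lambda>. x (M, M) = rng \<Lambda> u \<and> x (M, M) = rng \<Lambda> v
    \<and> (l \<diamondop> x (0, M)) \<diamondop> u = (y \<diamondop> x (0, M)) \<diamondop> v)" by metis
  \<comment> \<open>A sum of degrees is an upper bound for each of them in the product order, so
    this \<open>M\<close> works for all paths in \<open>L\<close> at once.\<close>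
  define M where "M = sum N L"
  let ?a = "x (0, M)"
  have a: "?a \<in> mor \<Lambda>" "rng \<Lambda> ?a = w" "src \<Lambda> ?a = x (M, M)" "src \<Lambda> ?a \<notin> ?H"
    using D(1-4)[OF 0, of M] x(2) by auto
  have comp: "src \<Lambda> y = rng \<Lambda> ?a" if "y \<in> L" for y using L(2)[OF that] a(2) by simp
  have ya: "y \<diamondop> ?a \<in> mor \<Lambda>" "src \<Lambda> (y \<diamondop> ?a) = x (M, M)" "deg \<Lambda> (y \<diamondop> ?a) = deg \<Lambda> y + deg \<Lambda> ?a"
    if "y \<in> L" for y
    using cmp_mor[of y ?a] src_cmp[of y ?a] deg_cmp[of y ?a] L(2)[OF that] a comp[OF that] by simp_all
  have summand: "T (l \<diamondop> ?a) * S (y \<diamondop> ?a) \<doteq> (if y = l then free_p (x (M, M)) else (0 :: ('m, 'r) kp_free))"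
    if y: "y \<in> L" for y
  proof -
    \<comment> \<open>A distinct path of the same degree remains distinct from \<open>l\<close>
      after extension by \<open>?a\<close> and is orthogonal by the relations; only a path of
      another degree needs aperiodicity.\<close>
    consider "y = l" | "y \<noteq> l" "deg \<Lambda> y = deg \<Lambda> l" | "deg \<Lambda> l \<noteq> deg \<Lambda> y" by metis
    then show ?thesis
    proof cases
      case 1
      then show ?thesis using T_S_same[OF ya(1)[OF l]] ya(2)[OF l] by simp
    next
      case 2
      then have "l \<diamondop> ?a \<noteq> y \<diamondop> ?a"
        using factor_unique(1)[of l ?a y ?a] L(2)[OF y] lm a(1) comp[OF y] comp[OF l] by auto
      then show ?thesis using 2 by (simp add: T_S_diff ya l y)
    next
      case 3
      have "N y \<le> M" unfolding M_def by (rule nat_vec_le_sum[OF L(1) y])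
      then have "T (l \<diamondop> ?a) * S (y \<diamondop> ?a) \<doteq> (0 :: ('m, 'r) kp_free)"
        using N[OF _ y 3] ya(2)[OF l] ya(2)[OF y]
        by (intro T_S_no_common_extension ya l y) (metis (no_types, lifting))
      then show ?thesis using 3 by auto
    qed
  qed
  have "T (l \<diamondop> ?a) * (\<Sum>y\<in>L. c y \<cdot> S y) * S ?a \<in> J"
    using sum ya(1)[OF l] a(1) by (intro lifted_idealD(4,5)[OF J]) simp_all
  moreover have "T (l \<diamondop> ?a) * (\<Sum>y\<in>L. c y \<cdot> S y) * S ?a \<doteq> c l \<cdot> free_p (x (M, M))"
  proof -
    have "T (l \<diamondop> ?a) * (\<Sum>y\<in>L. c y \<cdot> S y) * S ?a = (\<Sum>y\<in>L. c y \<cdot> (T (l \<diamondop> ?a) * (S y * S ?a)))"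
      by (simp add: sum_distrib_left sum_distrib_right smult_mult_right smult_mult_left mult.assoc)
    also have "\<dots> \<doteq> (\<Sum>y\<in>L. c y \<cdot> (T (l \<diamondop> ?a) * S (y \<diamondop> ?a)))"
      using L(2) a(1) comp
      by (intro kp_equiv_sum kp_equiv_smult cong_mult_left S_mult T_free ya(1)[OF l]) auto
    also have "\<dots> \<doteq> (\<Sum>y\<in>L. c y \<cdot> (if y = l then free_p (x (M, M)) else 0))"
      by (intro kp_equiv_sum kp_equiv_smult summand)
    also have "\<dots> = (\<Sum>y\<in>L. if y = l then c y \<cdot> free_p (x (M, M)) else 0)"
      by (intro sum.cong) auto
    also have "\<dots> = c l \<cdot> free_p (x (M, M))" using L(1) l by simp
    finally show ?thesis .
  qed
  ultimately have "c l \<cdot> free_p (x (M, M)) \<in> J" by (rule lifted_ideal_equiv[OF J])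
  \<comment> \<open>The path \<open>x\<close> avoids \<open>?H\<close>, so its vertex
    \<open>x (M, M)\<close> cannot carry the coefficient \<open>c l\<close> into
    \<open>J\<close>.\<close>
  then show False using a(3,4) src_obj[OF a(1)] by simp
qed

text \<open>\<open>K\<close> stands for the representatives of the span in (1), kept abstract so
  that the argument stays in the free algebra. Each \<open>f * S y\<close> with \<open>y\<close> of
  degree \<open>n\<close> is in \<open>J\<close> and is a combination of paths with the source of
  \<open>y\<close>; by \<open>coefficients_in_ideal\<close> multiplying it by \<open>T y\<close>
  gives terms covered by \<open>K_gen\<close>.\<close>

lemma lifted_ideal_expansion:
  fixes J K :: "('m, 'r::{comm_ring, comm_monoid_mult}) kp_free set"
  assumes SA: "strongly_aperiodic \<Lambda>" and J: "lifted_ideal \<Lambda> J" and f: "f \<in> J"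
    and K0: "0 \<in> K" and K_add: "\<And>f g. f \<in> K \<Longrightarrow> g \<in> K \<Longrightarrow> f + g \<in> K"
    and K_equiv: "\<And>f g. f \<in> K \<Longrightarrow> f \<doteq> g \<Longrightarrow> g \<in> K"
    and K_gen: "\<And>r x y. \<lbrakk>x \<in> mor \<Lambda>; y \<in> mor \<Lambda>; r \<cdot> free_p (src \<Lambda> y) \<in> J\<rbrakk> \<Longrightarrow> r \<cdot> (S x * T y) \<in> K"
  shows "f \<in> K"
proof -
  have K_sum: "sum h A \<in> K" if "\<And>i. i \<in> A \<Longrightarrow> h i \<in> K" for h and A :: "'m set"
    using that by (induction A rule: infinite_finite_induct) (simp_all add: K0 K_add)
  have ff: "f \<in> kp_free \<Lambda>" by (rule lifted_idealD(1)[OF J f])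
  obtain V where V: "finite V" "V \<subseteq> obj \<Lambda>" "f * (\<Sum>v\<in>V. free_p v) \<doteq> f"
    using right_unit[OF ff] by blast
  obtain n where n: "\<And>y. y \<in> mor \<Lambda> \<Longrightarrow> n \<le> deg \<Lambda> y \<Longrightarrow> f * S y \<in> path_span (src \<Lambda> y) 0"
    using mult_long_path_in_path_span[OF ff] by blast
  have summand: "f * S y * T y \<in> K" if y: "y \<in> mor \<Lambda>" "deg \<Lambda> y = n" for y
  proof -
    obtain L c where L: "finite L" "\<And>x. x \<in> L \<Longrightarrow> x \<in> mor \<Lambda> \<and> src \<Lambda> x = src \<Lambda> y"
      "f * S y \<doteq> (\<Sum>x\<in>L. c x \<cdot> S x)"
      using n[OF y(1)] y(2) unfolding path_span_def by auto
    have "(\<Sum>x\<in>L. c x \<cdot> S x) \<in> J"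
      by (rule lifted_ideal_equiv[OF J lifted_idealD(5)[OF J S_free[OF y(1)] f] L(3)])
    then have c: "c x \<cdot> free_p (src \<Lambda> y) \<in> J" if "x \<in> L" for x
      using coefficients_in_ideal[OF SA J L(1), of "src \<Lambda> y" c x] L(2) that by simp
    have "(\<Sum>x\<in>L. c x \<cdot> (S x * T y)) \<in> K"
      using L(2) c by (intro K_sum K_gen y) auto
    moreover have "f * S y * T y \<doteq> (\<Sum>x\<in>L. c x \<cdot> S x) * T y"
      by (rule cong_mult_right[OF T_free[OF y(1)] L(3)])
    then have "f * S y * T y \<doteq> (\<Sum>x\<in>L. c x \<cdot> (S x * T y))"
      by (simp add: sum_distrib_right smult_mult_left)
    ultimately show ?thesis using K_equiv kp_equiv_sym by blast
  qed
  \<comment> \<open>A local unit is inserted on the right and each of its vertices is expanded at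
    degree \<open>n\<close>.\<close>
  have "f \<doteq> (\<Sum>v\<in>V. f * free_p v)"
    using kp_equiv_sym[OF V(3)] by (simp add: sum_distrib_left)
  also have "\<dots> \<doteq> (\<Sum>v\<in>V. f * (\<Sum>y\<in>paths_from \<Lambda> v n. S y * T y))"
    using V(2) by (intro kp_equiv_sum cong_mult_left[OF ff] p_sum) blast
  also have "\<dots> = (\<Sum>v\<in>V. \<Sum>y\<in>paths_from \<Lambda> v n. f * S y * T y)"
    by (simp add: sum_distrib_left mult.assoc)
  finally have "f \<doteq> (\<Sum>v\<in>V. \<Sum>y\<in>paths_from \<Lambda> v n. f * S y * T y)" .
  moreover have "(\<Sum>v\<in>V. \<Sum>y\<in>paths_from \<Lambda> v n. f * S y * T y) \<in> K"
    by (intro K_sum summand) (auto simp: paths_from_def)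
  ultimately show ?thesis using K_equiv kp_equiv_sym by blast
qed

end

section \<open>Action on functions of finite paths\<close>

lemma ring_idealsD:
  assumes "J \<in> ring_ideals"
  shows "0 \<in> J" "a \<in> J \<Longrightarrow> b \<in> J \<Longrightarrow> a + b \<in> J" "a \<in> J \<Longrightarrow> r * a \<in> J"
  using assms unfolding ring_ideals_def by blast+

lemma zero_ring_ideal: "{0} \<in> ring_ideals"
  by (simp add: ring_ideals_def)

context kp_graph
begin

text \<open>Operators on functions of finite paths: \<open>Path x\<close> transports values along
  prepending \<open>x\<close>, and \<open>Ghost x\<close> pulls them back. A finite path may be too
  short to start with a path of degree \<open>n\<close>, so the vertex sum relation holds only at
  long paths.\<close>

fun gen_act :: "'m kp_gen \<Rightarrow> ('m \<Rightarrow> 'r::{comm_ring, comm_monoid_mult}) \<Rightarrow> 'm \<Rightarrow> 'r" where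
  "gen_act (Vert v) \<phi> k = (if k \<in> mor \<Lambda> \<and> rng \<Lambda> k = v then \<phi> k else 0)"
| "gen_act (Path x) \<phi> k = (if \<exists>y. y \<in> mor \<Lambda> \<and> src \<Lambda> x = rng \<Lambda> y \<and> k = x \<diamondop> y
     then \<phi> (THE y. y \<in> mor \<Lambda> \<and> src \<Lambda> x = rng \<Lambda> y \<and> k = x \<diamondop> y) else 0)"
| "gen_act (Ghost x) \<phi> k = (if k \<in> mor \<Lambda> \<and> rng \<Lambda> k = src \<Lambda> x then \<phi> (x \<diamondop> k) else 0)"

declare gen_act.simps(2) [simp del]

lemma gen_act_Path_comp:
  assumes "x \<in> mor \<Lambda>" "y \<in> mor \<Lambda>" "src \<Lambda> x = rng \<Lambda> y"
  shows "gen_act (Path x) \<phi> (x \<diamondop> y) = \<phi> y"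
proof -
  have "(THE z. z \<in> mor \<Lambda> \<and> src \<Lambda> x = rng \<Lambda> z \<and> x \<diamondop> y = x \<diamondop> z) = y"
  proof (rule the_equality)
    fix z assume z: "z \<in> mor \<Lambda> \<and> src \<Lambda> x = rng \<Lambda> z \<and> x \<diamondop> y = x \<diamondop> z"
    show "z = y"
      by (rule factor_unique(2)[OF assms(1) _ _ assms _ refl])
        (use z in simp_all)
  qed (intro conjI assms refl)
  moreover have "\<exists>z. z \<in> mor \<Lambda> \<and> src \<Lambda> x = rng \<Lambda> z \<and> x \<diamondop> y = x \<diamondop> z" using assms(2,3) by blast
  ultimately show ?thesis by (simp only: gen_act.simps(2) if_True)
qed

lemma gen_act_Path_other:
  "\<not> (\<exists>y. y \<in> mor \<Lambda> \<and> src \<Lambda> x = rng \<Lambda> y \<and> k = x \<diamondop> y) \<Longrightarrow> gen_act (Path x) \<phi> k = 0"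
  by (simp only: gen_act.simps if_False)

text \<open>At degree zero \<open>free_s\<close> is a vertex generator; by this agreement
  \<open>S x\<close> acts as \<open>Path x\<close> for every path \<open>x\<close>.\<close>

lemma gen_act_Path_obj:
  assumes v: "v \<in> obj \<Lambda>"
  shows "gen_act (Path v) \<phi> = gen_act (Vert v) \<phi>"
proof
  fix k
  show "gen_act (Path v) \<phi> k = gen_act (Vert v) \<phi> k"
  proof (cases "k \<in> mor \<Lambda> \<and> rng \<Lambda> k = v")
    case True
    then have "v \<diamondop> k = k" using cmp_id_left[of k] by simp
    then show ?thesis
      using gen_act_Path_comp[of v k \<phi>] True obj_mor[OF v] src_id[OF v] by simp
  next
    case False
    have "\<not> (\<exists>y. y \<in> mor \<Lambda> \<and> src \<Lambda> v = rng \<Lambda> y \<and> k = v \<diamondop> y)"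
    proof
      assume "\<exists>y. y \<in> mor \<Lambda> \<and> src \<Lambda> v = rng \<Lambda> y \<and> k = v \<diamondop> y"
      then obtain y where "y \<in> mor \<Lambda>" "v = rng \<Lambda> y" "k = v \<diamondop> y"
        unfolding src_id[OF v] by blast
      then show False using False cmp_id_left[of y] by simp
    qed
    then show ?thesis using False by (simp only: gen_act.simps if_False)
  qed
qed

lemma gen_act_Ghost_obj:
  assumes v: "v \<in> obj \<Lambda>"
  shows "gen_act (Ghost v) \<phi> = gen_act (Vert v) \<phi>"
proof
  fix k show "gen_act (Ghost v) \<phi> k = gen_act (Vert v) \<phi> k"
  proof (cases "k \<in> mor \<Lambda> \<and> rng \<Lambda> k = v")
    case True
    then have "v \<diamondop> k = k" using cmp_id_left[of k] by simp
    then show ?thesis by (simp only: gen_act.simps src_id[OF v])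
  next
    case False
    then show ?thesis by (simp only: gen_act.simps src_id[OF v] if_False)
  qed
qed

lemma gen_act_add: "gen_act g (\<lambda>k. \<phi> k + \<psi> k) = (\<lambda>k. gen_act g \<phi> k + gen_act g \<psi> k)"
proof
  fix k show "gen_act g (\<lambda>k. \<phi> k + \<psi> k) k = gen_act g \<phi> k + gen_act g \<psi> k"
  proof (cases g)
    case (Path x)
    show ?thesis
      unfolding Path gen_act.simps(2)
      by (cases "\<exists>y. y \<in> mor \<Lambda> \<and> src \<Lambda> x = rng \<Lambda> y \<and> k = x \<diamondop> y") (simp_all only: if_True if_False add_0)
  qed simp_all
qed

lemma gen_act_scale: "gen_act g (\<lambda>k. r * \<phi> k) = (\<lambda>k. r * gen_act g \<phi> k)"
proof
  fix k show "gen_act g (\<lambda>k. r * \<phi> k) k = r * gen_act g \<phi> k"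
  proof (cases g)
    case (Path x)
    show ?thesis
      unfolding Path gen_act.simps(2)
      by (cases "\<exists>y. y \<in> mor \<Lambda> \<and> src \<Lambda> x = rng \<Lambda> y \<and> k = x \<diamondop> y") (simp_all only: if_True if_False mult_zero_right)
  qed simp_all
qed

section \<open>Extension of the action to words and to the free algebra\<close>

definition word_act ::
  "'m kp_gen word \<Rightarrow> ('m \<Rightarrow> 'r::{comm_ring, comm_monoid_mult}) \<Rightarrow> 'm \<Rightarrow> 'r" where
  "word_act w = foldr gen_act (letters w)"

lemma word_act_plus: "word_act (u + w) \<phi> = word_act u (word_act w \<phi>)"
  by (simp add: word_act_def plus_word_def)

lemma word_act_zero: "word_act 0 \<phi> = \<phi>"
  by (simp add: word_act_def zero_word_def)

lemma word_act_add: "word_act w (\<lambda>k. \<phi> k + \<psi> k) = (\<lambda>k. word_act w \<phi> k + word_act w \<psi> k)"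
proof -
  have "foldr gen_act l (\<lambda>k. \<phi> k + \<psi> k) = (\<lambda>k. foldr gen_act l \<phi> k + foldr gen_act l \<psi> k)" for l
    by (induction l) (simp_all add: gen_act_add)
  then show ?thesis by (simp add: word_act_def)
qed

lemma word_act_scale: "word_act w (\<lambda>k. r * \<phi> k) = (\<lambda>k. r * word_act w \<phi> k)"
proof -
  have "foldr gen_act l (\<lambda>k. r * \<phi> k) = (\<lambda>k. r * foldr gen_act l \<phi> k)" for l
    by (induction l) (simp_all add: gen_act_scale)
  then show ?thesis by (simp add: word_act_def)
qed

definition act ::
  "('m, 'r::{comm_ring, comm_monoid_mult}) kp_free \<Rightarrow> ('m \<Rightarrow> 'r) \<Rightarrow> 'm \<Rightarrow> 'r" where
  "act f \<phi> k = (\<Sum>w\<in>Poly_Mapping.keys f. Poly_Mapping.lookup f w * word_act w \<phi> k)"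

lemma act_superset:
  assumes "finite W" "Poly_Mapping.keys f \<subseteq> W"
  shows "act f \<phi> k = (\<Sum>w\<in>W. Poly_Mapping.lookup f w * word_act w \<phi> k)"
  unfolding act_def using assms
  by (intro sum.mono_neutral_left) (auto simp: in_keys_iff)

lemma act_zero: "act 0 \<phi> k = 0"
  by (simp add: act_def)

lemma act_add: "act (f + g) \<phi> k = act f \<phi> k + act g \<phi> k"
proof -
  let ?W = "Poly_Mapping.keys f \<union> Poly_Mapping.keys g"
  have "act (f + g) \<phi> k = (\<Sum>w\<in>?W. Poly_Mapping.lookup (f + g) w * word_act w \<phi> k)"
    by (rule act_superset) (simp_all add: keys_add)
  also have "\<dots> = (\<Sum>w\<in>?W. Poly_Mapping.lookup f w * word_act w \<phi> k)
      + (\<Sum>w\<in>?W. Poly_Mapping.lookup g w * word_act w \<phi> k)"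
    by (simp add: lookup_add distrib_right sum.distrib)
  also have "\<dots> = act f \<phi> k + act g \<phi> k"
    by (intro arg_cong2[of _ _ _ _ "(+)"] act_superset[symmetric]) simp_all
  finally show ?thesis .
qed

lemma act_sum: "act (\<Sum>i\<in>A. h i) \<phi> k = (\<Sum>i\<in>A. act (h i) \<phi> k)"
  by (induction A rule: infinite_finite_induct) (simp_all add: act_zero act_add)

lemma act_diff: "act (f - g) \<phi> k = act f \<phi> k - act g \<phi> k"
  using act_add[of "f - g" g \<phi> k] by simp

lemma act_single: "act (Poly_Mapping.single w r) \<phi> k = r * word_act w \<phi> k"
  using act_superset[of "{w}" "Poly_Mapping.single w r" \<phi> k] by simp

lemma act_fun_add: "act f (\<lambda>k. \<phi> k + \<psi> k) k = act f \<phi> k + act f \<psi> k"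
  by (simp add: act_def word_act_add distrib_left sum.distrib)

lemma act_fun_zero: "act f (\<lambda>_. 0) k = 0"
  using act_fun_add[of f "\<lambda>_. 0" "\<lambda>_. 0" k] by simp

lemma act_fun_sum: "act f (\<lambda>k. \<Sum>i\<in>A. \<phi> i k) k = (\<Sum>i\<in>A. act f (\<phi> i) k)"
proof (induction A rule: infinite_finite_induct)
  case (insert i A)
  then show ?case using act_fun_add[of f "\<phi> i" "\<lambda>k. \<Sum>i\<in>A. \<phi> i k" k] by simp
qed (simp_all add: act_fun_zero)

text \<open>Both sides are additive in \<open>f\<close> and in \<open>g\<close>, so monomials
  suffice; there concatenation of words becomes composition of operators.\<close>

lemma act_mult: "act (f * g) \<phi> k = act f (act g \<phi>) k"
proof -
  let ?s = "\<lambda>f w. Poly_Mapping.single w (Poly_Mapping.lookup f w)"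
  have single: "act (?s f u * ?s g w) \<phi> k = act (?s f u) (act (?s g w) \<phi>) k" for u w
  proof -
    have "act (?s g w) \<phi> = (\<lambda>k. Poly_Mapping.lookup g w * word_act w \<phi> k)"
      by (simp add: fun_eq_iff act_single)
    then show ?thesis
      by (simp add: mult_single act_single word_act_plus word_act_scale mult.assoc)
  qed
  have g: "act (\<Sum>w\<in>B. ?s g w) \<phi> = (\<lambda>k. \<Sum>w\<in>B. act (?s g w) \<phi> k)" for B
    by (simp add: fun_eq_iff act_sum)
  have "act ((\<Sum>u\<in>A. ?s f u) * (\<Sum>w\<in>B. ?s g w)) \<phi> k
      = act (\<Sum>u\<in>A. ?s f u) (act (\<Sum>w\<in>B. ?s g w) \<phi>) k" for A B
    unfolding g sum_product act_sum act_fun_sum single by (rule sum.swap)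
  from this[of "Poly_Mapping.keys f" "Poly_Mapping.keys g"] show ?thesis
    by (simp only: poly_mapping_sum_single[symmetric])
qed

lemma act_smult: "act (r \<cdot> f) \<phi> k = r * act f \<phi> k"
  by (simp add: free_smult_def act_mult act_single word_act_zero)

lemma act_free_gen: "act (free_gen g) \<phi> = gen_act g \<phi>"
  by (simp add: fun_eq_iff free_gen_def act_single word_act_def)

lemma act_p: "act (free_p v) \<phi> = gen_act (Vert v) \<phi>"
  by (simp add: free_p_def act_free_gen)

lemma act_S: "x \<in> mor \<Lambda> \<Longrightarrow> act (S x) \<phi> = gen_act (Path x) \<phi>"
  by (simp add: free_s_def act_p act_free_gen gen_act_Path_obj[OF deg_zero_obj])

lemma act_T: "x \<in> mor \<Lambda> \<Longrightarrow> act (T x) \<phi> = gen_act (Ghost x) \<phi>"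
  by (simp add: free_t_def act_p act_free_gen gen_act_Ghost_obj[OF deg_zero_obj])

text \<open>The bound \<open>N\<close> is a vector, so only paths that are long in every direction
  are tested. With the zero ideal at every vertex these are the functions that vanish at all long
  paths.\<close>

definition eventually_in ::
  "('m \<Rightarrow> 'r::{comm_ring, comm_monoid_mult} set) \<Rightarrow> ('m \<Rightarrow> 'r) \<Rightarrow> bool" where
  "eventually_in \<J> \<phi> \<longleftrightarrow> (\<exists>N. \<forall>k\<in>mor \<Lambda>. N \<le> deg \<Lambda> k \<longrightarrow> \<phi> k \<in> \<J> (src \<Lambda> k))"

lemma eventually_inI:
  "(\<And>k. k \<in> mor \<Lambda> \<Longrightarrow> N \<le> deg \<Lambda> k \<Longrightarrow> \<phi> k \<in> \<J> (src \<Lambda> k)) \<Longrightarrow> eventually_in \<J> \<phi>"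
  unfolding eventually_in_def by blast

lemma eventually_in_mono:
  "eventually_in \<J> \<phi> \<Longrightarrow> (\<And>v. v \<in> obj \<Lambda> \<Longrightarrow> \<J> v \<subseteq> \<K> v) \<Longrightarrow> eventually_in \<K> \<phi>"
  unfolding eventually_in_def using src_obj by (meson subsetD)

context
  fixes \<J> :: "'m \<Rightarrow> 'r::{comm_ring, comm_monoid_mult} set"
  assumes \<J>: "\<And>v. v \<in> obj \<Lambda> \<Longrightarrow> \<J> v \<in> ring_ideals"
begin

lemma eventually_in_zero: "eventually_in \<J> (\<lambda>_. 0)"
  using ring_idealsD(1)[OF \<J>] src_obj by (intro eventually_inI) simp

lemma eventually_in_add:
  assumes "eventually_in \<J> \<phi>" "eventually_in \<J> \<psi>"
  shows "eventually_in \<J> (\<lambda>k. \<phi> k + \<psi> k)"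
proof -
  obtain N M where N: "\<And>k. k \<in> mor \<Lambda> \<Longrightarrow> N \<le> deg \<Lambda> k \<Longrightarrow> \<phi> k \<in> \<J> (src \<Lambda> k)"
    and M: "\<And>k. k \<in> mor \<Lambda> \<Longrightarrow> M \<le> deg \<Lambda> k \<Longrightarrow> \<psi> k \<in> \<J> (src \<Lambda> k)"
    using assms unfolding eventually_in_def by blast
  show ?thesis
  proof (rule eventually_inI)
    fix k assume k: "k \<in> mor \<Lambda>" "N + M \<le> deg \<Lambda> k"
    then have "N \<le> deg \<Lambda> k" "M \<le> deg \<Lambda> k" using nat_vec_le_add order_trans by blast+
    then show "\<phi> k + \<psi> k \<in> \<J> (src \<Lambda> k)"
      using N M k(1) ring_idealsD(2)[OF \<J>[OF src_obj]] by blast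
  qed
qed

lemma eventually_in_scale:
  assumes "eventually_in \<J> \<phi>"
  shows "eventually_in \<J> (\<lambda>k. r * \<phi> k)"
proof -
  obtain N where N: "\<And>k. k \<in> mor \<Lambda> \<Longrightarrow> N \<le> deg \<Lambda> k \<Longrightarrow> \<phi> k \<in> \<J> (src \<Lambda> k)"
    using assms unfolding eventually_in_def by blast
  show ?thesis
    by (rule eventually_inI[of N]) (rule ring_idealsD(3)[OF \<J>[OF src_obj] N])
qed

text \<open>Generators alter a path only at its range end, so the source, and with it the ideal in
  which the value is tested, stays the same. For \<open>S x\<close> the bound grows by the degree of
  \<open>x\<close>; for \<open>T x\<close> the old bound remains valid.\<close>

lemma eventually_in_act:
  assumes "f \<in> kp_free \<Lambda>" "eventually_in \<J> \<phi>"
  shows "eventually_in \<J> (act f \<phi>)"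
  using assms
proof (induction arbitrary: \<phi> rule: kp_free_path_induct)
  case zero
  have "act 0 \<phi> = (\<lambda>_. 0)" by (simp add: fun_eq_iff act_zero)
  then show ?case using eventually_in_zero by simp
next
  case (add f g)
  have "act (f + g) \<phi> = (\<lambda>k. act f \<phi> k + act g \<phi> k)" by (simp add: fun_eq_iff act_add)
  then show ?case using eventually_in_add add.IH add.prems by simp
next
  case (smult r f)
  have "act (r \<cdot> f) \<phi> = (\<lambda>k. r * act f \<phi> k)" by (simp add: fun_eq_iff act_smult)
  then show ?case using eventually_in_scale smult.IH smult.prems by simp
next
  case (path x)
  then obtain N where N: "\<And>k. k \<in> mor \<Lambda> \<Longrightarrow> N \<le> deg \<Lambda> k \<Longrightarrow> \<phi> k \<in> \<J> (src \<Lambda> k)"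
    unfolding eventually_in_def by blast
  show ?case
    unfolding act_S[OF path(1)]
  proof (rule eventually_inI)
    fix k assume k: "k \<in> mor \<Lambda>" "deg \<Lambda> x + N \<le> deg \<Lambda> k"
    show "gen_act (Path x) \<phi> k \<in> \<J> (src \<Lambda> k)"
    proof (cases "\<exists>y. y \<in> mor \<Lambda> \<and> src \<Lambda> x = rng \<Lambda> y \<and> k = x \<diamondop> y")
      case True
      then obtain y where y: "y \<in> mor \<Lambda>" "src \<Lambda> x = rng \<Lambda> y" "k = x \<diamondop> y" by blast
      have "N \<le> deg \<Lambda> y" using k(2) by (simp add: y(3) deg_cmp[OF path(1) y(1,2)] nat_vec_add_le_cancel)
      then show ?thesis
        using N[OF y(1)] by (simp add: y(3) gen_act_Path_comp[OF path(1) y(1,2)] src_cmp[OF path(1) y(1,2)])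
    next
      case False
      show ?thesis
        unfolding gen_act_Path_other[OF False] by (rule ring_idealsD(1)[OF \<J>[OF src_obj[OF k(1)]]])
    qed
  qed
next
  case (ghost x)
  then obtain N where N: "\<And>k. k \<in> mor \<Lambda> \<Longrightarrow> N \<le> deg \<Lambda> k \<Longrightarrow> \<phi> k \<in> \<J> (src \<Lambda> k)"
    unfolding eventually_in_def by blast
  show ?case
    unfolding act_T[OF ghost(1)]
  proof (rule eventually_inI)
    fix k assume k: "k \<in> mor \<Lambda>" "N \<le> deg \<Lambda> k"
    show "gen_act (Ghost x) \<phi> k \<in> \<J> (src \<Lambda> k)"
    proof (cases "rng \<Lambda> k = src \<Lambda> x")
      case True
      have "N \<le> deg \<Lambda> (x \<diamondop> k)"
        unfolding deg_cmp[OF ghost(1) k(1) True[symmetric]] using k(2) nat_vec_le_add(2) order_trans by blast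
      then show ?thesis
        using N[OF cmp_mor[OF ghost(1) k(1) True[symmetric]]] k(1) True
          src_cmp[OF ghost(1) k(1) True[symmetric]] by simp
    next
      case False
      then show ?thesis using ring_idealsD(1)[OF \<J>[OF src_obj[OF k(1)]]] by simp
    qed
  qed
next
  case (mult f g)
  have "act (f * g) \<phi> = act f (act g \<phi>)" by (simp add: fun_eq_iff act_mult)
  then show ?case using mult.IH mult.prems by simp
qed

end

text \<open>All relations except the vertex sum hold at every path. The vertex sum at
  \<open>n\<close> holds at paths \<open>k\<close> of degree at least \<open>n\<close>: such a
  \<open>k\<close> has exactly one initial piece \<open>y\<close> of degree \<open>n\<close>, and
  only the summand of \<open>y\<close> can contribute.\<close>

lemma relator_act:
  fixes f :: "('m, 'r::{comm_ring, comm_monoid_mult}) kp_free"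
  assumes "f \<in> kp_relators \<Lambda>"
  shows "\<exists>N. \<forall>k\<in>mor \<Lambda>. N \<le> deg \<Lambda> k \<longrightarrow> act f \<phi> k = 0"
  using assms
proof cases
  case (idem v)
  then show ?thesis by (simp add: act_diff act_mult act_p)
next
  case (orth v w)
  then show ?thesis by (simp add: act_mult act_p)
next
  case (path_mult x y)
  note xy = path_mult(2-4) and m = cmp_mor[OF path_mult(2-4)]
  have "gen_act (Path x) (gen_act (Path y) \<phi>) k = gen_act (Path (x \<diamondop> y)) \<phi> k" for k
  proof (cases "\<exists>z. z \<in> mor \<Lambda> \<and> src \<Lambda> (x \<diamondop> y) = rng \<Lambda> z \<and> k = (x \<diamondop> y) \<diamondop> z")
    case True
    then obtain z where z: "z \<in> mor \<Lambda>" "src \<Lambda> (x \<diamondop> y) = rng \<Lambda> z" "k = (x \<diamondop> y) \<diamondop> z" by blast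
    have yz: "src \<Lambda> y = rng \<Lambda> z" using z(2) src_cmp[OF xy] by simp
    have "gen_act (Path (x \<diamondop> y)) \<phi> k = \<phi> z" unfolding z(3) by (rule gen_act_Path_comp[OF m z(1,2)])
    moreover have "gen_act (Path x) (gen_act (Path y) \<phi>) (x \<diamondop> (y \<diamondop> z)) = gen_act (Path y) \<phi> (y \<diamondop> z)"
      by (rule gen_act_Path_comp[OF xy(1) cmp_mor[OF xy(2) z(1) yz]])
        (simp add: rng_cmp[OF xy(2) z(1) yz] xy(3))
    moreover have "gen_act (Path y) \<phi> (y \<diamondop> z) = \<phi> z" by (rule gen_act_Path_comp[OF xy(2) z(1) yz])
    ultimately show ?thesis using cmp_assoc[OF xy(1,2) z(1) xy(3) yz] z(3) by simp
  next
    case False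
    have "gen_act (Path x) (gen_act (Path y) \<phi>) k = 0"
    proof (cases "\<exists>u. u \<in> mor \<Lambda> \<and> src \<Lambda> x = rng \<Lambda> u \<and> k = x \<diamondop> u")
      case True
      then obtain u where u: "u \<in> mor \<Lambda>" "src \<Lambda> x = rng \<Lambda> u" "k = x \<diamondop> u" by blast
      have "\<not> (\<exists>z. z \<in> mor \<Lambda> \<and> src \<Lambda> y = rng \<Lambda> z \<and> u = y \<diamondop> z)"
        using False u(3) src_cmp[OF xy] cmp_assoc[OF xy(1,2) _ xy(3)] by metis
      then show ?thesis
        unfolding u(3) gen_act_Path_comp[OF xy(1) u(1,2)] by (rule gen_act_Path_other)
    qed (rule gen_act_Path_other)
    then show ?thesis using gen_act_Path_other[OF False] by simp
  qed
  then show ?thesis using xy m by (simp add: path_mult(1) act_diff act_mult act_S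
      del: gen_act.simps)
next
  case (ghost_mult x y)
  note xy = ghost_mult(2-4) and m = cmp_mor[OF ghost_mult(2-4)]
  have "gen_act (Ghost y) (gen_act (Ghost x) \<phi>) k = gen_act (Ghost (x \<diamondop> y)) \<phi> k" for k
  proof (cases "k \<in> mor \<Lambda> \<and> rng \<Lambda> k = src \<Lambda> y")
    case True
    then have k: "k \<in> mor \<Lambda>" "src \<Lambda> y = rng \<Lambda> k" by auto
    show ?thesis
      using k cmp_mor[OF xy(2) k] rng_cmp[OF xy(2) k] xy(3) src_cmp[OF xy]
        cmp_assoc[OF xy(1,2) k(1) xy(3) k(2)] by simp
  next
    case False
    then show ?thesis using src_cmp[OF xy] by auto
  qed
  then show ?thesis using xy m by (simp add: ghost_mult(1) act_diff act_mult act_T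
      del: gen_act.simps)
next
  case (ghost_path x y)
  note xy = ghost_path(2-4)
  have eq: "gen_act (Ghost x) (gen_act (Path y) \<phi>) k = (if x = y then gen_act (Vert (src \<Lambda> x)) \<phi> k else 0)" for k
  proof (cases "k \<in> mor \<Lambda> \<and> rng \<Lambda> k = src \<Lambda> x")
    case True
    then have k: "k \<in> mor \<Lambda>" "src \<Lambda> x = rng \<Lambda> k" by auto
    have "gen_act (Ghost x) (gen_act (Path y) \<phi>) k = gen_act (Path y) \<phi> (x \<diamondop> k)"
      using True by (simp only: gen_act.simps if_True simp_thms)
    also have "\<dots> = (if x = y then \<phi> k else 0)"
    proof (cases "x = y")
      case True
      then show ?thesis using gen_act_Path_comp[OF xy(1) k] by simp
    next
      case False
      then have "\<not> (\<exists>z. z \<in> mor \<Lambda> \<and> src \<Lambda> y = rng \<Lambda> z \<and> x \<diamondop> k = y \<diamondop> z)"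
        using factor_unique(1)[OF xy(1) k xy(2)] xy(3) by metis
      from gen_act_Path_other[OF this] show ?thesis using False by simp
    qed
    finally show ?thesis using True by simp
  next
    case False
    then show ?thesis by auto
  qed
  show ?thesis
    using eq xy by (cases "x = y") (simp_all add: ghost_path(1) act_diff act_mult act_S act_T act_p act_zero
      del: gen_act.simps)
next
  case (vertex_sum v n)
  have eq: "gen_act (Vert v) \<phi> k = (\<Sum>x\<in>paths_from \<Lambda> v n. gen_act (Path x) (gen_act (Ghost x) \<phi>) k)"
    if k: "k \<in> mor \<Lambda>" "n \<le> deg \<Lambda> k" for k
  proof -
    obtain y z where y: "y \<in> mor \<Lambda>" "z \<in> mor \<Lambda>" "src \<Lambda> y = rng \<Lambda> z" "deg \<Lambda> y = n" "k = y \<diamondop> z"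
      using factorE[OF k] by metis
    have "gen_act (Path x) (gen_act (Ghost x) \<phi>) k = (if x = y then \<phi> k else 0)"
      if x: "x \<in> paths_from \<Lambda> v n" for x
    proof -
      have x: "x \<in> mor \<Lambda>" "deg \<Lambda> x = n" using x by (simp_all add: paths_from_def)
      show ?thesis
      proof (cases "x = y")
        case True
        then show ?thesis
          unfolding y(5) using gen_act_Path_comp[OF y(1-3), of "gen_act (Ghost y) \<phi>"] y(2,3) by simp
      next
        case False
        then have "\<not> (\<exists>w. w \<in> mor \<Lambda> \<and> src \<Lambda> x = rng \<Lambda> w \<and> k = x \<diamondop> w)"
          using factor_unique(1)[OF y(1-3) x(1)] y(4,5) x(2) by metis
        from gen_act_Path_other[OF this] show ?thesis using False by simp
      qed
    qed
    then have "(\<Sum>x\<in>paths_from \<Lambda> v n. gen_act (Path x) (gen_act (Ghost x) \<phi>) k)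
        = (\<Sum>x\<in>paths_from \<Lambda> v n. if x = y then \<phi> k else 0)"
      by (rule sum.cong[OF refl])
    \<comment> \<open>If \<open>k\<close> has a range other than \<open>v\<close>, then
      \<open>y\<close> is not an index of the sum and both sides vanish.\<close>
    also have "\<dots> = gen_act (Vert v) \<phi> k"
      using finite_paths[OF vertex_sum(2)] y rng_cmp[OF y(1-3)] k(1)
      by (simp add: sum.delta) (auto simp: paths_from_def)
    finally show ?thesis by simp
  qed
  have "act f \<phi> k = 0" if k: "k \<in> mor \<Lambda>" "n \<le> deg \<Lambda> k" for k
  proof -
    have "act (\<Sum>x\<in>paths_from \<Lambda> v n. S x * T x) \<phi> k
        = (\<Sum>x\<in>paths_from \<Lambda> v n. gen_act (Path x) (gen_act (Ghost x) \<phi>) k)"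
      unfolding act_sum by (intro sum.cong refl) (simp add: paths_from_def act_mult act_S act_T
      del: gen_act.simps)
    then show ?thesis using eq[OF k] by (simp add: vertex_sum(1) act_diff act_p
      del: gen_act.simps)
  qed
  then show ?thesis by blast
qed

text \<open>The function \<open>\<phi>\<close> varies in the induction, because right multiplication
  by \<open>a\<close> replaces it by \<open>act a \<phi>\<close>. For left multiplication, vanishing
  at long paths is preserved by \<open>eventually_in_act\<close>.\<close>

lemma null_act:
  fixes f :: "('m, 'r::{comm_ring, comm_monoid_mult}) kp_free"
  assumes "f \<in> kp_null \<Lambda>"
  shows "eventually_in (\<lambda>_. {0}) (act f \<phi>)"
  using assms
proof (induction arbitrary: \<phi>)
  case (rel f)
  then show ?case using relator_act[OF rel, of \<phi>] by (simp add: eventually_in_def)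
next
  case zero
  have "act 0 \<phi> = (\<lambda>_. 0)" by (simp add: fun_eq_iff act_zero)
  then show ?case using eventually_in_zero[OF zero_ring_ideal] by simp
next
  case (add f g)
  have "act (f + g) \<phi> = (\<lambda>k. act f \<phi> k + act g \<phi> k)" by (simp add: fun_eq_iff act_add)
  then show ?case using eventually_in_add[OF zero_ring_ideal add.IH] by simp
next
  case (smult f r)
  have "act (r \<cdot> f) \<phi> = (\<lambda>k. r * act f \<phi> k)" by (simp add: fun_eq_iff act_smult)
  then show ?case using eventually_in_scale[OF zero_ring_ideal smult.IH] by simp
next
  case (left a f)
  have "act (a * f) \<phi> = act a (act f \<phi>)" by (simp add: fun_eq_iff act_mult)
  then show ?case using eventually_in_act[OF zero_ring_ideal left.hyps(1) left.IH] by simp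
next
  case (right f a)
  have "act (f * a) \<phi> = act f (act a \<phi>)" by (simp add: fun_eq_iff act_mult)
  then show ?case using right.IH by simp
qed

text \<open>If every \<open>\<J> v\<close> is an ideal, this is the kernel of the action on all
  functions modulo those that are eventually in \<open>\<J>\<close>.\<close>

definition action_ideal ::
  "('m \<Rightarrow> 'r::{comm_ring, comm_monoid_mult} set) \<Rightarrow> ('m, 'r) kp_free set" where
  "action_ideal \<J> = {f \<in> kp_free \<Lambda>. \<forall>\<phi>. eventually_in \<J> (act f \<phi>)}"

lemma lifted_ideal_action_ideal:
  fixes \<J> :: "'m \<Rightarrow> 'r::{comm_ring, comm_monoid_mult} set"
  assumes \<J>: "\<And>v. v \<in> obj \<Lambda> \<Longrightarrow> \<J> v \<in> ring_ideals"
  shows "lifted_ideal \<Lambda> (action_ideal \<J>)"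
  unfolding lifted_ideal_def
proof (intro conjI ballI subsetI)
  fix f :: "('m, 'r) kp_free" assume "f \<in> action_ideal \<J>"
  then show "f \<in> kp_free \<Lambda>" by (simp add: action_ideal_def)
next
  fix f :: "('m, 'r) kp_free" assume f: "f \<in> kp_null \<Lambda>"
  have "eventually_in \<J> (act f \<phi>)" for \<phi>
    by (rule eventually_in_mono[OF null_act[OF f]]) (simp add: ring_idealsD(1)[OF \<J>])
  then show "f \<in> action_ideal \<J>" using kp_null_free[OF f] by (simp add: action_ideal_def)
next
  fix f g :: "('m, 'r) kp_free" assume fg: "f \<in> action_ideal \<J>" "g \<in> action_ideal \<J>"
  have "act (f + g) \<phi> = (\<lambda>k. act f \<phi> k + act g \<phi> k)" for \<phi> by (simp add: fun_eq_iff act_add)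
  then show "f + g \<in> action_ideal \<J>"
    using fg eventually_in_add[OF \<J>] by (simp add: action_ideal_def kp_free_closed)
next
  fix a f :: "('m, 'r) kp_free" assume af: "a \<in> kp_free \<Lambda>" "f \<in> action_ideal \<J>"
  have eq: "act (a * f) \<phi> = act a (act f \<phi>)" "act (f * a) \<phi> = act f (act a \<phi>)" for \<phi>
    by (simp_all add: fun_eq_iff act_mult)
  show "a * f \<in> action_ideal \<J>" "f * a \<in> action_ideal \<J>"
    using af eventually_in_act[OF \<J>] by (simp_all add: action_ideal_def kp_free_closed eq)
qed

text \<open>At a path \<open>k\<close> from \<open>v\<close> the resulting value is a multiple of
  \<open>r\<close>, and \<open>her\<close> carries \<open>r\<close> from \<open>\<J> v\<close> to
  the ideal at the source of \<open>k\<close>.\<close>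

lemma smult_p_in_action_ideal:
  fixes \<J> :: "'m \<Rightarrow> 'r::{comm_ring, comm_monoid_mult} set"
  assumes \<J>: "\<And>v. v \<in> obj \<Lambda> \<Longrightarrow> \<J> v \<in> ring_ideals"
    and her: "\<And>x. x \<in> mor \<Lambda> \<Longrightarrow> \<J> (rng \<Lambda> x) \<subseteq> \<J> (src \<Lambda> x)"
    and v: "v \<in> obj \<Lambda>" and r: "r \<in> \<J> v"
  shows "r \<cdot> free_p v \<in> action_ideal \<J>"
proof -
  have "eventually_in \<J> (act (r \<cdot> free_p v) \<phi>)" for \<phi>
  proof (rule eventually_inI[of 0])
    fix k assume k: "k \<in> mor \<Lambda>"
    note J = \<J>[OF src_obj[OF k]]
    show "act (r \<cdot> free_p v) \<phi> k \<in> \<J> (src \<Lambda> k)"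
    proof (cases "rng \<Lambda> k = v")
      case True
      then have "r \<in> \<J> (src \<Lambda> k)" using her[OF k] r by blast
      then have "\<phi> k * r \<in> \<J> (src \<Lambda> k)" by (rule ring_idealsD(3)[OF J])
      moreover have "act (r \<cdot> free_p v) \<phi> k = \<phi> k * r"
        using True k by (simp add: act_smult act_p mult.commute)
      ultimately show ?thesis by simp
    next
      case False
      then have "act (r \<cdot> free_p v) \<phi> k = 0" by (simp add: act_smult act_p)
      then show ?thesis using ring_idealsD(1)[OF J] by simp
    qed
  qed
  then show ?thesis using v by (simp add: action_ideal_def kp_free_closed)
qed

lemma action_ideal_smult_pD:
  assumes v: "v \<in> obj \<Lambda>" and r: "r \<cdot> free_p v \<in> action_ideal \<J>"
  shows "\<exists>n. \<forall>x\<in>paths_from \<Lambda> v n. r \<in> \<J> (src \<Lambda> x)"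
proof -
  \<comment> \<open>The constant function 1 is the test function: its image has the value
    \<open>r\<close> at every path from \<open>v\<close>.\<close>
  have "eventually_in \<J> (act (r \<cdot> free_p v) (\<lambda>_. 1))" using r by (simp add: action_ideal_def)
  then obtain n where n: "\<And>k. k \<in> mor \<Lambda> \<Longrightarrow> n \<le> deg \<Lambda> k \<Longrightarrow> act (r \<cdot> free_p v) (\<lambda>_. 1) k \<in> \<J> (src \<Lambda> k)"
    unfolding eventually_in_def by blast
  show ?thesis
  proof (intro exI[of _ n] ballI)
    fix x assume "x \<in> paths_from \<Lambda> v n"
    then show "r \<in> \<J> (src \<Lambda> x)"
      using n[of x] by (simp add: paths_from_def act_smult act_p)
  qed
qed

section \<open>Ideals of the Kumjian--Pask algebra\<close>

text \<open>Together with taking images under \<open>kp_class \<Lambda>\<close> this matches the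
  ideals of \<open>KP \<Lambda>\<close> with the lifted ideals.\<close>

definition ideal_lift ::
  "('m, 'r::{comm_ring, comm_monoid_mult}) kp_free set set \<Rightarrow> ('m, 'r) kp_free set" where
  "ideal_lift I = {f \<in> kp_free \<Lambda>. kp_class \<Lambda> f \<in> I}"

lemma acarrier_KP: "acarrier (KP \<Lambda>) = kp_class \<Lambda> ` kp_free \<Lambda>"
  by (auto simp: KP_def quotient_def kp_class_def)

lemma azero_KP: "azero (KP \<Lambda>) = kp_class \<Lambda> 0"
  by (simp add: KP_def)

lemma aidealsD:
  assumes "I \<in> aideals (KP \<Lambda>)"
  shows "I \<subseteq> kp_class \<Lambda> ` kp_free \<Lambda>" "kp_class \<Lambda> 0 \<in> I"
    "f \<in> kp_free \<Lambda> \<Longrightarrow> g \<in> kp_free \<Lambda> \<Longrightarrow> kp_class \<Lambda> f \<in> I \<Longrightarrow> kp_class \<Lambda> g \<in> I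
      \<Longrightarrow> kp_class \<Lambda> (f + g) \<in> I"
    "f \<in> kp_free \<Lambda> \<Longrightarrow> g \<in> kp_free \<Lambda> \<Longrightarrow> kp_class \<Lambda> f \<in> I \<Longrightarrow> kp_class \<Lambda> (g * f) \<in> I"
    "f \<in> kp_free \<Lambda> \<Longrightarrow> g \<in> kp_free \<Lambda> \<Longrightarrow> kp_class \<Lambda> f \<in> I \<Longrightarrow> kp_class \<Lambda> (f * g) \<in> I"
proof -
  have I: "I \<subseteq> acarrier (KP \<Lambda>)" "azero (KP \<Lambda>) \<in> I" "\<forall>x\<in>I. \<forall>y\<in>I. aadd (KP \<Lambda>) x y \<in> I"
    "\<forall>a\<in>acarrier (KP \<Lambda>). \<forall>x\<in>I. amult (KP \<Lambda>) a x \<in> I \<and> amult (KP \<Lambda>) x a \<in> I"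
    using assms unfolding aideals_def by auto
  show "I \<subseteq> kp_class \<Lambda> ` kp_free \<Lambda>" "kp_class \<Lambda> 0 \<in> I"
    using I(1,2) by (simp_all add: acarrier_KP azero_KP)
  assume f: "f \<in> kp_free \<Lambda>" "kp_class \<Lambda> f \<in> I" and g: "g \<in> kp_free \<Lambda>"
  show "kp_class \<Lambda> (f + g) \<in> I" if "kp_class \<Lambda> g \<in> I"
    using bspec[OF bspec[OF I(3) f(2)] that] by (simp add: KP_ops f(1) g)
  have "kp_class \<Lambda> g \<in> acarrier (KP \<Lambda>)" using g by (simp add: acarrier_KP)
  from bspec[OF bspec[OF I(4) this] f(2)]
  show "kp_class \<Lambda> (g * f) \<in> I" "kp_class \<Lambda> (f * g) \<in> I" by (simp_all add: KP_ops f(1) g)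
qed

lemma kp_class_null: "f \<in> kp_null \<Lambda> \<Longrightarrow> kp_class \<Lambda> f = kp_class \<Lambda> 0"
  by (rule kp_class_cong) (simp flip: null_cong)

lemma lifted_ideal_lift:
  fixes I :: "('m, 'r::{comm_ring, comm_monoid_mult}) kp_free set set"
  assumes "I \<in> aideals (KP \<Lambda>)"
  shows "lifted_ideal \<Lambda> (ideal_lift I)"
  unfolding lifted_ideal_def
proof (intro conjI ballI subsetI)
  fix f :: "('m, 'r) kp_free" assume "f \<in> kp_null \<Lambda>"
  then show "f \<in> ideal_lift I"
    using aidealsD(2)[OF assms] by (simp add: ideal_lift_def kp_null_free kp_class_null)
qed (auto simp: ideal_lift_def kp_free_closed aidealsD(3-5)[OF assms])

lemma ideal_lift_obtain:
  assumes "I \<in> aideals (KP \<Lambda>)" "a \<in> I"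
  obtains f where "f \<in> ideal_lift I" "a = kp_class \<Lambda> f"
  using aidealsD(1)[OF assms(1)] assms(2) unfolding ideal_lift_def by blast

lemma ideal_lift_class_image:
  assumes "lifted_ideal \<Lambda> J"
  shows "ideal_lift (kp_class \<Lambda> ` J) = J"
proof
  show "ideal_lift (kp_class \<Lambda> ` J) \<subseteq> J"
  proof
    fix f assume "f \<in> ideal_lift (kp_class \<Lambda> ` J)"
    then obtain g where g: "g \<in> J" "kp_class \<Lambda> g = kp_class \<Lambda> f" and f: "f \<in> kp_free \<Lambda>"
      unfolding ideal_lift_def by auto
    show "f \<in> J" by (rule lifted_ideal_equiv[OF assms g(1) kp_class_eqD[OF g(2) f]])
  qed
  show "J \<subseteq> ideal_lift (kp_class \<Lambda> ` J)"
    using lifted_idealD(1)[OF assms] unfolding ideal_lift_def by blast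
qed

lemma class_image_aideal:
  fixes J :: "('m, 'r::{comm_ring, comm_monoid_mult}) kp_free set"
  assumes J: "lifted_ideal \<Lambda> J"
  shows "kp_class \<Lambda> ` J \<in> aideals (KP \<Lambda>)"
  unfolding aideals_def mem_Collect_eq
proof (intro conjI ballI)
  note D = lifted_idealD[OF J]
  show "kp_class \<Lambda> ` J \<subseteq> acarrier (KP \<Lambda>)" using D(1) by (auto simp: acarrier_KP)
  show "azero (KP \<Lambda>) \<in> kp_class \<Lambda> ` J" using D(2)[OF kp_null.zero] by (simp add: azero_KP)
  fix a assume "a \<in> kp_class \<Lambda> ` J"
  then obtain f where f: "f \<in> J" "a = kp_class \<Lambda> f" by blast
  show "aadd (KP \<Lambda>) a b \<in> kp_class \<Lambda> ` J" if b: "b \<in> kp_class \<Lambda> ` J" for b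
  proof -
    obtain g where g: "g \<in> J" "b = kp_class \<Lambda> g" using b by blast
    show ?thesis
      unfolding f(2) g(2) KP_ops(1)[OF D(1)[OF f(1)] D(1)[OF g(1)]] by (intro imageI D(3) f g)
  qed
  \<comment> \<open>The additive inverses demanded by \<open>aideals\<close> come from closure under
    the scalar \<open>- 1\<close>.\<close>
  have "(- 1) \<cdot> f = - f" by (simp add: free_smult_def single_uminus single_one_mult)
  then have m: "- f \<in> J" using lifted_ideal_smult[OF J f(1), of "- 1"] by simp
  have "aadd (KP \<Lambda>) a (kp_class \<Lambda> (- f)) = azero (KP \<Lambda>)"
    unfolding f(2) KP_ops(1)[OF D(1)[OF f(1)] D(1)[OF m]] by (simp add: azero_KP)
  then show "\<exists>b\<in>kp_class \<Lambda> ` J. aadd (KP \<Lambda>) a b = azero (KP \<Lambda>)" using m by blast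
next
  fix a b assume "a \<in> acarrier (KP \<Lambda> :: ('r, ('m, 'r) kp_free set) nalg)" "b \<in> kp_class \<Lambda> ` J"
  then obtain g f where g: "a = kp_class \<Lambda> g" "g \<in> kp_free \<Lambda>" and f: "f \<in> J" "b = kp_class \<Lambda> f"
    by (auto simp: acarrier_KP)
  note ff = lifted_idealD(1)[OF J f(1)]
  show "amult (KP \<Lambda>) a b \<in> kp_class \<Lambda> ` J"
    unfolding g(1) f(2) KP_ops(2)[OF g(2) ff] by (intro imageI lifted_idealD(4)[OF J] g f)
  show "amult (KP \<Lambda>) b a \<in> kp_class \<Lambda> ` J"
    unfolding g(1) f(2) KP_ops(2)[OF ff g(2)] by (intro imageI lifted_idealD(5)[OF J] g f)
qed

section \<open>Spanning elements and assertion (1)\<close>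

lemma asmult_kp_p:
  "v \<in> obj \<Lambda> \<Longrightarrow> asmult (KP \<Lambda>) r (kp_p \<Lambda> v) = kp_class \<Lambda> (r \<cdot> free_p v)"
  unfolding kp_p_def by (rule KP_ops(3)[OF free_p_free free_p_free])

lemma asmult_kp_p_in_iff:
  "v \<in> obj \<Lambda> \<Longrightarrow> asmult (KP \<Lambda>) r (kp_p \<Lambda> v) \<in> I \<longleftrightarrow> r \<cdot> free_p v \<in> ideal_lift I"
  by (simp add: asmult_kp_p ideal_lift_def kp_free_closed)

lemma kp_st_class:
  "x \<in> mor \<Lambda> \<Longrightarrow> y \<in> mor \<Lambda> \<Longrightarrow> kp_st \<Lambda> x y = kp_class \<Lambda> (S x * T y)"
  unfolding kp_st_def kp_s_def kp_t_def by (rule KP_ops(2)) simp_all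

lemma asmult_kp_st:
  assumes "x \<in> mor \<Lambda>" "y \<in> mor \<Lambda>"
  shows "asmult (KP \<Lambda>) r (kp_st \<Lambda> x y) = kp_class \<Lambda> (r \<cdot> (S x * T y))"
proof -
  have "S x * T y \<in> kp_free \<Lambda>" using assms by (simp add: kp_free_closed)
  from KP_ops(3)[OF this this] show ?thesis unfolding kp_st_class[OF assms] .
qed

text \<open>The ghost \<open>T y\<close> absorbs the vertex at its own source, so the sources of
  \<open>x\<close> and \<open>y\<close> may differ.\<close>

lemma smult_S_T_in_ideal:
  assumes J: "lifted_ideal \<Lambda> J" and x: "x \<in> mor \<Lambda>" "y \<in> mor \<Lambda>" and r: "r \<cdot> free_p (src \<Lambda> y) \<in> J"
  shows "r \<cdot> (S x * T y) \<in> J"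
proof (rule lifted_ideal_equiv[OF J])
  show "S x * (r \<cdot> free_p (src \<Lambda> y) * T y) \<in> J"
    by (intro lifted_idealD(4,5)[OF J] S_free T_free x r)
  show "S x * (r \<cdot> free_p (src \<Lambda> y) * T y) \<doteq> r \<cdot> (S x * T y)"
    unfolding smult_mult_left smult_mult_right
    by (intro kp_equiv_smult cong_mult_left p_T S_free x)
qed

text \<open>Ideals contain the spans of their subsets because \<open>lifted_ideal_smult\<close>
  makes them closed under scalars.\<close>

lemma aspan_least:
  assumes I: "I \<in> aideals (KP \<Lambda>)" and X: "X \<subseteq> I"
  shows "aspan (KP \<Lambda>) X \<subseteq> I"
proof
  note L = lifted_ideal_lift[OF I]
  fix a assume "a \<in> aspan (KP \<Lambda>) X"
  then show "a \<in> I"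
  proof induction
    case (base a)
    then show ?case using X by blast
  next
    case zero
    then show ?case using aidealsD(2)[OF I] by (simp add: azero_KP)
  next
    case (add a b)
    obtain f where f: "f \<in> ideal_lift I" "a = kp_class \<Lambda> f"
      by (rule ideal_lift_obtain[OF I add.IH(1)])
    obtain g where g: "g \<in> ideal_lift I" "b = kp_class \<Lambda> g"
      by (rule ideal_lift_obtain[OF I add.IH(2)])
    have "f + g \<in> ideal_lift I" by (rule lifted_idealD(3)[OF L f(1) g(1)])
    then show ?case
      unfolding f(2) g(2) KP_ops(1)[OF lifted_idealD(1)[OF L f(1)] lifted_idealD(1)[OF L g(1)]]
      by (simp add: ideal_lift_def)
  next
    case (smult a r)
    obtain f where f: "f \<in> ideal_lift I" "a = kp_class \<Lambda> f"
      by (rule ideal_lift_obtain[OF I smult.IH])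
    note ff = lifted_idealD(1)[OF L f(1)]
    have "r \<cdot> f \<in> ideal_lift I" by (rule lifted_ideal_smult[OF L f(1)])
    then show ?case unfolding f(2) KP_ops(3)[OF ff ff] by (simp add: ideal_lift_def)
  qed
qed

lemma aspan_mono:
  assumes "X \<subseteq> Y"
  shows "aspan A X \<subseteq> aspan A Y"
proof
  fix a assume "a \<in> aspan A X"
  then show "a \<in> aspan A Y"
  proof induction
    case (base a)
    then show ?case using assms by (intro aspan.base) blast
  qed (simp_all add: aspan.zero aspan.add aspan.smult)
qed

lemma ideal_eq_aspan:
  fixes I :: "('m, 'r::{comm_ring, comm_monoid_mult}) kp_free set set"
  assumes SA: "strongly_aperiodic \<Lambda>" and I: "I \<in> aideals (KP \<Lambda>)"
  shows "I = aspan (KP \<Lambda>) {asmult (KP \<Lambda>) r (kp_st \<Lambda> x y) | r x y.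
    x \<in> mor \<Lambda> \<and> y \<in> mor \<Lambda> \<and> asmult (KP \<Lambda>) r (kp_p \<Lambda> (src \<Lambda> y)) \<in> I}" (is "I = aspan _ ?X")
proof
  note L = lifted_ideal_lift[OF I]
  show "aspan (KP \<Lambda>) ?X \<subseteq> I"
  proof (rule aspan_least[OF I], rule subsetI)
    fix a assume "a \<in> ?X"
    then obtain r x y where a: "a = asmult (KP \<Lambda>) r (kp_st \<Lambda> x y)" and x: "x \<in> mor \<Lambda>" "y \<in> mor \<Lambda>"
      and r: "asmult (KP \<Lambda>) r (kp_p \<Lambda> (src \<Lambda> y)) \<in> I" by blast
    have "r \<cdot> (S x * T y) \<in> ideal_lift I"
      using r by (intro smult_S_T_in_ideal[OF L x]) (simp add: asmult_kp_p_in_iff src_obj x)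
    then show "a \<in> I" by (simp add: a asmult_kp_st[OF x] ideal_lift_def)
  qed
  show "I \<subseteq> aspan (KP \<Lambda>) ?X"
  proof
    fix a assume "a \<in> I"
    then obtain f where f: "f \<in> ideal_lift I" "a = kp_class \<Lambda> f"
      by (rule ideal_lift_obtain[OF I])
    \<comment> \<open>The abstract set of \<open>lifted_ideal_expansion\<close> is instantiated with
      the representatives of the span.\<close>
    let ?K = "{f \<in> kp_free \<Lambda>. kp_class \<Lambda> f \<in> aspan (KP \<Lambda>) ?X}"
    have "f \<in> ?K"
    proof (rule lifted_ideal_expansion[OF SA L f(1)])
      show "0 \<in> ?K" using aspan.zero[of "KP \<Lambda>" ?X] by (simp add: azero_KP kp_free_closed)
      show "f + g \<in> ?K" if "f \<in> ?K" "g \<in> ?K" for f g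
        using that aspan.add[of "kp_class \<Lambda> f" "KP \<Lambda>" ?X "kp_class \<Lambda> g"] KP_ops(1)[of f \<Lambda> g]
        by (simp add: kp_free_closed)
      show "g \<in> ?K" if "f \<in> ?K" "f \<doteq> g" for f g
        using that kp_equivD(2)[OF that(2)] kp_class_cong[OF that(2)] by simp
      show "r \<cdot> (S x * T y) \<in> ?K"
        if "x \<in> mor \<Lambda>" "y \<in> mor \<Lambda>" "r \<cdot> free_p (src \<Lambda> y) \<in> ideal_lift I" for r x y
      proof -
        have "asmult (KP \<Lambda>) r (kp_st \<Lambda> x y) \<in> ?X"
          using that asmult_kp_p_in_iff[OF src_obj[OF that(2)]] by blast
        then show ?thesis
          using aspan.base[of _ ?X "KP \<Lambda>"] asmult_kp_st[OF that(1,2), of r] that(1,2)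
          by (simp add: kp_free_closed)
      qed
    qed
    then show "a \<in> aspan (KP \<Lambda>) ?X" by (simp add: f(2))
  qed
qed

section \<open>The correspondence\<close>

lemma kp_ideal_of_least:
  assumes "I \<in> aideals (KP \<Lambda>)" "\<And>v. v \<in> H \<Longrightarrow> kp_p \<Lambda> v \<in> I"
  shows "kp_ideal_of \<Lambda> H \<subseteq> I"
  unfolding kp_ideal_of_def ideal_gen_def using assms by blast

text \<open>The case \<open>r = 1\<close> of \<open>smult_S_T_in_ideal\<close>, applied to each
  ideal that contains the vertices of \<open>H\<close>.\<close>

lemma kp_st_in_kp_ideal_of:
  fixes H :: "'m set"
  assumes x: "x \<in> mor \<Lambda>" "y \<in> mor \<Lambda>" and H: "src \<Lambda> y \<in> H"
  shows "kp_st \<Lambda> x y \<in> (kp_ideal_of \<Lambda> H :: ('m, 'r::{comm_ring, comm_monoid_mult}) kp_free set set)"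
  unfolding kp_ideal_of_def ideal_gen_def
proof (rule InterI)
  fix I :: "('m, 'r) kp_free set set"
  assume "I \<in> {I \<in> aideals (KP \<Lambda>). kp_p \<Lambda> ` H \<subseteq> I}"
  then have I: "I \<in> aideals (KP \<Lambda>)" "kp_p \<Lambda> (src \<Lambda> y) \<in> I" using H by auto
  have "1 \<cdot> free_p (src \<Lambda> y) \<in> ideal_lift I"
    using I(2) src_obj[OF x(2)] by (simp add: ideal_lift_def kp_p_def)
  then have "1 \<cdot> (S x * T y) \<in> ideal_lift I"
    by (rule smult_S_T_in_ideal[OF lifted_ideal_lift[OF I(1)] x])
  then show "kp_st \<Lambda> x y \<in> I" by (simp add: ideal_lift_def kp_st_class[OF x])
qed

text \<open>This is the colon ideal of \<open>J\<close> by the scalars \<open>Q\<close>. It extends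
  the condition that \<open>Q\<close> multiplies certain vertices into \<open>J\<close> to the whole
  ideal generated by these vertices.\<close>

lemma lifted_ideal_colon:
  fixes J :: "('m, 'r::{comm_ring, comm_monoid_mult}) kp_free set"
  assumes J: "lifted_ideal \<Lambda> J"
  shows "lifted_ideal \<Lambda> {f \<in> kp_free \<Lambda>. \<forall>r\<in>Q. r \<cdot> f \<in> J}"
  unfolding lifted_ideal_def
proof (intro conjI ballI subsetI)
  note D = lifted_idealD[OF J]
  show "f \<in> {f \<in> kp_free \<Lambda>. \<forall>r\<in>Q. r \<cdot> f \<in> J}" if "f \<in> kp_null \<Lambda>" for f
    using that D(2)[OF kp_null.smult] kp_null_free by blast
  show "f + g \<in> {f \<in> kp_free \<Lambda>. \<forall>r\<in>Q. r \<cdot> f \<in> J}"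
    if "f \<in> {f \<in> kp_free \<Lambda>. \<forall>r\<in>Q. r \<cdot> f \<in> J}" "g \<in> {f \<in> kp_free \<Lambda>. \<forall>r\<in>Q. r \<cdot> f \<in> J}" for f g
    using that D(3) by (simp add: kp_free_closed smult_add)
  fix a f :: "('m, 'r) kp_free" assume a: "a \<in> kp_free \<Lambda>" and f: "f \<in> {f \<in> kp_free \<Lambda>. \<forall>r\<in>Q. r \<cdot> f \<in> J}"
  have "r \<cdot> (a * f) \<in> J" "r \<cdot> (f * a) \<in> J" if "r \<in> Q" for r
    using D(4,5)[OF a, of "r \<cdot> f"] f that by (simp_all add: smult_mult_left smult_mult_right)
  then show "a * f \<in> {f \<in> kp_free \<Lambda>. \<forall>r\<in>Q. r \<cdot> f \<in> J}" "f * a \<in> {f \<in> kp_free \<Lambda>. \<forall>r\<in>Q. r \<cdot> f \<in> J}"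
    using a f by (simp_all add: kp_free_closed)
qed simp

text \<open>
  \<open>kp_Gamma\<close> inverts the map that sends \<open>I\<close> to \<open>H \<mapsto> {r. r p\<^sub>v \<in> I for all v \<in> H}\<close>.
\<close>

lemma kp_Gamma_eq:
  fixes I :: "('m, 'r::{comm_ring, comm_monoid_mult}) kp_free set set"
  assumes SA: "strongly_aperiodic \<Lambda>" and I: "I \<in> aideals (KP \<Lambda>)"
    and \<pi>: "\<And>H. H \<in> sat_her \<Lambda> \<Longrightarrow> \<pi> H = {r. \<forall>v\<in>H. r \<cdot> free_p v \<in> ideal_lift I}"
  shows "kp_Gamma \<Lambda> \<pi> = I"
proof
  note L = lifted_ideal_lift[OF I]
  let ?Y = "{asmult (KP \<Lambda>) r (kp_st \<Lambda> x y) | r x y. x \<in> mor \<Lambda> \<and> y \<in> mor \<Lambda> \<and>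
    (\<exists>H \<in> sat_her \<Lambda>. r \<in> \<pi> H \<and> kp_st \<Lambda> x y \<in> (kp_ideal_of \<Lambda> H :: ('m, 'r) kp_free set set))}"
  show "kp_Gamma \<Lambda> \<pi> \<subseteq> I"
    unfolding kp_Gamma_def
  proof (rule aspan_least[OF I], rule subsetI)
    fix a assume "a \<in> ?Y"
    then obtain r x y H where a: "a = asmult (KP \<Lambda>) r (kp_st \<Lambda> x y)" and H: "H \<in> sat_her \<Lambda>" "r \<in> \<pi> H"
      and x: "kp_st \<Lambda> x y \<in> (kp_ideal_of \<Lambda> H :: ('m, 'r) kp_free set set)" by blast
    \<comment> \<open>The colon ideal by \<open>\<pi> H\<close> contains the vertices of
      \<open>H\<close>, hence their generated ideal, so \<open>r\<close> multiplies the given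
      element into \<open>I\<close>.\<close>
    let ?J = "{f \<in> kp_free \<Lambda>. \<forall>r\<in>\<pi> H. r \<cdot> f \<in> ideal_lift I}"
    have "kp_ideal_of \<Lambda> H \<subseteq> kp_class \<Lambda> ` ?J"
    proof (rule kp_ideal_of_least[OF class_image_aideal[OF lifted_ideal_colon[OF L]]])
      fix v assume "v \<in> H"
      then have "free_p v \<in> ?J" using \<pi>[OF H(1)] sat_herD(1)[OF H(1)] by auto
      then show "kp_p \<Lambda> v \<in> kp_class \<Lambda> ` ?J" unfolding kp_p_def by (rule imageI)
    qed
    then obtain f where f: "f \<in> ?J" "kp_st \<Lambda> x y = kp_class \<Lambda> f" using x by blast
    then have "r \<cdot> f \<in> ideal_lift I" "f \<in> kp_free \<Lambda>" using H(2) by auto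
    then show "a \<in> I" using KP_ops(3)[of f \<Lambda> f r] by (simp add: a f(2) ideal_lift_def)
  qed
  have "I = aspan (KP \<Lambda>) {asmult (KP \<Lambda>) r (kp_st \<Lambda> x y) | r x y.
    x \<in> mor \<Lambda> \<and> y \<in> mor \<Lambda> \<and> asmult (KP \<Lambda>) r (kp_p \<Lambda> (src \<Lambda> y)) \<in> I}" (is "I = aspan _ ?X")
    by (rule ideal_eq_aspan[OF SA I])
  also have "\<dots> \<subseteq> aspan (KP \<Lambda>) ?Y"
  proof (rule aspan_mono, rule subsetI)
    fix a assume "a \<in> ?X"
    then obtain r x y where a: "a = asmult (KP \<Lambda>) r (kp_st \<Lambda> x y)" and x: "x \<in> mor \<Lambda>" "y \<in> mor \<Lambda>"
      and r: "asmult (KP \<Lambda>) r (kp_p \<Lambda> (src \<Lambda> y)) \<in> I" by blast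
    \<comment> \<open>The witness is the largest set whose vertices are all multiplied into
      \<open>I\<close> by \<open>r\<close>.\<close>
    let ?H = "{v \<in> obj \<Lambda>. r \<cdot> free_p v \<in> ideal_lift I}"
    have H: "?H \<in> sat_her \<Lambda>" by (rule coefficient_sat_her[OF L])
    have "src \<Lambda> y \<in> ?H" using r src_obj[OF x(2)] by (simp add: asmult_kp_p_in_iff)
    then have "kp_st \<Lambda> x y \<in> (kp_ideal_of \<Lambda> ?H :: ('m, 'r) kp_free set set)"
      by (rule kp_st_in_kp_ideal_of[OF x])
    moreover have "r \<in> \<pi> ?H" unfolding \<pi>[OF H] by simp
    ultimately show "a \<in> ?Y" using a x H by blast
  qed
  finally show "I \<subseteq> kp_Gamma \<Lambda> \<pi>" unfolding kp_Gamma_def .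
qed

text \<open>The smallest saturated hereditary set containing \<open>v\<close>;
  \<open>sh_join\<close> accepts the family \<open>{{v}}\<close> although \<open>{v}\<close> itself
  may be neither saturated nor hereditary.\<close>

definition sh_closure :: "'m \<Rightarrow> 'm set" where
  "sh_closure v = sh_join \<Lambda> {{v}}"

lemma sh_closure_sat_her: "v \<in> obj \<Lambda> \<Longrightarrow> sh_closure v \<in> sat_her \<Lambda>"
  unfolding sh_closure_def by (rule sh_join_sat_her) simp

lemma sh_closure_self: "v \<in> sh_closure v"
  unfolding sh_closure_def using sh_join_upper[of "{v}"] by simp

lemma sh_closure_least: "H \<in> sat_her \<Lambda> \<Longrightarrow> v \<in> H \<Longrightarrow> sh_closure v \<subseteq> H"
  unfolding sh_closure_def by (rule sh_join_least) simp_all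

section \<open>Maps that turn joins into intersections are determined by ideals at vertices\<close>

context
  fixes \<pi> :: "'m set \<Rightarrow> 'r::{comm_ring, comm_monoid_mult} set"
  assumes \<pi>: "\<pi> \<in> join_maps \<Lambda>"
begin

lemma join_map_ideal: "H \<in> sat_her \<Lambda> \<Longrightarrow> \<pi> H \<in> ring_ideals"
  using \<pi> unfolding join_maps_def by (auto dest: PiE_mem)

lemma join_map_join: "\<A> \<subseteq> sat_her \<Lambda> \<Longrightarrow> \<pi> (sh_join \<Lambda> \<A>) = (\<Inter>H\<in>\<A>. \<pi> H)"
  using \<pi> unfolding join_maps_def by simp

text \<open>The join of \<open>H\<close> and \<open>K\<close> is \<open>K\<close>, so
  \<open>\<pi> K\<close> is the intersection of \<open>\<pi> H\<close> and
  \<open>\<pi> K\<close>.\<close>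

lemma join_map_antimono:
  assumes "H \<in> sat_her \<Lambda>" "K \<in> sat_her \<Lambda>" "H \<subseteq> K"
  shows "\<pi> K \<subseteq> \<pi> H"
proof -
  have "sh_join \<Lambda> {H, K} \<subseteq> K" using assms by (intro sh_join_least) auto
  moreover have "K \<subseteq> sh_join \<Lambda> {H, K}" by (rule sh_join_upper) simp
  ultimately have "sh_join \<Lambda> {H, K} = K" by (rule equalityI)
  then show ?thesis using join_map_join[of "{H, K}"] assms by auto
qed

abbreviation vertex_ideal :: "'m \<Rightarrow> 'r set" where
  "vertex_ideal v \<equiv> \<pi> (sh_closure v)"

text \<open>\<open>H\<close> is the join of the closures of its vertices, and \<open>\<pi>\<close>
  turns this join into an intersection.\<close>

lemma join_map_eq_Inter:
  assumes H: "H \<in> sat_her \<Lambda>"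
  shows "\<pi> H = (\<Inter>v\<in>H. vertex_ideal v)"
proof -
  have sub: "sh_closure ` H \<subseteq> sat_her \<Lambda>" using sh_closure_sat_her sat_herD(1)[OF H] by auto
  have "sh_join \<Lambda> (sh_closure ` H) \<subseteq> H"
    using sh_closure_least[OF H] by (intro sh_join_least[OF H]) auto
  moreover have "H \<subseteq> sh_join \<Lambda> (sh_closure ` H)"
    using sh_join_upper[of _ "sh_closure ` H"] sh_closure_self by blast
  ultimately have "sh_join \<Lambda> (sh_closure ` H) = H" by (rule equalityI)
  then show ?thesis using join_map_join[OF sub] by simp
qed

lemma vertex_ideal_ideal: "v \<in> obj \<Lambda> \<Longrightarrow> vertex_ideal v \<in> ring_ideals"
  by (intro join_map_ideal sh_closure_sat_her)

text \<open>A hereditary set that contains the range of \<open>x\<close> contains its source, so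
  closures shrink along a path and their ideals grow.\<close>

lemma vertex_ideal_path:
  assumes "x \<in> mor \<Lambda>"
  shows "vertex_ideal (rng \<Lambda> x) \<subseteq> vertex_ideal (src \<Lambda> x)"
proof (rule join_map_antimono)
  show "sh_closure (rng \<Lambda> x) \<in> sat_her \<Lambda>" "sh_closure (src \<Lambda> x) \<in> sat_her \<Lambda>"
    using assms by (simp_all add: sh_closure_sat_her rng_obj src_obj)
  then show "sh_closure (src \<Lambda> x) \<subseteq> sh_closure (rng \<Lambda> x)"
    using sh_closure_least sat_herD(2)[OF _ assms sh_closure_self] by simp
qed

text \<open>By saturation \<open>v\<close> lies in the join of the closures of the sources, and
  \<open>\<pi>\<close> sends this join to the intersection of the ideals there.\<close>

lemma vertex_ideal_saturated:
  assumes v: "v \<in> obj \<Lambda>" and r: "\<And>x. x \<in> paths_from \<Lambda> v n \<Longrightarrow> r \<in> vertex_ideal (src \<Lambda> x)"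
  shows "r \<in> vertex_ideal v"
proof -
  let ?\<A> = "(\<lambda>x. sh_closure (src \<Lambda> x)) ` paths_from \<Lambda> v n"
  have sub: "?\<A> \<subseteq> sat_her \<Lambda>"
    by (auto simp: paths_from_def src_obj intro!: sh_closure_sat_her)
  have join: "sh_join \<Lambda> ?\<A> \<in> sat_her \<Lambda>"
    by (rule sh_join_sat_her) (use sub sat_herD(1) in blast)
  have "src \<Lambda> ` paths_from \<Lambda> v n \<subseteq> sh_join \<Lambda> ?\<A>"
    using sh_join_upper[of _ ?\<A>] sh_closure_self by blast
  then have "v \<in> sh_join \<Lambda> ?\<A>" by (rule sat_herD(3)[OF join v])
  then have "sh_closure v \<subseteq> sh_join \<Lambda> ?\<A>" by (rule sh_closure_least[OF join])
  then have "\<pi> (sh_join \<Lambda> ?\<A>) \<subseteq> vertex_ideal v"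
    by (rule join_map_antimono[OF sh_closure_sat_her[OF v] join])
  moreover have "r \<in> \<pi> (sh_join \<Lambda> ?\<A>)" unfolding join_map_join[OF sub] using r by blast
  ultimately show ?thesis by blast
qed

lemma smult_p_in_action_ideal_iff:
  assumes v: "v \<in> obj \<Lambda>"
  shows "r \<cdot> free_p v \<in> action_ideal vertex_ideal \<longleftrightarrow> r \<in> vertex_ideal v"
proof
  assume "r \<cdot> free_p v \<in> action_ideal vertex_ideal"
  then obtain n where "\<forall>x\<in>paths_from \<Lambda> v n. r \<in> vertex_ideal (src \<Lambda> x)"
    using action_ideal_smult_pD[OF v] by blast
  then show "r \<in> vertex_ideal v" by (intro vertex_ideal_saturated[OF v]) blast
next
  assume "r \<in> vertex_ideal v"
  then show "r \<cdot> free_p v \<in> action_ideal vertex_ideal"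
    by (intro smult_p_in_action_ideal vertex_ideal_ideal vertex_ideal_path v)
qed

text \<open>The ideal is constructed before \<open>kp_Gamma\<close> is evaluated:
  \<open>\<pi>\<close> can be read off from the action ideal of its vertex ideals, and
  \<open>kp_Gamma_eq\<close> then identifies the image of that ideal with
  \<open>kp_Gamma \<Lambda> \<pi>\<close>.\<close>

lemma kp_Gamma_join_map:
  assumes SA: "strongly_aperiodic \<Lambda>"
  shows "kp_Gamma \<Lambda> \<pi> \<in> aideals (KP \<Lambda>)"
    and "H \<in> sat_her \<Lambda> \<Longrightarrow> \<pi> H = {r. \<forall>v\<in>H. r \<cdot> free_p v \<in> ideal_lift (kp_Gamma \<Lambda> \<pi>)}"
proof -
  let ?J = "action_ideal vertex_ideal"
  have J: "lifted_ideal \<Lambda> ?J" by (rule lifted_ideal_action_ideal[OF vertex_ideal_ideal])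
  have eq: "\<pi> H = {r. \<forall>v\<in>H. r \<cdot> free_p v \<in> ideal_lift (kp_class \<Lambda> ` ?J)}" if H: "H \<in> sat_her \<Lambda>" for H
    unfolding ideal_lift_class_image[OF J] join_map_eq_Inter[OF H]
    using smult_p_in_action_ideal_iff sat_herD(1)[OF H] by blast
  have \<Gamma>: "kp_Gamma \<Lambda> \<pi> = kp_class \<Lambda> ` ?J"
    by (rule kp_Gamma_eq[OF SA class_image_aideal[OF J] eq])
  show "kp_Gamma \<Lambda> \<pi> \<in> aideals (KP \<Lambda>)" unfolding \<Gamma> by (rule class_image_aideal[OF J])
  show "H \<in> sat_her \<Lambda> \<Longrightarrow> \<pi> H = {r. \<forall>v\<in>H. r \<cdot> free_p v \<in> ideal_lift (kp_Gamma \<Lambda> \<pi>)}"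
    unfolding \<Gamma> by (rule eq)
qed

end

section \<open>Order and bijectivity: assertions (2) and (3)\<close>

lemma kp_Gamma_mono:
  assumes "\<And>H. H \<in> sat_her \<Lambda> \<Longrightarrow> \<pi>\<^sub>1 H \<subseteq> \<pi>\<^sub>2 H"
  shows "kp_Gamma \<Lambda> \<pi>\<^sub>1 \<subseteq> kp_Gamma \<Lambda> \<pi>\<^sub>2"
  unfolding kp_Gamma_def by (rule aspan_mono) (use assms in blast)

text \<open>Each map is recovered from its ideal by a formula that is monotone in the ideal.\<close>

lemma kp_Gamma_subset_iff:
  fixes \<pi>\<^sub>1 \<pi>\<^sub>2 :: "'m set \<Rightarrow> 'r::{comm_ring, comm_monoid_mult} set"
  assumes SA: "strongly_aperiodic \<Lambda>" and \<pi>: "\<pi>\<^sub>1 \<in> join_maps \<Lambda>" "\<pi>\<^sub>2 \<in> join_maps \<Lambda>"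
  shows "kp_Gamma \<Lambda> \<pi>\<^sub>1 \<subseteq> kp_Gamma \<Lambda> \<pi>\<^sub>2 \<longleftrightarrow> (\<forall>H\<in>sat_her \<Lambda>. \<pi>\<^sub>1 H \<subseteq> \<pi>\<^sub>2 H)"
proof (intro iffI ballI)
  fix H assume sub: "kp_Gamma \<Lambda> \<pi>\<^sub>1 \<subseteq> kp_Gamma \<Lambda> \<pi>\<^sub>2" and H: "H \<in> sat_her \<Lambda>"
  have "ideal_lift (kp_Gamma \<Lambda> \<pi>\<^sub>1) \<subseteq> ideal_lift (kp_Gamma \<Lambda> \<pi>\<^sub>2)"
    using sub unfolding ideal_lift_def by blast
  then show "\<pi>\<^sub>1 H \<subseteq> \<pi>\<^sub>2 H"
    unfolding kp_Gamma_join_map(2)[OF \<pi>(1) SA H] kp_Gamma_join_map(2)[OF \<pi>(2) SA H] by blast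
qed (rule kp_Gamma_mono, blast)

text \<open>The inverse of \<open>kp_Gamma\<close>, restricted to \<open>sat_her \<Lambda>\<close>
  to meet the extensionality required in \<open>join_maps\<close>.\<close>

definition ideal_map ::
  "('m, 'r::{comm_ring, comm_monoid_mult}) kp_free set set \<Rightarrow> 'm set \<Rightarrow> 'r set" where
  "ideal_map I = restrict (\<lambda>H. {r. \<forall>v\<in>H. r \<cdot> free_p v \<in> ideal_lift I}) (sat_her \<Lambda>)"

lemma ideal_map_join_maps:
  fixes I :: "('m, 'r::{comm_ring, comm_monoid_mult}) kp_free set set"
  assumes I: "I \<in> aideals (KP \<Lambda>)"
  shows "ideal_map I \<in> join_maps \<Lambda>"
  unfolding join_maps_def
proof (intro CollectI conjI allI impI)
  note L = lifted_ideal_lift[OF I]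
  have "{r. \<forall>v\<in>H. r \<cdot> free_p v \<in> ideal_lift I} \<in> ring_ideals" for H
    unfolding ring_ideals_def
    using lifted_idealD(2)[OF L kp_null.zero] lifted_idealD(3)[OF L]
      lifted_ideal_smult[OF L] by (simp add: smult_add_left flip: smult_smult)
  then show "ideal_map I \<in> sat_her \<Lambda> \<rightarrow>\<^sub>E ring_ideals" unfolding ideal_map_def by simp
  fix \<A> assume \<A>: "\<A> \<subseteq> sat_her \<Lambda>"
  have join: "sh_join \<Lambda> \<A> \<in> sat_her \<Lambda>"
    by (rule sh_join_sat_her) (use \<A> sat_herD(1) in blast)
  have "ideal_map I (sh_join \<Lambda> \<A>) = {r. \<forall>v\<in>sh_join \<Lambda> \<A>. r \<cdot> free_p v \<in> ideal_lift I}"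
    using join by (simp add: ideal_map_def)
  also have "\<dots> = (\<Inter>H\<in>\<A>. {r. \<forall>v\<in>H. r \<cdot> free_p v \<in> ideal_lift I})"
  proof
    show "{r. \<forall>v\<in>sh_join \<Lambda> \<A>. r \<cdot> free_p v \<in> ideal_lift I} \<subseteq> (\<Inter>H\<in>\<A>. {r. \<forall>v\<in>H. r \<cdot> free_p v \<in> ideal_lift I})"
      using sh_join_upper[of _ \<A>] by blast
    show "(\<Inter>H\<in>\<A>. {r. \<forall>v\<in>H. r \<cdot> free_p v \<in> ideal_lift I}) \<subseteq> {r. \<forall>v\<in>sh_join \<Lambda> \<A>. r \<cdot> free_p v \<in> ideal_lift I}"
    proof
      fix r assume r: "r \<in> (\<Inter>H\<in>\<A>. {r. \<forall>v\<in>H. r \<cdot> free_p v \<in> ideal_lift I})"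
      \<comment> \<open>For fixed \<open>r\<close> the vertices that \<open>r\<close> multiplies
        into the ideal form a saturated hereditary set, so once it contains all members of
        \<open>\<A>\<close> it contains their join.\<close>
      have "sh_join \<Lambda> \<A> \<subseteq> {v \<in> obj \<Lambda>. r \<cdot> free_p v \<in> ideal_lift I}"
      proof (rule sh_join_least[OF coefficient_sat_her[OF L]])
        fix H assume H: "H \<in> \<A>"
        then have "H \<subseteq> obj \<Lambda>" using \<A> sat_herD(1) by blast
        then show "H \<subseteq> {v \<in> obj \<Lambda>. r \<cdot> free_p v \<in> ideal_lift I}" using r H by blast
      qed
      then show "r \<in> {r. \<forall>v\<in>sh_join \<Lambda> \<A>. r \<cdot> free_p v \<in> ideal_lift I}" by blast
    qed
  qed
  also have "\<dots> = (\<Inter>H\<in>\<A>. ideal_map I H)"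
    using \<A> by (intro INF_cong refl) (auto simp: ideal_map_def)
  finally show "ideal_map I (sh_join \<Lambda> \<A>) = (\<Inter>H\<in>\<A>. ideal_map I H)" .
qed

lemma bij_betw_kp_Gamma:
  assumes SA: "strongly_aperiodic \<Lambda>"
  shows "bij_betw (kp_Gamma \<Lambda>) (join_maps \<Lambda>)
    (aideals (KP \<Lambda> :: ('r::{comm_ring, comm_monoid_mult}, ('m, 'r) kp_free set) nalg))"
proof (rule bij_betw_imageI)
  show "inj_on (kp_Gamma \<Lambda>) (join_maps \<Lambda> :: ('m set \<Rightarrow> 'r set) set)"
  proof (rule inj_onI)
    fix \<pi> \<rho> :: "'m set \<Rightarrow> 'r set"
    assume \<pi>: "\<pi> \<in> join_maps \<Lambda>" and \<rho>: "\<rho> \<in> join_maps \<Lambda>" and eq: "kp_Gamma \<Lambda> \<pi> = kp_Gamma \<Lambda> \<rho>"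
    show "\<pi> = \<rho>"
    proof (rule PiE_ext)
      show "\<pi> \<in> sat_her \<Lambda> \<rightarrow>\<^sub>E ring_ideals" "\<rho> \<in> sat_her \<Lambda> \<rightarrow>\<^sub>E ring_ideals"
        using \<pi> \<rho> unfolding join_maps_def by simp_all
      show "\<pi> H = \<rho> H" if "H \<in> sat_her \<Lambda>" for H
        unfolding kp_Gamma_join_map(2)[OF \<pi> SA that] kp_Gamma_join_map(2)[OF \<rho> SA that] eq ..
    qed
  qed
  show "kp_Gamma \<Lambda> ` join_maps \<Lambda> = aideals (KP \<Lambda> :: ('r, ('m, 'r) kp_free set) nalg)"
  proof
    show "kp_Gamma \<Lambda> ` join_maps \<Lambda> \<subseteq> aideals (KP \<Lambda> :: ('r, ('m, 'r) kp_free set) nalg)"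
      using kp_Gamma_join_map(1)[OF _ SA] by (rule image_subsetI)
    show "aideals (KP \<Lambda> :: ('r, ('m, 'r) kp_free set) nalg) \<subseteq> kp_Gamma \<Lambda> ` join_maps \<Lambda>"
    proof
      fix I :: "('m, 'r) kp_free set set" assume I: "I \<in> aideals (KP \<Lambda>)"
      have "kp_Gamma \<Lambda> (ideal_map I) = I"
        by (rule kp_Gamma_eq[OF SA I]) (simp add: ideal_map_def)
      then show "I \<in> kp_Gamma \<Lambda> ` join_maps \<Lambda>"
        using ideal_map_join_maps[OF I] by (metis imageI)
    qed
  qed
qed

end

theorem theorem6p3:
  fixes \<Lambda> :: "('m, 'k::finite) kgraph"
  assumes "kgraph \<Lambda>" and "row_finite \<Lambda>" and "no_sources \<Lambda>"
    and "strongly_aperiodic \<Lambda>"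
  shows "(\<forall>I \<in> aideals (KP \<Lambda> :: ('r::{comm_ring, comm_monoid_mult}, ('m, 'r) kp_free set) nalg).
            I = aspan (KP \<Lambda>) {asmult (KP \<Lambda>) r (kp_st \<Lambda> x y) | r x y.
                  x \<in> mor \<Lambda> \<and> y \<in> mor \<Lambda> \<and> asmult (KP \<Lambda>) r (kp_p \<Lambda> (src \<Lambda> y)) \<in> I})
       \<and> bij_betw (kp_Gamma \<Lambda>) (join_maps \<Lambda>)
            (aideals (KP \<Lambda> :: ('r, ('m, 'r) kp_free set) nalg))
       \<and> (\<forall>\<pi>\<^sub>1 \<in> (join_maps \<Lambda> :: ('m set \<Rightarrow> 'r set) set). \<forall>\<pi>\<^sub>2 \<in> join_maps \<Lambda>.
            kp_Gamma \<Lambda> \<pi>\<^sub>1 \<subseteq> kp_Gamma \<Lambda> \<pi>\<^sub>2 \<longleftrightarrow> (\<forall>H \<in> sat_her \<Lambda>. \<pi>\<^sub>1 H \<subseteq> \<pi>\<^sub>2 H))"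
proof -
  interpret kp_graph \<Lambda>
    by (intro kp_graph.intro kp_graph_axioms.intro assms(1,2))
  show ?thesis
    by (intro conjI ballI ideal_eq_aspan bij_betw_kp_Gamma kp_Gamma_subset_iff assms(4))
qed

end
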